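(* A commutative ring $R$ with identity is a general Krull ring if and only if every nonprincipal prime ideal of $R$ contains a $u$-invertible prime ideal.
   Context: All rings are commutative with nonzero identity. $T(R)$ is the total quotient ring of $R$; a regular element is a non-zero-divisor; an ideal is regular if it contains a regular element. For an $R$-submodule $I$ of $T(R)$, $I^{-1} = \{x \in T(R) : xI \subseteq R\}$. Let $\mathrm{rGV}(R)$ be the set of finitely generated regular ideals $J$ of $R$ with $J^{-1} = R$. For an $R$-submodule $I$ of $T(R)$, $I_u = \{x \in T(R) : xJ \subseteq I \text{ for some } J \in \mathrm{rGV}(R)\}$. $I$ is $u$-invertible if $(II^{-1})_u = R$. A special primary ring (SPR) is a local ring whose maximal ideal $M$ is principal and satisfies $M^n = (0)$ for some $n \geq 1$ (so a field is an SPR). A general Krull ring is a finite direct product of Krull domains and SPRs (a field counts as a Krull domain). *)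

theory Defs
  imports "HOL-Algebra.Algebra"
begin

section \<open>Total quotient ring\<close>

definition regular_elements :: "('a, 'm) ring_scheme \<Rightarrow> 'a set" where
  "regular_elements R =
     {s \<in> carrier R. \<forall>x \<in> carrier R. s \<otimes>\<^bsub>R\<^esub> x = \<zero>\<^bsub>R\<^esub> \<longrightarrow> x = \<zero>\<^bsub>R\<^esub>}"

text \<open>The fraction \<open>a/s\<close> is the class of all pairs \<open>(b, t)\<close> with \<open>t\<close> regular and \<open>a t = b s\<close>;
  denominators being regular, no further multiplier is needed in this equation.\<close>

definition tq_frac :: "('a, 'm) ring_scheme \<Rightarrow> 'a \<Rightarrow> 'a \<Rightarrow> ('a \<times> 'a) set" where
  "tq_frac R a s = {(b, t). b \<in> carrier R \<and> t \<in> regular_elements R \<and> a \<otimes>\<^bsub>R\<^esub> t = b \<otimes>\<^bsub>R\<^esub> s}"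

text \<open>The unions below run over all representatives of the two classes; every term of such a union
  is the same class (see \<open>tq_frac_mult\<close> and \<open>tq_frac_add\<close>).\<close>

definition total_quotient_ring :: "('a, 'm) ring_scheme \<Rightarrow> ('a \<times> 'a) set ring" where
  "total_quotient_ring R =
     \<lparr> carrier = {tq_frac R a s | a s. a \<in> carrier R \<and> s \<in> regular_elements R},
       monoid.mult = (\<lambda>A B. \<Union>(a, s) \<in> A. \<Union>(b, t) \<in> B. tq_frac R (a \<otimes>\<^bsub>R\<^esub> b) (s \<otimes>\<^bsub>R\<^esub> t)),
       one = tq_frac R \<one>\<^bsub>R\<^esub> \<one>\<^bsub>R\<^esub>,
       ring.zero = tq_frac R \<zero>\<^bsub>R\<^esub> \<one>\<^bsub>R\<^esub>,
       add = (\<lambda>A B. \<Union>(a, s) \<in> A. \<Union>(b, t) \<in> B.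
                tq_frac R (a \<otimes>\<^bsub>R\<^esub> t \<oplus>\<^bsub>R\<^esub> b \<otimes>\<^bsub>R\<^esub> s) (s \<otimes>\<^bsub>R\<^esub> t)) \<rparr>"

definition tq_embed :: "('a, 'm) ring_scheme \<Rightarrow> 'a \<Rightarrow> ('a \<times> 'a) set" where
  "tq_embed R a = tq_frac R a \<one>\<^bsub>R\<^esub>"

lemma (in cring) regular_elements_one: "\<one> \<in> regular_elements R"
  by (simp add: regular_elements_def)

lemma (in cring) regular_elements_closed:
  assumes "s \<in> regular_elements R" "t \<in> regular_elements R"
  shows "s \<otimes> t \<in> regular_elements R"
proof -
  have c: "s \<in> carrier R" "t \<in> carrier R"
    and s: "\<And>x. \<lbrakk>x \<in> carrier R; s \<otimes> x = \<zero>\<rbrakk> \<Longrightarrow> x = \<zero>"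
    and t: "\<And>x. \<lbrakk>x \<in> carrier R; t \<otimes> x = \<zero>\<rbrakk> \<Longrightarrow> x = \<zero>"
    using assms unfolding regular_elements_def by blast+
  have "x = \<zero>" if x: "x \<in> carrier R" "(s \<otimes> t) \<otimes> x = \<zero>" for x
    using t[OF x(1)] s[of "t \<otimes> x"] x c by (simp only: m_assoc m_closed)
  thus ?thesis unfolding regular_elements_def using c by blast
qed

lemma (in cring) regular_elements_cancel:
  assumes "s \<in> regular_elements R" "x \<in> carrier R" "y \<in> carrier R" "x \<otimes> s = y \<otimes> s"
  shows "x = y"
proof -
  have s: "s \<in> carrier R" using assms(1) by (simp add: regular_elements_def)
  have "s \<otimes> (x \<ominus> y) = x \<otimes> s \<ominus> y \<otimes> s" using assms(2,3) s by algebra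
  also have "\<dots> = \<zero>" using assms s by (simp add: r_right_minus_eq)
  finally have "x \<ominus> y = \<zero>" using assms by (simp add: regular_elements_def)
  thus ?thesis using assms by (simp add: r_right_minus_eq)
qed

lemma (in cring) tq_frac_eq_iff:
  assumes "a \<in> carrier R" "s \<in> regular_elements R" "b \<in> carrier R" "t \<in> regular_elements R"
  shows "tq_frac R a s = tq_frac R b t \<longleftrightarrow> a \<otimes> t = b \<otimes> s"
proof
  assume "tq_frac R a s = tq_frac R b t"
  moreover have "(b, t) \<in> tq_frac R b t" using assms by (simp add: tq_frac_def)
  ultimately have "(b, t) \<in> tq_frac R a s" by simp
  thus "a \<otimes> t = b \<otimes> s" by (simp add: tq_frac_def)
next
  assume eq: "a \<otimes> t = b \<otimes> s"
  have c: "s \<in> carrier R" "t \<in> carrier R" using assms by (auto simp: regular_elements_def)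
  have "a \<otimes> v = u \<otimes> s \<longleftrightarrow> b \<otimes> v = u \<otimes> t"
    if u: "u \<in> carrier R" and v: "v \<in> regular_elements R" for u v
  proof -
    have v': "v \<in> carrier R" using v by (simp add: regular_elements_def)
    have 1: "(b \<otimes> v) \<otimes> s = (a \<otimes> v) \<otimes> t"
      using assms(1,3) c v' eq by (metis m_assoc m_comm)
    have 2: "(u \<otimes> t) \<otimes> s = (u \<otimes> s) \<otimes> t" using u c by (simp add: m_ac)
    show ?thesis
    proof
      assume "a \<otimes> v = u \<otimes> s"
      hence "(b \<otimes> v) \<otimes> s = (u \<otimes> t) \<otimes> s" using 1 2 by simp
      thus "b \<otimes> v = u \<otimes> t" by (rule regular_elements_cancel[OF assms(2), rotated -1])
          (use assms u v' c in auto)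
    next
      assume "b \<otimes> v = u \<otimes> t"
      hence "(a \<otimes> v) \<otimes> t = (u \<otimes> s) \<otimes> t" using 1 2 by simp
      thus "a \<otimes> v = u \<otimes> s" by (rule regular_elements_cancel[OF assms(4), rotated -1])
          (use assms u v' c in auto)
    qed
  qed
  thus "tq_frac R a s = tq_frac R b t" by (auto simp: tq_frac_def)
qed

lemma UN_pairs_const:
  assumes "p \<in> A" "q \<in> B"
    and "\<And>a s b t. \<lbrakk>(a, s) \<in> A; (b, t) \<in> B\<rbrakk> \<Longrightarrow> f a s b t = C"
  shows "(\<Union>(a, s) \<in> A. \<Union>(b, t) \<in> B. f a s b t) = C"
proof -
  have "(\<Union>(a, s) \<in> A. \<Union>(b, t) \<in> B. f a s b t) = (\<Union>x \<in> A. \<Union>y \<in> B. C)"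
    using assms(3) by (intro SUP_cong refl) (auto split: prod.splits)
  thus ?thesis using assms(1,2) by auto
qed

lemma (in cring) tq_frac_mult:
  assumes "a \<in> carrier R" "s \<in> regular_elements R" "b \<in> carrier R" "t \<in> regular_elements R"
  shows "tq_frac R a s \<otimes>\<^bsub>total_quotient_ring R\<^esub> tq_frac R b t = tq_frac R (a \<otimes> b) (s \<otimes> t)"
proof -
  have c: "s \<in> carrier R" "t \<in> carrier R" using assms by (auto simp: regular_elements_def)
  have "tq_frac R (a' \<otimes> b') (s' \<otimes> t') = tq_frac R (a \<otimes> b) (s \<otimes> t)"
    if "(a', s') \<in> tq_frac R a s" "(b', t') \<in> tq_frac R b t" for a' s' b' t'
  proof -
    have m: "a' \<in> carrier R" "s' \<in> regular_elements R" "b' \<in> carrier R" "t' \<in> regular_elements R"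
      and e: "a \<otimes> s' = a' \<otimes> s" "b \<otimes> t' = b' \<otimes> t" using that by (auto simp: tq_frac_def)
    have c': "s' \<in> carrier R" "t' \<in> carrier R" using m by (auto simp: regular_elements_def)
    have "(a' \<otimes> b') \<otimes> (s \<otimes> t) = (a' \<otimes> s) \<otimes> (b' \<otimes> t)" using m c by (simp add: m_ac)
    also have "\<dots> = (a \<otimes> s') \<otimes> (b \<otimes> t')" using e by simp
    also have "\<dots> = (a \<otimes> b) \<otimes> (s' \<otimes> t')" using assms c' by (simp add: m_ac)
    finally show ?thesis
      using assms m by (subst tq_frac_eq_iff) (auto intro: regular_elements_closed)
  qed
  moreover have "(a, s) \<in> tq_frac R a s" "(b, t) \<in> tq_frac R b t" using assms by (auto simp: tq_frac_def)
  ultimately show ?thesis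
    unfolding total_quotient_ring_def monoid.simps ring.simps by (intro UN_pairs_const)
qed

lemma (in cring) tq_frac_add:
  assumes "a \<in> carrier R" "s \<in> regular_elements R" "b \<in> carrier R" "t \<in> regular_elements R"
  shows "tq_frac R a s \<oplus>\<^bsub>total_quotient_ring R\<^esub> tq_frac R b t = tq_frac R (a \<otimes> t \<oplus> b \<otimes> s) (s \<otimes> t)"
proof -
  have c: "s \<in> carrier R" "t \<in> carrier R" using assms by (auto simp: regular_elements_def)
  have "tq_frac R (a' \<otimes> t' \<oplus> b' \<otimes> s') (s' \<otimes> t') = tq_frac R (a \<otimes> t \<oplus> b \<otimes> s) (s \<otimes> t)"
    if "(a', s') \<in> tq_frac R a s" "(b', t') \<in> tq_frac R b t" for a' s' b' t'
  proof -
    have m: "a' \<in> carrier R" "s' \<in> regular_elements R" "b' \<in> carrier R" "t' \<in> regular_elements R"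
      and e: "a \<otimes> s' = a' \<otimes> s" "b \<otimes> t' = b' \<otimes> t" using that by (auto simp: tq_frac_def)
    have c': "s' \<in> carrier R" "t' \<in> carrier R" using m by (auto simp: regular_elements_def)
    have "(a' \<otimes> t' \<oplus> b' \<otimes> s') \<otimes> (s \<otimes> t) = (a' \<otimes> s) \<otimes> (t \<otimes> t') \<oplus> (b' \<otimes> t) \<otimes> (s \<otimes> s')"
      using m c c' by algebra
    also have "\<dots> = (a \<otimes> s') \<otimes> (t \<otimes> t') \<oplus> (b \<otimes> t') \<otimes> (s \<otimes> s')" using e by simp
    also have "\<dots> = (a \<otimes> t \<oplus> b \<otimes> s) \<otimes> (s' \<otimes> t')" using assms c c' by algebra
    finally show ?thesis
      using assms m c c' by (subst tq_frac_eq_iff) (auto intro: regular_elements_closed)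
  qed
  moreover have "(a, s) \<in> tq_frac R a s" "(b, t) \<in> tq_frac R b t" using assms by (auto simp: tq_frac_def)
  ultimately show ?thesis
    unfolding total_quotient_ring_def monoid.simps ring.simps by (intro UN_pairs_const)
qed


section \<open>The \<open>u\<close>-operation\<close>

text \<open>Submodules of \<open>T(R)\<close> are sets of fractions; an ideal \<open>I\<close> of \<open>R\<close> enters as
  \<open>tq_embed R ` I\<close>, and \<open>R\<close> itself as \<open>tq_embed R ` carrier R\<close>.\<close>

definition tq_inverse :: "('a, 'm) ring_scheme \<Rightarrow> ('a \<times> 'a) set set \<Rightarrow> ('a \<times> 'a) set set" where
  "tq_inverse R I =
     {x \<in> carrier (total_quotient_ring R).
        \<forall>y \<in> I. x \<otimes>\<^bsub>total_quotient_ring R\<^esub> y \<in> tq_embed R ` carrier R}"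

definition rGV :: "('a, 'm) ring_scheme \<Rightarrow> 'a set set" where
  "rGV R = {J. ideal J R
             \<and> (\<exists>A \<subseteq> carrier R. finite A \<and> J = Idl\<^bsub>R\<^esub> A)
             \<and> J \<inter> regular_elements R \<noteq> {}
             \<and> tq_inverse R (tq_embed R ` J) = tq_embed R ` carrier R}"

definition u_closure :: "('a, 'm) ring_scheme \<Rightarrow> ('a \<times> 'a) set set \<Rightarrow> ('a \<times> 'a) set set" where
  "u_closure R I =
     {x \<in> carrier (total_quotient_ring R).
        \<exists>J \<in> rGV R. \<forall>j \<in> J. x \<otimes>\<^bsub>total_quotient_ring R\<^esub> tq_embed R j \<in> I}"

text \<open>\<^const>\<open>ideal_prod\<close> collects the nonempty finite sums of products \<open>x y\<close>; taken inside \<open>T(R)\<close> it is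
  the product of \<open>R\<close>-submodules, not only of ideals of \<open>T(R)\<close>.\<close>

definition u_invertible :: "('a, 'm) ring_scheme \<Rightarrow> ('a \<times> 'a) set set \<Rightarrow> bool" where
  "u_invertible R I \<longleftrightarrow>
     u_closure R (ideal_prod (total_quotient_ring R) I (tq_inverse R I)) = tq_embed R ` carrier R"


section \<open>General Krull rings\<close>

text \<open>The zero ring has no maximal ideal, so it is not local.\<close>

definition local_ring :: "('a, 'm) ring_scheme \<Rightarrow> bool" where
  "local_ring R \<longleftrightarrow> cring R \<and> (\<exists>!M. maximalideal M R)"

definition discrete_valuation_ring :: "('a, 'm) ring_scheme \<Rightarrow> bool" where
  "discrete_valuation_ring V \<longleftrightarrow> principal_domain V \<and> local_ring V \<and> \<not> field V"

text \<open>A Krull domain is an intersection, with finite character, of discrete valuation overrings inside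
  its quotient field. The empty family is allowed, its intersection being the quotient field, so a
  field is a Krull domain.\<close>

definition krull_domain :: "('a, 'm) ring_scheme \<Rightarrow> bool" where
  "krull_domain D \<longleftrightarrow> domain D \<and>
     (let K = total_quotient_ring D in
      \<exists>\<V>. (\<forall>V \<in> \<V>. subring V K \<and> tq_embed D ` carrier D \<subseteq> V
                     \<and> discrete_valuation_ring (K\<lparr>carrier := V\<rparr>))
         \<and> tq_embed D ` carrier D = carrier K \<inter> \<Inter>\<V>
         \<and> (\<forall>x \<in> carrier D - {\<zero>\<^bsub>D\<^esub>}.
              finite {V \<in> \<V>. tq_embed D x \<notin> Units (K\<lparr>carrier := V\<rparr>)}))"

definition special_primary_ring :: "('a, 'm) ring_scheme \<Rightarrow> bool" where
  "special_primary_ring R \<longleftrightarrow> local_ring R \<and>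
     (\<exists>M. maximalideal M R \<and> principalideal M R
        \<and> (\<exists>n::nat. n \<ge> 1 \<and> M [^]\<^bsub>ideals_set R\<^esub> n = {\<zero>\<^bsub>R\<^esub>}))"

text \<open>Each direct factor of \<open>R\<close> embeds, as a set, in \<open>carrier R\<close>, so it is no restriction to take the
  factors over the element type of \<open>R\<close>.\<close>

definition general_krull_ring :: "('a, 'm) ring_scheme \<Rightarrow> bool" where
  "general_krull_ring R \<longleftrightarrow> cring R \<and>
     (\<exists>Ss :: 'a ring list. (\<forall>S \<in> set Ss. krull_domain S \<or> special_primary_ring S)
        \<and> R \<simeq> RDirProd_list Ss)"

end

theory Submission
  imports Defs
begin

text \<open>
  Write \<open>GV\<close> for the ideals in \<^const>\<open>rGV\<close>, and call a \<open>u\<close>-invertible prime good if it contains no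
  \<open>GV\<close>-ideal. Assume that every nonprincipal prime contains a \<open>u\<close>-invertible prime. A Zorn argument
  shows that every regular ideal contains a product \<open>J Q\<^sub>1 \<cdots> Q\<^sub>n\<close> with \<open>J\<close> in \<open>GV\<close> and good \<open>Q\<^sub>i\<close>;
  consequently a fraction that lies in \<open>R\<close> locally at every good prime lies in \<open>R\<close>. In a domain this
  exhibits \<open>R\<close> as an intersection, of finite character, of the discrete valuation rings \<open>R\<^sub>Q\<close>.
  In general every minimal prime is principal, and the local criterion puts into \<open>R\<close> an idempotent
  of \<open>T(R)\<close> attached to it. The corresponding direct factor is a domain or an SPR, and by
  compactness finitely many of these factors exhaust \<open>R\<close>.

  Conversely, in a Krull domain every nonzero ideal is \<open>u\<close>-invertible, and \<open>u\<close>-invertibility passes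
  from a direct factor to the preimage in \<open>R\<close>. So a nonprincipal prime of a general Krull ring is
  itself \<open>u\<close>-invertible.
\<close>

section \<open>Ideals of commutative rings\<close>

text \<open>For regular \<open>s\<close> the fraction \<open>a/s\<close> lies in \<open>R\<close>
  iff \<open>s divides a\<close>. Stated with divisibility, nearly all arguments stay inside
  \<open>R\<close>; \<open>T(R)\<close> serves to match the definitions and to house valuation
  rings.

  Good primes matter because some element of \<open>Q Q^-1\<close> lies outside a good
  \<open>Q\<close>, and it makes \<open>Q\<close> principal in the localization at \<open>Q\<close>.
  A \<open>u\<close>-invertible prime containing a GV-ideal is invisible to the
  \<open>u\<close>-operation, and \<open>J\<close> absorbs it.

  The obstacle is zero divisors. A \<open>u\<close>-invertible ideal contains a regular element, a
  minimal prime does not; so about a minimal prime \<open>P\<close> the hypothesis says only that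
  \<open>P = (p)\<close>. What ties \<open>p\<close> to the primes above is annihilation: if a prime
  properly containing \<open>P\<close> is good or principal, some element outside it kills
  \<open>p\<close>. Hence no prime free of regular elements contains both \<open>p^n\<close> and its
  annihilator, once an element outside \<open>P\<close> kills \<open>p^n\<close>, and a regular
  element of the sum of these two ideals produces the idempotent. The factor is a domain if
  \<open>n = 1\<close> can be taken, and an SPR otherwise.\<close>

context cring
begin

lemma idealI_cring:
  assumes "I \<subseteq> carrier R" "\<zero> \<in> I"
    and "\<And>a b. \<lbrakk>a \<in> I; b \<in> I\<rbrakk> \<Longrightarrow> a \<oplus> b \<in> I"
    and "\<And>a x. \<lbrakk>a \<in> I; x \<in> carrier R\<rbrakk> \<Longrightarrow> x \<otimes> a \<in> I"
  shows "ideal I R"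
proof (rule idealI)
  show "ring R" by (rule ring_axioms)
  have "\<ominus> a \<in> I" if "a \<in> I" for a
    using assms(4)[OF that, of "\<ominus> \<one>"] that assms(1) by (auto simp: l_minus)
  thus "subgroup I (add_monoid R)"
    using assms by (intro add.subgroupI) (auto simp: a_inv_def)
qed (use assms m_comm in \<open>auto simp: subset_iff\<close>)

lemma idealD:
  assumes "ideal I R"
  shows "x \<in> I \<Longrightarrow> x \<in> carrier R" "\<zero> \<in> I"
    "\<lbrakk>x \<in> I; y \<in> I\<rbrakk> \<Longrightarrow> x \<oplus> y \<in> I"
    "\<lbrakk>x \<in> I; y \<in> I\<rbrakk> \<Longrightarrow> x \<ominus> y \<in> I"
    "\<lbrakk>r \<in> carrier R; x \<in> I\<rbrakk> \<Longrightarrow> r \<otimes> x \<in> I"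
    "\<lbrakk>r \<in> carrier R; x \<in> I\<rbrakk> \<Longrightarrow> x \<otimes> r \<in> I"
proof -
  interpret I: ideal I R by fact
  show "x \<in> I \<Longrightarrow> x \<in> carrier R" by (rule I.Icarr)
  show "\<zero> \<in> I" by simp
  show "\<lbrakk>x \<in> I; y \<in> I\<rbrakk> \<Longrightarrow> x \<oplus> y \<in> I" by simp
  show "\<lbrakk>x \<in> I; y \<in> I\<rbrakk> \<Longrightarrow> x \<ominus> y \<in> I" by (simp add: a_minus_def)
  show "\<lbrakk>r \<in> carrier R; x \<in> I\<rbrakk> \<Longrightarrow> r \<otimes> x \<in> I" by (rule I.I_l_closed)
  show "\<lbrakk>r \<in> carrier R; x \<in> I\<rbrakk> \<Longrightarrow> x \<otimes> r \<in> I" by (rule I.I_r_closed)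
qed

lemma primeidealD:
  assumes "primeideal P R"
  shows "ideal P R" "\<one> \<notin> P" "P \<noteq> carrier R"
    "\<lbrakk>a \<in> carrier R; b \<in> carrier R; a \<otimes> b \<in> P\<rbrakk> \<Longrightarrow> a \<in> P \<or> b \<in> P"
proof -
  interpret P: primeideal P R by fact
  show "ideal P R" by (rule P.is_ideal)
  show "\<one> \<notin> P" using P.one_imp_carrier P.I_notcarr by blast
  show "P \<noteq> carrier R" using P.I_notcarr by blast
  show "\<lbrakk>a \<in> carrier R; b \<in> carrier R; a \<otimes> b \<in> P\<rbrakk> \<Longrightarrow> a \<in> P \<or> b \<in> P" by (rule P.I_prime)
qed

lemma primeideal_pow:
  assumes "primeideal P R" "a \<in> carrier R" "a [^] (n::nat) \<in> P"
  shows "a \<in> P"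
  using assms(3)
proof (induction n)
  case 0 thus ?case using primeidealD(2)[OF assms(1)] by simp
next
  case (Suc n) thus ?case using primeidealD(4)[OF assms(1), of "a [^] n" a] assms(2) by auto
qed

text \<open>For regular \<open>s\<close> this is the denominator ideal of \<open>a/s\<close>, the
  set of all \<open>d\<close> with \<open>d (a/s)\<close> in \<open>R\<close>. Being an ideal, it
  contains all that a set generates once it contains the set; this is how divisibility passes from
  generators to ideals.\<close>

lemma divides_ideal:
  assumes "s \<in> carrier R" "a \<in> carrier R"
  shows "ideal {d \<in> carrier R. s divides (a \<otimes> d)} R"
proof (rule idealI_cring)
  show "\<zero> \<in> {d \<in> carrier R. s divides (a \<otimes> d)}"
    using assms by (auto intro!: dividesI[of \<zero>])
next
  fix x y assume "x \<in> {d \<in> carrier R. s divides (a \<otimes> d)}" "y \<in> {d \<in> carrier R. s divides (a \<otimes> d)}"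
  then obtain c d where "x \<in> carrier R" "y \<in> carrier R" "c \<in> carrier R" "d \<in> carrier R"
    "a \<otimes> x = s \<otimes> c" "a \<otimes> y = s \<otimes> d" by (auto simp: factor_def)
  thus "x \<oplus> y \<in> {d \<in> carrier R. s divides (a \<otimes> d)}"
    using assms by (auto simp: r_distr intro!: dividesI[of "c \<oplus> d"])
next
  fix x r assume "x \<in> {d \<in> carrier R. s divides (a \<otimes> d)}" "r \<in> carrier R"
  then obtain c where "x \<in> carrier R" "r \<in> carrier R" "c \<in> carrier R"  "a \<otimes> x = s \<otimes> c"
    by (auto simp: factor_def)
  moreover from this have "a \<otimes> (r \<otimes> x) = s \<otimes> (r \<otimes> c)" using assms
    by (metis m_lcomm)
  ultimately show "r \<otimes> x \<in> {d \<in> carrier R. s divides (a \<otimes> d)}"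
    using assms by (auto intro!: dividesI[of "r \<otimes> c"])
qed auto

text \<open>This is the ideal \<open>I + (a)\<close>; the explicit form lets two such ideals be
  multiplied elementwise.\<close>

definition adjoin :: "'a set \<Rightarrow> 'a \<Rightarrow> 'a set" where
  "adjoin I a = {x \<oplus> r \<otimes> a | x r. x \<in> I \<and> r \<in> carrier R}"

lemma adjoin:
  assumes "ideal I R" "a \<in> carrier R"
  shows "ideal (adjoin I a) R" "I \<subseteq> adjoin I a" "a \<in> adjoin I a"
proof -
  note I = idealD[OF assms(1)]
  show "ideal (adjoin I a) R"
  proof (rule idealI_cring)
    show "\<zero> \<in> adjoin I a" unfolding adjoin_def using I(2) assms(2)
      by (auto intro!: exI[of _ \<zero>])
  next
    fix x y assume "x \<in> adjoin I a" "y \<in> adjoin I a"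
    then obtain u r v t where h: "x = u \<oplus> r \<otimes> a" "y = v \<oplus> t \<otimes> a" "u \<in> I" "v \<in> I"
      "r \<in> carrier R" "t \<in> carrier R" by (auto simp: adjoin_def)
    moreover have "u \<in> carrier R" "v \<in> carrier R" using h I by auto
    ultimately have "x \<oplus> y = (u \<oplus> v) \<oplus> (r \<oplus> t) \<otimes> a" using assms(2) by algebra
    thus "x \<oplus> y \<in> adjoin I a" unfolding adjoin_def using h I by blast
  next
    fix x y assume "x \<in> adjoin I a" "y \<in> carrier R"
    then obtain u r where h: "x = u \<oplus> r \<otimes> a" "u \<in> I" "r \<in> carrier R" "y \<in> carrier R"
      by (auto simp: adjoin_def)
    moreover have "u \<in> carrier R" using h I by auto
    ultimately have "y \<otimes> x = y \<otimes> u \<oplus> (y \<otimes> r) \<otimes> a"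
      using assms(2) by (simp add: r_distr m_assoc)
    moreover have "y \<otimes> u \<in> I" "y \<otimes> r \<in> carrier R" using h I(5) by auto
    ultimately show "y \<otimes> x \<in> adjoin I a" unfolding adjoin_def by blast
  next
    show "adjoin I a \<subseteq> carrier R" using I(1) assms(2) unfolding adjoin_def by blast
  qed
  show "I \<subseteq> adjoin I a"
  proof
    fix x assume "x \<in> I"
    moreover have "x = x \<oplus> \<zero> \<otimes> a" using I(1)[OF \<open>x \<in> I\<close>] assms by simp
    ultimately show "x \<in> adjoin I a" unfolding adjoin_def by blast
  qed
  have "a = \<zero> \<oplus> \<one> \<otimes> a" using assms by simp
  thus "a \<in> adjoin I a" unfolding adjoin_def using I(2) by blast
qed

section \<open>Prime, maximal and minimal prime ideals from Zorn's lemma\<close>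

lemma Union_chain_ideal:
  assumes "C \<noteq> {}" "\<And>L. L \<in> C \<Longrightarrow> ideal L R" "\<And>L M. \<lbrakk>L \<in> C; M \<in> C\<rbrakk> \<Longrightarrow> L \<subseteq> M \<or> M \<subseteq> L"
  shows "ideal (\<Union>C) R"
proof (rule idealI_cring)
  show "\<Union>C \<subseteq> carrier R" using idealD(1)[OF assms(2)] by blast
  show "\<zero> \<in> \<Union>C" using assms(1) idealD(2)[OF assms(2)] by blast
  show "a \<oplus> b \<in> \<Union>C" if ab: "a \<in> \<Union>C" "b \<in> \<Union>C" for a b
  proof -
    obtain L M where LM: "L \<in> C" "M \<in> C" "a \<in> L" "b \<in> M" using ab by blast
    then obtain N where "N \<in> C" "a \<in> N" "b \<in> N" using assms(3)[OF LM(1,2)] by blast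
    thus ?thesis using idealD(3)[OF assms(2)] by blast
  qed
  show "x \<otimes> a \<in> \<Union>C" if "a \<in> \<Union>C" "x \<in> carrier R" for a x
    using that idealD(5)[OF assms(2)] by blast
qed

text \<open>Among the ideals over \<open>I\<close> that fail \<open>F\<close>, Zorn's lemma gives a
  maximal one. Condition \<open>fin\<close> says that finitely many elements already force
  \<open>F\<close>, so the union of a chain of failing ideals fails. If \<open>a\<close> and
  \<open>b\<close> are outside the maximal \<open>P\<close>, then \<open>F\<close> holds for
  \<open>P + (a)\<close> and \<open>P + (b)\<close>, and \<open>ab\<close> in \<open>P\<close> would
  put their product into \<open>P\<close>; so \<open>prod\<close> makes \<open>P\<close> prime. The
  instances of \<open>F\<close> are meeting a multiplicative set, containing \<open>\<one>\<close>,
  and \<open>u_factored\<close>.\<close>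

lemma prime_ideal_principle:
  fixes F :: "'a set \<Rightarrow> bool"
  assumes I: "ideal I R" "\<not> F I"
    and top: "F (carrier R)"
    and fin: "\<And>L. \<lbrakk>ideal L R; F L\<rbrakk> \<Longrightarrow> \<exists>B. finite B \<and> B \<subseteq> L \<and> (\<forall>M. ideal M R \<longrightarrow> B \<subseteq> M \<longrightarrow> F M)"
    and prod: "\<And>L M N. \<lbrakk>ideal L R; ideal M R; ideal N R; F L; F M; \<forall>x\<in>L. \<forall>y\<in>M. x \<otimes> y \<in> N\<rbrakk> \<Longrightarrow> F N"
  obtains P where "primeideal P R" "I \<subseteq> P" "\<not> F P" "\<And>L. \<lbrakk>ideal L R; P \<subset> L\<rbrakk> \<Longrightarrow> F L"
proof -
  let ?A = "{L. ideal L R \<and> I \<subseteq> L \<and> \<not> F L}"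
  have "\<exists>P\<in>?A .  \<forall>Z\<in>?A .  P \<subseteq> Z \<longrightarrow> Z = P"
  proof (rule subset_Zorn_nonempty)
    show "?A \<noteq> {}" using I by blast
    fix C assume C: "C \<noteq> {}" "subset.chain ?A C"
    have CA: "C \<subseteq> ?A" and lin: "\<And>L M. \<lbrakk>L \<in> C; M \<in> C\<rbrakk> \<Longrightarrow> L \<subseteq> M \<or> M \<subseteq> L"
      using C(2) unfolding subset_chain_def by blast+
    have U: "ideal (\<Union>C) R" by (rule Union_chain_ideal[OF C(1)]) (use CA lin in auto)
    moreover have "\<not> F (\<Union>C)"
    proof
      assume "F (\<Union>C)"
      then obtain B where B: "finite B" "B \<subseteq> \<Union>C" "\<And>M. ideal M R \<Longrightarrow> B \<subseteq> M \<Longrightarrow> F M" using fin[OF U] by blast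
      then obtain M where "M \<in> C" "B \<subseteq> M" using finite_subset_Union_chain[OF B(1,2) C] by blast
      thus False using B(3)[of M] CA by blast
    qed
    moreover have "I \<subseteq> \<Union>C" using C(1) CA by blast
    ultimately show "\<Union>C \<in> ?A" by blast
  qed
  then obtain P where PA: "P \<in> ?A" and Pmax: "\<forall>Z\<in>?A. P \<subseteq> Z \<longrightarrow> Z = P" ..
  have P: "ideal P R" "I \<subseteq> P" "\<not> F P" using PA by auto
  have max: "F L" if "ideal L R" "P \<subset> L" for L
  proof (rule ccontr)
    assume "\<not> F L"
    hence "L \<in> ?A" using that P by auto
    hence "L = P" using Pmax that(2) by blast
    thus False using that(2) by blast
  qed
  have "primeideal P R"
  proof (rule primeidealI)
    show "carrier R \<noteq> P" using top P by blast
    fix a b assume ab: "a \<in> carrier R" "b \<in> carrier R" "a \<otimes> b \<in> P"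
    show "a \<in> P \<or> b \<in> P"
    proof (rule ccontr)
      assume n: "\<not> (a \<in> P \<or> b \<in> P)"
      note A = adjoin[OF P(1) ab(1)] and B = adjoin[OF P(1) ab(2)]
      have F: "F (adjoin P a)" "F (adjoin P b)" using max A B n by blast+
      have "x \<otimes> y \<in> P" if xy: "x \<in> adjoin P a" "y \<in> adjoin P b" for x y
      proof -
        obtain u r v t where h: "x = u \<oplus> r \<otimes> a" "y = v \<oplus> t \<otimes> b" "u \<in> P" "v \<in> P"
          "r \<in> carrier R" "t \<in> carrier R" using xy by (auto simp: adjoin_def)
        note c = idealD[OF P(1)]
        have uv: "u \<in> carrier R" "v \<in> carrier R" using c h by auto
        have "x \<otimes> y = u \<otimes> (v \<oplus> t \<otimes> b) \<oplus> ((r \<otimes> a) \<otimes> v \<oplus> (r \<otimes> t) \<otimes> (a \<otimes> b))"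
          using uv ab h by algebra
        thus ?thesis using c(3,5,6) h uv ab by simp
      qed
      thus False using prod[OF A(1) B(1) P(1) F] P(3) by blast
    qed
  qed (use P is_cring in auto)
  thus ?thesis using that P max by blast
qed

lemma exists_prime_disjoint:
  assumes "ideal I R" "I \<inter> S = {}" "\<one> \<in> S" "S \<subseteq> carrier R" "\<And>s t. \<lbrakk>s \<in> S; t \<in> S\<rbrakk> \<Longrightarrow> s \<otimes> t \<in> S"
  obtains P where "primeideal P R" "I \<subseteq> P" "P \<inter> S = {}"
proof (rule prime_ideal_principle[of I "\<lambda>L. L \<inter> S \<noteq> {}"])
  fix L assume "ideal L R" "L \<inter> S \<noteq> {}"
  then obtain x where "x \<in> L" "x \<in> S" by blast
  thus "\<exists>B. finite B \<and> B \<subseteq> L \<and> (\<forall>M. ideal M R \<longrightarrow> B \<subseteq> M \<longrightarrow> M \<inter> S \<noteq> {})"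
    by (intro exI[of _ "{x}"]) auto
next
  fix L M N assume "L \<inter> S \<noteq> {}" "M \<inter> S \<noteq> {}" "\<forall>x\<in>L. \<forall>y\<in>M. x \<otimes> y \<in> N"
  thus "N \<inter> S \<noteq> {}" using assms(5) by fast
next
  fix P assume "primeideal P R" "I \<subseteq> P" "\<not> P \<inter> S \<noteq> {}"
  thus thesis using that by blast
qed (use assms in auto)

text \<open>For the property of containing \<open>\<one>\<close>, the last clause of the prime ideal
  principle says exactly that \<open>P\<close> is maximal.\<close>

lemma exists_maximal:
  assumes "ideal I R" "\<one> \<notin> I"
  obtains M where "maximalideal M R" "I \<subseteq> M"
proof (rule prime_ideal_principle[of I "\<lambda>L. \<one> \<in> L"])
  fix L assume "\<one> \<in> L"
  thus "\<exists>B. finite B \<and> B \<subseteq> L \<and> (\<forall>M. ideal M R \<longrightarrow> B \<subseteq> M \<longrightarrow> \<one> \<in> M)"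
    by (intro exI[of _ "{\<one>}"]) auto
next
  fix L M N assume "\<one> \<in> L" "\<one> \<in> M" "\<forall>x\<in>L. \<forall>y\<in>M. x \<otimes> y \<in> N"
  thus "\<one> \<in> N" using r_one[OF one_closed] by metis
next
  fix P assume P: "primeideal P R" "I \<subseteq> P" "\<one> \<notin> P" and mx: "\<And>L. \<lbrakk>ideal L R; P \<subset> L\<rbrakk> \<Longrightarrow> \<one> \<in> L"
  have "maximalideal P R"
  proof (rule maximalidealI)
    fix J assume J: "ideal J R" "P \<subseteq> J" "J \<subseteq> carrier R"
    show "J = P \<or> J = carrier R"
      using mx[OF J(1)] J ideal.one_imp_carrier[OF J(1)] by blast
  qed (use primeidealD(1,3)[OF P(1)] in auto)
  thus thesis using that P by blast
qed (use assms in auto)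

text \<open>Zorn's lemma is applied to complements of primes, so that descending chains of primes
  become ascending ones; the intersection of a chain of primes is prime.\<close>

lemma exists_minimal_prime:
  assumes "primeideal M R"
  obtains P where "primeideal P R" "P \<subseteq> M" "\<And>Q. \<lbrakk>primeideal Q R; Q \<subseteq> P\<rbrakk> \<Longrightarrow> Q = P"
proof -
  let ?A = "{Z. \<exists>P. Z = carrier R - P \<and> primeideal P R \<and> P \<subseteq> M}"
  have "\<exists>Z\<in>?A .  \<forall>Y\<in>?A .  Z \<subseteq> Y \<longrightarrow> Y = Z"
  proof (rule subset_Zorn_nonempty)
    show "?A \<noteq> {}" using assms by blast
    fix C assume C: "C \<noteq> {}" "subset.chain ?A C"
    have CA: "C \<subseteq> ?A" and lin: "\<And>Z Y. \<lbrakk>Z \<in> C; Y \<in> C\<rbrakk> \<Longrightarrow> Z \<subseteq> Y \<or> Y \<subseteq> Z"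
      using C(2) unfolding subset_chain_def by blast+
    have pr: "primeideal (carrier R - Z) R" "carrier R - Z \<subseteq> M" "Z \<subseteq> carrier R" if Z: "Z \<in> C" for Z
    proof -
      obtain P where P: "Z = carrier R - P" "primeideal P R" "P \<subseteq> M" using CA Z by blast
      hence "carrier R - Z = P" using idealD(1)[OF primeidealD(1)[OF P(2)]] by blast
      thus "primeideal (carrier R - Z) R" "carrier R - Z \<subseteq> M" "Z \<subseteq> carrier R" using P by auto
    qed
    let ?P = "carrier R - \<Union>C"
    have i: "ideal ?P R"
    proof (rule idealI_cring)
      fix a b assume "a \<in> ?P" "b \<in> ?P"
      thus "a \<oplus> b \<in> ?P" using idealD(3)[OF primeidealD(1)[OF pr(1)], of _ a b] by auto
    next
      fix a x assume "a \<in> ?P" "x \<in> carrier R"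
      thus "x \<otimes> a \<in> ?P" using idealD(5)[OF primeidealD(1)[OF pr(1)], of _ x a] by auto
    qed (use idealD(2)[OF primeidealD(1)[OF pr(1)]] in auto)
    have "primeideal ?P R"
    proof (rule primeidealI[OF i is_cring])
      show "carrier R \<noteq> ?P" using C(1) primeidealD(2)[OF pr(1)] by fast
      fix a b assume ab: "a \<in> carrier R" "b \<in> carrier R" "a \<otimes> b \<in> ?P"
      show "a \<in> ?P \<or> b \<in> ?P"
      proof (rule ccontr)
        assume "\<not> (a \<in> ?P \<or> b \<in> ?P)"
        then obtain Z Y where "Z \<in> C" "Y \<in> C" "a \<in> Z" "b \<in> Y" using ab by blast
        then obtain W where W: "W \<in> C" "a \<in> W" "b \<in> W" using lin by blast
        show False using primeidealD(4)[OF pr(1)[OF W(1)] ab(1,2)] ab W by auto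
      qed
    qed
    moreover have "?P \<subseteq> M" using C(1) pr(2) by blast
    moreover have "\<Union>C = carrier R - ?P" using pr(3) by blast
    ultimately show "\<Union>C \<in> ?A" by blast
  qed
  then obtain Y where YA: "Y \<in> ?A" and Ymax: "\<forall>Z\<in>?A. Y \<subseteq> Z \<longrightarrow> Z = Y" ..
  from YA obtain P where P: "primeideal P R" "P \<subseteq> M" "Y = carrier R - P" by auto
  have "Q = P" if Q: "primeideal Q R" "Q \<subseteq> P" for Q
  proof -
    have "carrier R - Q \<in> ?A" using Q P by blast
    hence "carrier R - Q = carrier R - P" using Ymax P(3) Q(2) by blast
    thus ?thesis using idealD(1)[OF primeidealD(1)[OF Q(1)]] idealD(1)[OF primeidealD(1)[OF P(1)]] by blast
  qed
  thus ?thesis using that P by blast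
qed

text \<open>The maximal ideal of the localization at \<open>P\<close> is its only prime, hence nil.
  Without localizing: if no such relation existed, the products \<open>s p^n\<close> would form a
  multiplicative set missing \<open>\<zero>\<close>. A prime \<open>Q\<close> disjoint from it would
  lie in \<open>P\<close> (take \<open>n = 0\<close>) and omit \<open>p\<close> (take
  \<open>s = \<one>\<close>, \<open>n = 1\<close>), against minimality.\<close>

lemma minimal_prime_annihilated_power:
  assumes P: "primeideal P R" and min: "\<And>Q. \<lbrakk>primeideal Q R; Q \<subseteq> P\<rbrakk> \<Longrightarrow> Q = P" and p: "p \<in> P"
  obtains s n where "s \<in> carrier R" "s \<notin> P" "s \<otimes> p [^] (n::nat) = \<zero>"
proof (rule ccontr)
  assume n: "\<not> thesis"
  note Pi = primeidealD[OF P]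
  have pc: "p \<in> carrier R" using idealD(1)[OF Pi(1) p] .
  let ?S = "{s \<otimes> p [^] (n::nat) | s n. s \<in> carrier R \<and> s \<notin> P}"
  have "\<zero> \<notin> ?S" using n that by force
  hence S0: "{\<zero>} \<inter> ?S = {}" by blast
  have S1: "\<one> \<in> ?S" using Pi(2) by (auto intro!: exI[of _ \<one>] exI[of _ "0::nat"])
  have S2: "?S \<subseteq> carrier R" using pc by auto
  have S3: "x \<otimes> y \<in> ?S" if xy: "x \<in> ?S" "y \<in> ?S" for x y
  proof -
    obtain s t i j where h: "x = s \<otimes> p [^] (i::nat)" "y = t \<otimes> p [^] (j::nat)" "s \<in> carrier R" "t \<in> carrier R"
      "s \<notin> P" "t \<notin> P" using xy by blast
    have "x \<otimes> y = (s \<otimes> t) \<otimes> p [^] (i + j)" using h pc by (simp add: nat_pow_mult[symmetric] m_ac)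
    moreover have "s \<otimes> t \<notin> P" using Pi(4) h by blast
    ultimately show ?thesis using h by blast
  qed
  obtain Q where Q: "primeideal Q R" "{\<zero>} \<subseteq> Q" "Q \<inter> ?S = {}"
    by (rule exists_prime_disjoint[OF zeroideal S0 S1 S2 S3])
  have S: "s \<otimes> p [^] (n::nat) \<notin> Q" if "s \<in> carrier R" "s \<notin> P" for s n using Q(3) that by blast
  have "Q \<subseteq> P"
  proof
    fix x assume x: "x \<in> Q"
    hence "x \<in> carrier R" using idealD(1)[OF primeidealD(1)[OF Q(1)]] by blast
    thus "x \<in> P" using S[of x 0] x by auto
  qed
  hence "p \<in> Q" using min[OF Q(1)] p by blast
  thus False using S[of \<one> 1] Pi(2) pc by simp
qed

end

section \<open>Factorization up to the \<open>u\<close>-operation\<close>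

text \<open>\<open>gv_set R A\<close> says that \<open>A\<close> generates an ideal of \<^const>\<open>rGV\<close>, and \<open>inverse_products R Q\<close>
  consists of the products \<open>q \<cdot> (b/s)\<close> with \<open>q \<in> Q\<close> and \<open>b/s \<in> Q\<^sup>-\<^sup>1\<close>, so it generates
  \<open>Q Q\<^sup>-\<^sup>1\<close>.\<close>

definition gv_set :: "('a, 'm) ring_scheme \<Rightarrow> 'a set \<Rightarrow> bool" where
  "gv_set R A \<longleftrightarrow> finite A \<and> A \<subseteq> carrier R \<and> Idl\<^bsub>R\<^esub> A \<inter> regular_elements R \<noteq> {}
     \<and> (\<forall>a\<in>carrier R. \<forall>s\<in>regular_elements R.
          (\<forall>j\<in>A. s divides\<^bsub>R\<^esub> (a \<otimes>\<^bsub>R\<^esub> j)) \<longrightarrow> s divides\<^bsub>R\<^esub> a)"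

definition inverse_products :: "('a, 'm) ring_scheme \<Rightarrow> 'a set \<Rightarrow> 'a set" where
  "inverse_products R Q = {d \<in> carrier R. \<exists>q\<in>Q. \<exists>s\<in>regular_elements R. \<exists>b\<in>carrier R.
     (\<forall>x\<in>Q. s divides\<^bsub>R\<^esub> (b \<otimes>\<^bsub>R\<^esub> x)) \<and> q \<otimes>\<^bsub>R\<^esub> b = s \<otimes>\<^bsub>R\<^esub> d}"

text \<open>This says that \<open>\<one>\<close> belongs to the \<open>u\<close>-closure of
  \<open>Q Q^-1\<close>; \<open>u_invertible_iff\<close> identifies it with
  \<open>u_invertible\<close>.\<close>

definition uinv :: "('a, 'm) ring_scheme \<Rightarrow> 'a set \<Rightarrow> bool" where
  "uinv R Q \<longleftrightarrow> (\<exists>A. gv_set R A \<and> A \<subseteq> Idl\<^bsub>R\<^esub> (inverse_products R Q))"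

definition good_prime :: "('a, 'm) ring_scheme \<Rightarrow> 'a set \<Rightarrow> bool" where
  "good_prime R Q \<longleftrightarrow> primeideal Q R \<and> uinv R Q \<and> (\<forall>A. gv_set R A \<longrightarrow> \<not> A \<subseteq> Q)"

definition colon :: "('a, 'm) ring_scheme \<Rightarrow> 'a set \<Rightarrow> 'a set \<Rightarrow> 'a set" where
  "colon R I B = {x \<in> carrier R. \<forall>y\<in>B. x \<otimes>\<^bsub>R\<^esub> y \<in> I}"

text \<open>The colon ideal encodes products of ideals: \<open>u_factored R I\<close> holds iff \<open>I\<close> contains a product
  \<open>J Q\<^sub>1 \<cdots> Q\<^sub>n\<close> with \<open>J\<close> in \<^const>\<open>rGV\<close> and all \<open>Q\<^sub>i\<close> good primes.\<close>

inductive u_factored :: "('a, 'm) ring_scheme \<Rightarrow> 'a set \<Rightarrow> bool" for R where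
  gv: "\<lbrakk>ideal I R; gv_set R A; A \<subseteq> I\<rbrakk> \<Longrightarrow> u_factored R I"
| prime: "\<lbrakk>ideal I R; good_prime R Q; u_factored R (colon R I Q)\<rbrakk> \<Longrightarrow> u_factored R I"

text \<open>The hypothesis with principality removed: a principal prime that meets the regular
  elements is itself invertible, see \<open>primes_contain_uinv_of_nonprincipal\<close>. In this
  form it descends to quotients by idempotents.\<close>

definition primes_contain_uinv :: "('a, 'm) ring_scheme \<Rightarrow> bool" where
  "primes_contain_uinv R \<longleftrightarrow> (\<forall>P. primeideal P R \<longrightarrow> P \<inter> regular_elements R \<noteq> {} \<longrightarrow>
     (\<exists>Q. primeideal Q R \<and> Q \<subseteq> P \<and> uinv R Q))"

context cring
begin

lemma regular_carrier: "s \<in> regular_elements R \<Longrightarrow> s \<in> carrier R"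
  by (simp add: regular_elements_def)

lemma regular_cancel:
  assumes "s \<in> regular_elements R" "x \<in> carrier R" "y \<in> carrier R" "s \<otimes> x = s \<otimes> y"
  shows "x = y"
  using regular_elements_cancel[OF assms(1-3)] assms regular_carrier[OF assms(1)] by (simp add: m_comm)

lemma gv_setD:
  assumes "gv_set R A"
  shows "finite A" "A \<subseteq> carrier R" "\<exists>r. r \<in> Idl A \<and> r \<in> regular_elements R"
    "\<lbrakk>a \<in> carrier R; s \<in> regular_elements R; \<And>j. j \<in> A \<Longrightarrow> s divides (a \<otimes> j)\<rbrakk> \<Longrightarrow> s divides a"
  using assms unfolding gv_set_def by blast+

lemma gv_set_one: "gv_set R {\<one>}"
  unfolding gv_set_def using genideal_one regular_elements_one by auto

lemma inverse_products_carrier: "inverse_products R Q \<subseteq> carrier R"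
  by (auto simp: inverse_products_def)

lemma inverse_productsE:
  assumes "d \<in> inverse_products R Q"
  obtains q s b where "d \<in> carrier R" "q \<in> Q" "s \<in> regular_elements R" "b \<in> carrier R"
    "\<And>x. x \<in> Q \<Longrightarrow> s divides (b \<otimes> x)" "q \<otimes> b = s \<otimes> d"
  using assms unfolding inverse_products_def by blast

text \<open>The inclusion holds because \<open>Q^-1\<close> contains \<open>\<one>\<close>.\<close>

lemma subset_inverse_products:
  assumes Q: "Q \<subseteq> carrier R"
  shows "Q \<subseteq> inverse_products R Q"
proof
  fix q assume q: "q \<in> Q"
  have "\<forall>x\<in>Q. \<one> divides (\<one> \<otimes> x)" using Q by (auto simp: factor_def)
  moreover have "q \<otimes> \<one> = \<one> \<otimes> q" "q \<in> carrier R" using Q q by auto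
  ultimately show "q \<in> inverse_products R Q"
    unfolding inverse_products_def using q regular_elements_one one_closed by blast
qed

lemma colon_ideal:
  assumes "ideal I R" "B \<subseteq> carrier R"
  shows "ideal (colon R I B) R"
proof (rule idealI_cring)
  note I = idealD[OF assms(1)]
  show "\<zero> \<in> colon R I B" using I(2) assms(2) by (auto simp: colon_def)
  show "a \<oplus> b \<in> colon R I B" if "a \<in> colon R I B" "b \<in> colon R I B" for a b
    using that I(3) assms(2) by (auto simp: colon_def l_distr subset_iff)
  show "x \<otimes> a \<in> colon R I B" if "a \<in> colon R I B" "x \<in> carrier R" for a x
    using that I(5) assms(2) by (auto simp: colon_def m_assoc subset_iff)
qed (auto simp: colon_def)

lemma good_primeD:
  assumes "good_prime R Q"
  shows "primeideal Q R" "ideal Q R" "Q \<subseteq> carrier R" "uinv R Q" "gv_set R A \<Longrightarrow> \<exists>a\<in>A. a \<notin> Q"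
  using assms idealD(1)[of Q] primeidealD(1) unfolding good_prime_def by blast+

section \<open>Consequences of \<open>u\<close>-invertibility\<close>

lemma gv_set_regular_ideal:
  assumes "gv_set R A" "ideal I R" "A \<subseteq> I"
  shows "I \<inter> regular_elements R \<noteq> {}"
  using gv_setD(3)[OF assms(1)] genideal_minimal[OF assms(2,3)] by blast

text \<open>The elements with a regular multiple in \<open>Q\<close> form an ideal. It contains
  every \<open>d\<close> with \<open>s d = q b\<close>, hence \<open>Q Q^-1\<close>, hence a
  GV-ideal and with it a regular \<open>r\<close>; a regular multiple \<open>s r\<close> then lies
  in \<open>Q\<close>.\<close>

lemma uinv_regular:
  assumes "ideal Q R" "uinv R Q"
  shows "Q \<inter> regular_elements R \<noteq> {}"
proof -
  note Q = idealD[OF assms(1)]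
  obtain A where A: "gv_set R A" "A \<subseteq> Idl (inverse_products R Q)" using assms(2) unfolding uinv_def by blast
  let ?I = "{j \<in> carrier R. \<exists>s\<in>regular_elements R. s \<otimes> j \<in> Q}"
  have I: "ideal ?I R"
  proof (rule idealI_cring)
    have "\<one> \<otimes> \<zero> \<in> Q" using Q(2) by simp
    thus "\<zero> \<in> ?I" using regular_elements_one by blast
  next
    fix a b assume "a \<in> ?I" "b \<in> ?I"
    then obtain s t where h: "a \<in> carrier R" "b \<in> carrier R" "s \<in> regular_elements R" "t \<in> regular_elements R"
      "s \<otimes> a \<in> Q" "t \<otimes> b \<in> Q" by blast
    note c = regular_carrier[OF h(3)] regular_carrier[OF h(4)]
    have "(s \<otimes> t) \<otimes> (a \<oplus> b) = t \<otimes> (s \<otimes> a) \<oplus> s \<otimes> (t \<otimes> b)" using h(1,2) c by (simp add: r_distr m_ac)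
    thus "a \<oplus> b \<in> ?I" using h Q c regular_elements_closed[OF h(3,4)]
      by (auto intro!: bexI[of _ "s \<otimes> t"])
  next
    fix a x assume "a \<in> ?I" "x \<in> carrier R"
    then obtain s where h: "a \<in> carrier R" "s \<in> regular_elements R" "s \<otimes> a \<in> Q" "x \<in> carrier R" by blast
    note c = regular_carrier[OF h(2)]
    have "s \<otimes> (x \<otimes> a) = x \<otimes> (s \<otimes> a)" using h c by (simp add: m_ac)
    moreover have "x \<otimes> (s \<otimes> a) \<in> Q" using h Q(5) by blast
    ultimately have "s \<otimes> (x \<otimes> a) \<in> Q" by simp
    thus "x \<otimes> a \<in> ?I" using h(1,2,4) m_closed by blast
  qed auto
  have "inverse_products R Q \<subseteq> ?I"
  proof
    fix d assume "d \<in> inverse_products R Q"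
    then obtain q s b where "d \<in> carrier R" "q \<in> Q" "s \<in> regular_elements R" "b \<in> carrier R" "q \<otimes> b = s \<otimes> d"
      by (rule inverse_productsE)
    thus "d \<in> ?I" using Q(6) by force
  qed
  hence "A \<subseteq> ?I" using A(2) genideal_minimal[OF I] by blast
  then obtain r where r: "r \<in> ?I" "r \<in> regular_elements R" using gv_set_regular_ideal[OF A(1) I] by blast
  then obtain s where "s \<in> regular_elements R" "s \<otimes> r \<in> Q" by blast
  thus ?thesis using regular_elements_closed r(2) by blast
qed

text \<open>If \<open>d = q (b/s)\<close> with \<open>b/s\<close> in \<open>Q^-1\<close>, then
  \<open>x d = (x b/s) q\<close> for all \<open>x\<close> in \<open>Q\<close>, so \<open>Q d\<close>
  is contained in \<open>(q)\<close>. Finitely many such \<open>q\<close> serve for a whole GV-set: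
  up to a GV-ideal, \<open>Q\<close> is finitely generated. This supplies the finiteness needed for
  Zorn's lemma.\<close>

lemma uinv_finite_type:
  assumes "ideal Q R" "uinv R Q"
  obtains A B where "gv_set R A" "finite B" "B \<subseteq> Q" "\<And>j q. \<lbrakk>j \<in> A; q \<in> Q\<rbrakk> \<Longrightarrow> q \<otimes> j \<in> Idl B"
proof -
  note Q = idealD[OF assms(1)]
  have Bi: "ideal (Idl B) R" if "B \<subseteq> Q" for B using genideal_ideal Q(1) that by blast
  obtain A where A: "gv_set R A" "A \<subseteq> Idl (inverse_products R Q)" using assms(2) unfolding uinv_def by blast
  let ?I = "{j \<in> carrier R. \<exists>B. finite B \<and> B \<subseteq> Q \<and> (\<forall>q\<in>Q. q \<otimes> j \<in> Idl B)}"
  have I: "ideal ?I R"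
  proof (rule idealI_cring)
    have "q \<otimes> \<zero> \<in> Idl {}" if "q \<in> Q" for q using idealD(2)[OF Bi[of "{}"]] Q(1)[OF that] by simp
    thus "\<zero> \<in> ?I" by blast
  next
    fix a b assume "a \<in> ?I" "b \<in> ?I"
    then obtain B C where h: "a \<in> carrier R" "b \<in> carrier R" "finite B" "B \<subseteq> Q" "finite C" "C \<subseteq> Q"
      "\<forall>q\<in>Q. q \<otimes> a \<in> Idl B" "\<forall>q\<in>Q. q \<otimes> b \<in> Idl C" by blast
    have BC: "B \<union> C \<subseteq> Q" "B \<union> C \<subseteq> carrier R" using h Q(1) by blast+
    have s: "Idl B \<subseteq> Idl (B \<union> C)" "Idl C \<subseteq> Idl (B \<union> C)"
      using subset_Idl_subset[OF BC(2)] by blast+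
    have "q \<otimes> (a \<oplus> b) \<in> Idl (B \<union> C)" if "q \<in> Q" for q
    proof -
      have "q \<otimes> (a \<oplus> b) = q \<otimes> a \<oplus> q \<otimes> b" using h Q(1)[OF that] by (simp add: r_distr)
      moreover have "q \<otimes> a \<in> Idl (B \<union> C)" "q \<otimes> b \<in> Idl (B \<union> C)" using h that s by blast+
      ultimately show ?thesis using idealD(3)[OF Bi[OF BC(1)]] by simp
    qed
    moreover have "finite (B \<union> C)" "a \<oplus> b \<in> carrier R" using h by auto
    ultimately show "a \<oplus> b \<in> ?I" using BC(1) by blast
  next
    fix a x assume "a \<in> ?I" "x \<in> carrier R"
    then obtain B where h: "a \<in> carrier R" "x \<in> carrier R" "finite B" "B \<subseteq> Q" "\<forall>q\<in>Q. q \<otimes> a \<in> Idl B" by blast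
    have "q \<otimes> (x \<otimes> a) \<in> Idl B" if "q \<in> Q" for q
    proof -
      have "q \<otimes> (x \<otimes> a) = x \<otimes> (q \<otimes> a)" using h Q(1)[OF that] by (simp add: m_ac)
      thus ?thesis using idealD(5)[OF Bi[OF h(4)]] h that by auto
    qed
    thus "x \<otimes> a \<in> ?I" using h by auto
  qed auto
  have "inverse_products R Q \<subseteq> ?I"
  proof
    fix d assume "d \<in> inverse_products R Q"
    then obtain q s b where d: "d \<in> carrier R" "q \<in> Q" "s \<in> regular_elements R" "b \<in> carrier R"
      "\<And>x. x \<in> Q \<Longrightarrow> s divides (b \<otimes> x)" "q \<otimes> b = s \<otimes> d"
      by (rule inverse_productsE) blast
    have "x \<otimes> d \<in> Idl {q}" if x: "x \<in> Q" for x
    proof -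
      obtain c where c: "c \<in> carrier R" "b \<otimes> x = s \<otimes> c" using d(5)[OF x] by (auto simp: factor_def)
      note cr = Q(1)[OF x] Q(1)[OF d(2)] regular_carrier[OF d(3)] d(1,4) c(1)
      have "s \<otimes> (x \<otimes> d) = x \<otimes> (q \<otimes> b)" using cr d(6) by (simp add: m_ac)
      also have "\<dots> = s \<otimes> (q \<otimes> c)" using cr c(2) by (metis m_lcomm m_comm)
      finally have "x \<otimes> d = c \<otimes> q" using regular_cancel[OF d(3)] cr by (simp add: m_comm)
      thus ?thesis using idealD(5)[OF genideal_ideal] genideal_self'[of q] cr by simp
    qed
    thus "d \<in> ?I" using d(1,2) by (auto intro!: exI[of _ "{q}"])
  qed
  hence "A \<subseteq> ?I" using A(2) genideal_minimal[OF I] by blast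
  hence "\<forall>j\<in>A. \<exists>B. finite B \<and> B \<subseteq> Q \<and> (\<forall>q\<in>Q. q \<otimes> j \<in> Idl B)" by blast
  then obtain f where f: "\<And>j. j \<in> A \<Longrightarrow> finite (f j) \<and> f j \<subseteq> Q \<and> (\<forall>q\<in>Q. q \<otimes> j \<in> Idl (f j))" by metis
  have sub: "(\<Union>j\<in>A. f j) \<subseteq> Q" using f by blast
  have "q \<otimes> j \<in> Idl (\<Union>j\<in>A. f j)" if "j \<in> A" "q \<in> Q" for j q
  proof -
    have "Idl (f j) \<subseteq> Idl (\<Union>j\<in>A. f j)"
      by (rule subset_Idl_subset) (use sub Q(1) that in blast)+
    thus ?thesis using f that by blast
  qed
  moreover have "finite (\<Union>j\<in>A. f j)" using gv_setD(1)[OF A(1)] f by blast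
  ultimately show ?thesis using that A(1) sub by blast
qed

text \<open>If \<open>y = a/s\<close> satisfies \<open>y Q \<subseteq> Q\<close>, then \<open>y Q Q\<^sup>-\<^sup>1 \<subseteq> R\<close> and hence \<open>y \<in> R\<close>.\<close>

lemma uinv_multiplier:
  assumes "ideal Q R" "uinv R Q" "a \<in> carrier R" "s \<in> regular_elements R"
    and aQ: "\<And>q. q \<in> Q \<Longrightarrow> \<exists>c\<in>Q. a \<otimes> q = s \<otimes> c"
  shows "s divides a"
proof -
  note Q = idealD[OF assms(1)]
  have sc: "s \<in> carrier R" using assms(4) by (rule regular_carrier)
  obtain A where A: "gv_set R A" "A \<subseteq> Idl (inverse_products R Q)" using assms(2) unfolding uinv_def by blast
  have I: "ideal {d \<in> carrier R. s divides (a \<otimes> d)} R" by (rule divides_ideal[OF sc assms(3)])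
  have "inverse_products R Q \<subseteq> {d \<in> carrier R. s divides (a \<otimes> d)}"
  proof
    fix d assume "d \<in> inverse_products R Q"
    then obtain q t b where d: "d \<in> carrier R" "q \<in> Q" "t \<in> regular_elements R" "b \<in> carrier R"
      "\<And>x. x \<in> Q \<Longrightarrow> t divides (b \<otimes> x)" "q \<otimes> b = t \<otimes> d"
      by (rule inverse_productsE) blast
    obtain q' where q': "q' \<in> Q" "a \<otimes> q = s \<otimes> q'" using aQ[OF d(2)] by blast
    obtain c where c: "c \<in> carrier R" "b \<otimes> q' = t \<otimes> c" using d(5)[OF q'(1)] by (auto simp: factor_def)
    note cr = Q(1)[OF q'(1)] Q(1)[OF d(2)] regular_carrier[OF d(3)] d(1,4) c(1) assms(3) sc
    have "t \<otimes> (a \<otimes> d) = a \<otimes> (q \<otimes> b)" using cr d(6) by (simp add: m_ac)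
    also have "\<dots> = (s \<otimes> q') \<otimes> b" using cr q'(2) by (metis m_assoc)
    also have "\<dots> = t \<otimes> (s \<otimes> c)" using cr c(2) by (metis m_assoc m_comm m_lcomm)
    finally have "a \<otimes> d = s \<otimes> c" using regular_cancel[OF d(3)] cr by simp
    thus "d \<in> {d \<in> carrier R. s divides (a \<otimes> d)}" using cr by auto
  qed
  hence "A \<subseteq> {d \<in> carrier R. s divides (a \<otimes> d)}" using A(2) genideal_minimal[OF I] by blast
  thus ?thesis using gv_setD(4)[OF A(1) assms(3,4)] by blast
qed

section \<open>Ideals containing a product of a GV-ideal and good primes\<close>

lemma u_factored_ideal: "u_factored R I \<Longrightarrow> ideal I R"
  by (erule u_factored.cases) auto

lemma u_factored_mono:
  assumes "u_factored R I" "ideal I' R" "I \<subseteq> I'"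
  shows "u_factored R I'"
  using assms
proof (induction arbitrary: I')
  case (gv I A) thus ?case by (meson u_factored.gv subset_trans)
next
  case (prime I Q)
  have "colon R I Q \<subseteq> colon R I' Q" using prime.prems by (auto simp: colon_def)
  hence "u_factored R (colon R I' Q)"
    by (rule prime.IH[OF colon_ideal[OF prime.prems(1)], rotated]) (use prime good_primeD in auto)
  thus ?case using prime u_factored.prime by blast
qed

text \<open>If \<open>s\<close> divides all \<open>x a b\<close>, then for fixed \<open>a\<close>
  the set \<open>B\<close> shows that \<open>s\<close> divides \<open>x a\<close>, and
  \<open>A\<close> then shows that \<open>s\<close> divides \<open>x\<close>. The regular element is
  a product of one from each generated ideal, placed in the product ideal by two colon
  arguments.\<close>

lemma gv_set_mult:
  assumes "gv_set R A" "gv_set R B"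
  shows "gv_set R {a \<otimes> b | a b. a \<in> A \<and> b \<in> B}"
proof -
  let ?C = "{a \<otimes> b | a b. a \<in> A \<and> b \<in> B}"
  note A = gv_setD[OF assms(1)] and B = gv_setD[OF assms(2)]
  have C: "?C \<subseteq> carrier R" using A(2) B(2) by blast
  have I: "ideal (Idl ?C) R" by (rule genideal_ideal[OF C])
  have "?C = (\<lambda>(a, b). a \<otimes> b) ` (A \<times> B)" by auto
  hence fin: "finite ?C" using A(1) B(1) by simp
  obtain r t where rt: "r \<in> Idl A" "r \<in> regular_elements R" "t \<in> Idl B" "t \<in> regular_elements R"
    using A(3) B(3) by blast
  have "Idl A \<subseteq> colon R (Idl ?C) B"
    by (rule genideal_minimal[OF colon_ideal[OF I B(2)]])
       (use A(2) genideal_self[OF C] in \<open>auto simp: colon_def\<close>)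
  hence 1: "r \<otimes> b \<in> Idl ?C" if "b \<in> B" for b using rt(1) that by (auto simp: colon_def)
  have rtc: "r \<in> carrier R" "t \<in> carrier R" using rt regular_carrier by auto
  have "Idl B \<subseteq> colon R (Idl ?C) {r}"
    by (rule genideal_minimal[OF colon_ideal[OF I]])
       (use B(2) 1 rtc m_comm in \<open>auto simp: colon_def subset_iff\<close>)
  hence "t \<otimes> r \<in> Idl ?C" using rt(3) by (auto simp: colon_def)
  moreover have "t \<otimes> r \<in> regular_elements R" using regular_elements_closed rt by blast
  moreover have "s divides x" if s: "s \<in> regular_elements R" "x \<in> carrier R" "\<forall>j\<in>?C. s divides (x \<otimes> j)" for x s
  proof (rule A(4)[OF s(2,1)])
    fix a assume a: "a \<in> A"
    hence ac: "a \<in> carrier R" using A(2) by blast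
    show "s divides (x \<otimes> a)"
    proof (rule B(4)[OF _ s(1)])
      show "x \<otimes> a \<in> carrier R" using s(2) ac by simp
      fix b assume b: "b \<in> B"
      hence "b \<in> carrier R" using B(2) by blast
      moreover have "s divides (x \<otimes> (a \<otimes> b))" using s(3) a b by blast
      ultimately show "s divides (x \<otimes> a \<otimes> b)" using s(2) ac by (simp add: m_assoc)
    qed
  qed
  ultimately show ?thesis unfolding gv_set_def using fin C by blast
qed

text \<open>Only the GV-part of the factorization changes, by \<open>gv_set_mult\<close>; the good
  primes are carried along. This is the base case of \<open>u_factored_prod\<close>.\<close>

lemma u_factored_gv_prod:
  assumes "u_factored R L" "gv_set R A" "ideal N R" "\<And>x a. \<lbrakk>x \<in> L; a \<in> A\<rbrakk> \<Longrightarrow> x \<otimes> a \<in> N"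
  shows "u_factored R N"
  using assms
proof (induction arbitrary: N)
  case (gv I B)
  have "{a \<otimes> b | a b. a \<in> B \<and> b \<in> A} \<subseteq> N" using gv by blast
  thus ?case using u_factored.gv[OF gv.prems(2) gv_set_mult[OF gv.hyps(2) gv.prems(1)]] by blast
next
  case (prime I Q)
  note Q = good_primeD[OF prime.hyps(2)]
  have Ac: "A \<subseteq> carrier R" using gv_setD(2)[OF prime.prems(1)] .
  have "u_factored R (colon R N Q)"
  proof (rule prime.IH[OF prime.prems(1) colon_ideal[OF prime.prems(2) Q(3)]])
    fix x a assume xa: "x \<in> colon R I Q" "a \<in> A"
    have "(x \<otimes> a) \<otimes> q \<in> N" if "q \<in> Q" for q
    proof -
      have "(x \<otimes> a) \<otimes> q = (x \<otimes> q) \<otimes> a" using xa Ac Q(3) that by (auto simp: m_ac colon_def subset_iff)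
      thus ?thesis using prime.prems(3)[of "x \<otimes> q" a] xa that by (auto simp: colon_def)
    qed
    thus "x \<otimes> a \<in> colon R N Q" using xa Ac by (auto simp: colon_def)
  qed
  thus ?case using u_factored.prime prime by blast
qed

text \<open>The factorization of \<open>M\<close> is consumed prime by prime: if \<open>y\<close>
  multiplies \<open>Q\<close> into \<open>M\<close>, then \<open>x y\<close> multiplies
  \<open>Q\<close> into \<open>N\<close>.\<close>

lemma u_factored_prod:
  assumes "u_factored R L" "u_factored R M" "ideal N R" "\<And>x y. \<lbrakk>x \<in> L; y \<in> M\<rbrakk> \<Longrightarrow> x \<otimes> y \<in> N"
  shows "u_factored R N"
  using assms(2,1,3,4)
proof (induction arbitrary: N)
  case (gv I A)
  thus ?case using u_factored_gv_prod[OF gv.prems(1) gv.hyps(2)] by blast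
next
  case (prime I Q)
  note Q = good_primeD[OF prime.hyps(2)]
  have Lc: "L \<subseteq> carrier R" using idealD(1)[OF u_factored_ideal[OF prime.prems(1)]] by blast
  have "u_factored R (colon R N Q)"
  proof (rule prime.IH[OF prime.prems(1) colon_ideal[OF prime.prems(2) Q(3)]])
    fix x y assume xy: "x \<in> L" "y \<in> colon R I Q"
    have "(x \<otimes> y) \<otimes> q \<in> N" if "q \<in> Q" for q
    proof -
      have "(x \<otimes> y) \<otimes> q = x \<otimes> (y \<otimes> q)" using xy Lc Q(3) that by (auto simp: m_assoc colon_def subset_iff)
      thus ?thesis using prime.prems(3)[of x "y \<otimes> q"] xy that by (auto simp: colon_def)
    qed
    thus "x \<otimes> y \<in> colon R N Q" using xy Lc by (auto simp: colon_def)
  qed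
  thus ?case using u_factored.prime prime by blast
qed

text \<open>This is the \<open>fin\<close> condition of the prime ideal principle. A good prime
  \<open>Q\<close> need not be finitely generated, so in the inductive step a finite
  \<open>C\<close> in \<open>Q\<close> and a GV-set \<open>A\<close> with \<open>Q A\<close> inside
  \<open>(C)\<close> stand in for it.\<close>

lemma u_factored_finite_type:
  assumes "u_factored R I"
  shows "\<exists>B. finite B \<and> B \<subseteq> I \<and> u_factored R (Idl B)"
  using assms
proof induction
  case (gv I A)
  have "u_factored R (Idl A)"
    using u_factored.gv[OF genideal_ideal gv.hyps(2) genideal_self] gv_setD(2)[OF gv.hyps(2)] by blast
  thus ?case using gv gv_setD(1) by blast
next
  case (prime I Q)
  note Q = good_primeD[OF prime.hyps(2)]
  obtain B where B: "finite B" "B \<subseteq> colon R I Q" "u_factored R (Idl B)" using prime.IH by blast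
  obtain A C where AC: "gv_set R A" "finite C" "C \<subseteq> Q" "\<And>j q. \<lbrakk>j \<in> A; q \<in> Q\<rbrakk> \<Longrightarrow> q \<otimes> j \<in> Idl C"
    by (rule uinv_finite_type[OF Q(2,4)]) blast
  let ?D = "{b \<otimes> c | b c. b \<in> B \<and> c \<in> C}"
  have Bc: "B \<subseteq> carrier R" using B(2) by (auto simp: colon_def)
  have Cc: "C \<subseteq> carrier R" using AC(3) Q(3) by blast
  have D: "?D \<subseteq> carrier R" using Bc Cc by blast
  have DI: "?D \<subseteq> I" using B(2) AC(3) by (auto simp: colon_def)
  have "?D = (\<lambda>(a, b). a \<otimes> b) ` (B \<times> C)" by auto
  hence fin: "finite ?D" using B(1) AC(2) by simp
  have Di: "ideal (Idl ?D) R" by (rule genideal_ideal[OF D])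
  have DQ: "ideal (colon R (Idl ?D) Q) R" by (rule colon_ideal[OF Di Q(3)])
  have Ac: "A \<subseteq> carrier R" by (rule gv_setD(2)[OF AC(1)])
  have bC: "Idl C \<subseteq> colon R (Idl ?D) {b}" if b: "b \<in> B" for b
  proof (rule genideal_minimal[OF colon_ideal[OF Di]])
    show "{b} \<subseteq> carrier R" using b Bc by blast
    show "C \<subseteq> colon R (Idl ?D) {b}"
    proof
      fix c assume c: "c \<in> C"
      have "c \<otimes> b = b \<otimes> c" using b c Bc Cc m_comm by blast
      moreover have "b \<otimes> c \<in> Idl ?D" using genideal_self[OF D] b c by blast
      ultimately show "c \<in> colon R (Idl ?D) {b}" using c Cc by (auto simp: colon_def)
    qed
  qed
  \<comment> \<open>Since \<open>Q A\<close> lies in \<open>(C)\<close>, the products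
    \<open>b a q\<close> lie in the ideal of \<open>?D\<close>. So \<open>colon R (Idl ?D) Q\<close>
    contains \<open>(B) A\<close>, and \<open>u_factored_gv_prod\<close> applies.\<close>
  have "Idl B \<subseteq> colon R (colon R (Idl ?D) Q) A"
  proof (rule genideal_minimal[OF colon_ideal[OF DQ Ac]])
    show "B \<subseteq> colon R (colon R (Idl ?D) Q) A"
    proof
      fix b assume b: "b \<in> B"
      have "(b \<otimes> a) \<otimes> q \<in> Idl ?D" if "a \<in> A" "q \<in> Q" for a q
      proof -
        have "q \<otimes> a \<otimes> b \<in> Idl ?D" using bC[OF b] AC(4)[OF that] by (auto simp: colon_def)
        moreover have "(b \<otimes> a) \<otimes> q = q \<otimes> a \<otimes> b" using b that Bc Ac Q(3) by (auto simp: m_ac subset_iff)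
        ultimately show ?thesis by simp
      qed
      thus "b \<in> colon R (colon R (Idl ?D) Q) A" using b Bc Ac by (auto simp: colon_def)
    qed
  qed
  hence "u_factored R (colon R (Idl ?D) Q)"
    by (intro u_factored_gv_prod[OF B(3) AC(1) DQ]) (auto simp: colon_def)
  hence "u_factored R (Idl ?D)" by (rule u_factored.prime[OF Di prime.hyps(2)])
  thus ?case using fin DI by blast
qed

text \<open>A counterexample could be enlarged to a prime \<open>P\<close> that is not
  \<open>u_factored\<close>. As \<open>P\<close> is regular, it contains a
  \<open>u\<close>-invertible prime \<open>Q\<close>. If \<open>Q\<close> is good,
  \<open>colon R P Q\<close> is all of \<open>R\<close>; otherwise a GV-set lies in \<open>Q\<close>
  and so in \<open>P\<close>. Either way \<open>P\<close> is \<open>u_factored\<close>.\<close>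

lemma regular_ideal_u_factored:
  assumes H: "primes_contain_uinv R" and I: "ideal I R" "I \<inter> regular_elements R \<noteq> {}"
  shows "u_factored R I"
proof (rule ccontr)
  assume n: "\<not> u_factored R I"
  have top: "u_factored R (carrier R)" by (rule u_factored.gv[OF oneideal gv_set_one]) simp
  show False
  proof (rule prime_ideal_principle[of I "u_factored R"])
    fix L assume "ideal L R" "u_factored R L"
    then obtain B where B: "finite B" "B \<subseteq> L" "u_factored R (Idl B)" using u_factored_finite_type by blast
    have "u_factored R M" if "ideal M R" "B \<subseteq> M" for M
      using u_factored_mono[OF B(3) that(1) genideal_minimal[OF that]] .
    thus "\<exists>B. finite B \<and> B \<subseteq> L \<and> (\<forall>M. ideal M R \<longrightarrow> B \<subseteq> M \<longrightarrow> u_factored R M)" using B by blast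
  next
    fix L M N assume "ideal N R" "u_factored R L" "u_factored R M" "\<forall>x\<in>L. \<forall>y\<in>M. x \<otimes> y \<in> N"
    thus "u_factored R N" using u_factored_prod[of L M N] by blast
  next
    fix P assume P: "primeideal P R" "I \<subseteq> P" "\<not> u_factored R P"
    note Pi = primeidealD(1)[OF P(1)]
    obtain Q where Q: "primeideal Q R" "Q \<subseteq> P" "uinv R Q"
      using H P(1,2) I(2) unfolding primes_contain_uinv_def by blast
    show False
    proof (cases "good_prime R Q")
      case True
      have "colon R P Q = carrier R"
        using Q(2) idealD(5)[OF Pi] by (auto simp: colon_def)
      hence "u_factored R P" using u_factored.prime[OF Pi True] top by simp
      thus False using P(3) by blast
    next
      case False
      then obtain A where "gv_set R A" "A \<subseteq> Q" using Q unfolding good_prime_def by blast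
      thus False using u_factored.gv[OF Pi] Q(2) P(3) by blast
    qed
  qed (use I n top in auto)
qed

text \<open>The induction strips good primes from the product inside \<open>I\<close>. For
  \<open>x\<close> with \<open>x Q\<close> in \<open>I\<close>, the fraction
  \<open>y = a x/s\<close> maps \<open>Q\<close> into \<open>R\<close>. As \<open>y\<close> has a
  denominator outside \<open>Q\<close>, it maps \<open>Q\<close> even into \<open>Q\<close>, and
  \<open>uinv_multiplier\<close> puts \<open>y\<close> into \<open>R\<close>. Thus
  \<open>a/s\<close> maps \<open>colon R I Q\<close> into \<open>R\<close> as well.\<close>

lemma divides_of_local:
  assumes "u_factored R I" "a \<in> carrier R" "s \<in> regular_elements R"
    and "\<And>d. d \<in> I \<Longrightarrow> s divides (a \<otimes> d)"
    and "\<And>Q. good_prime R Q \<Longrightarrow> \<exists>d\<in>carrier R - Q. s divides (a \<otimes> d)"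
  shows "s divides a"
  using assms
proof induction
  case (gv I A)
  thus ?case using gv_setD(4)[OF gv.hyps(2) gv.prems(1,2)] by blast
next
  case (prime I Q)
  note Q = good_primeD[OF prime.hyps(2)]
  have sc: "s \<in> carrier R" using prime.prems(2) by (rule regular_carrier)
  obtain d where d: "d \<in> carrier R" "d \<notin> Q" "s divides (a \<otimes> d)" using prime.prems(4)[OF prime.hyps(2)] by blast
  then obtain c' where c': "c' \<in> carrier R" "a \<otimes> d = s \<otimes> c'" by (auto simp: factor_def)
  show ?case
  proof (rule prime.IH[OF prime.prems(1,2) _ prime.prems(4)])
    fix x assume x: "x \<in> colon R I Q"
    hence xc: "x \<in> carrier R" by (simp add: colon_def)
    show "s divides (a \<otimes> x)"
    proof (rule uinv_multiplier[OF Q(2,4) _ prime.prems(2)])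
      show "a \<otimes> x \<in> carrier R" using xc prime.prems(1) by simp
      fix q assume q: "q \<in> Q"
      hence qc: "q \<in> carrier R" using Q(3) by blast
      have "s divides (a \<otimes> (x \<otimes> q))" using prime.prems(3) x q by (auto simp: colon_def)
      then obtain c where c: "c \<in> carrier R" "a \<otimes> (x \<otimes> q) = s \<otimes> c" by (auto simp: factor_def)
      note cr = xc qc sc c(1) c'(1) d(1) prime.prems(1)
      have "s \<otimes> (c \<otimes> d) = (a \<otimes> (x \<otimes> q)) \<otimes> d" using c cr by (simp add: m_assoc)
      also have "\<dots> = (a \<otimes> d) \<otimes> (x \<otimes> q)" using cr by (simp add: m_ac)
      also have "\<dots> = s \<otimes> (c' \<otimes> (x \<otimes> q))" using c' cr by (simp add: m_assoc)
      finally have "c \<otimes> d = c' \<otimes> (x \<otimes> q)" using regular_cancel[OF prime.prems(2)] cr by simp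
      hence "c \<otimes> d \<in> Q" using idealD(5)[OF Q(2)] q cr by simp
      hence "c \<in> Q" using primeidealD(4)[OF Q(1)] d cr by blast
      moreover have "a \<otimes> x \<otimes> q = s \<otimes> c" using c cr by (simp add: m_assoc)
      ultimately show "\<exists>c\<in>Q. a \<otimes> x \<otimes> q = s \<otimes> c" by blast
    qed
  qed
qed

text \<open>The denominator ideal of \<open>a/s\<close> contains the regular element
  \<open>s\<close>, so it is \<open>u_factored\<close> and can serve as the ideal in
  \<open>divides_of_local\<close>.\<close>

lemma divides_of_good_primes:
  assumes H: "primes_contain_uinv R" and a: "a \<in> carrier R" and s: "s \<in> regular_elements R"
    and loc: "\<And>Q. good_prime R Q \<Longrightarrow> \<exists>d\<in>carrier R - Q. s divides (a \<otimes> d)"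
  shows "s divides a"
proof (rule divides_of_local[OF _ a s _ loc])
  let ?I = "{d \<in> carrier R. s divides (a \<otimes> d)}"
  note sc = regular_carrier[OF s]
  have "s \<in> ?I" using a sc by (auto intro: dividesI[of a] simp: m_comm)
  thus "u_factored R ?I"
    using regular_ideal_u_factored[OF H divides_ideal[OF sc a]] s by blast
qed auto

end

section \<open>The total quotient ring\<close>

context cring
begin

abbreviation "TQ \<equiv> total_quotient_ring R"

lemma TQ_carrier_iff:
  "x \<in> carrier TQ \<longleftrightarrow> (\<exists>a s. x = tq_frac R a s \<and> a \<in> carrier R \<and> s \<in> regular_elements R)"
  by (auto simp: total_quotient_ring_def)

lemma TQ_E:
  assumes "x \<in> carrier TQ"
  obtains a s where "x = tq_frac R a s" "a \<in> carrier R" "s \<in> regular_elements R" "s \<in> carrier R"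
  using assms regular_carrier unfolding TQ_carrier_iff by blast

lemma TQ_I: "\<lbrakk>a \<in> carrier R; s \<in> regular_elements R\<rbrakk> \<Longrightarrow> tq_frac R a s \<in> carrier TQ"
  by (auto simp: TQ_carrier_iff)

lemma TQ_one: "\<one>\<^bsub>TQ\<^esub> = tq_frac R \<one> \<one>" and TQ_zero: "\<zero>\<^bsub>TQ\<^esub> = tq_frac R \<zero> \<one>"
  by (simp_all add: total_quotient_ring_def)

lemma TQ_cring: "cring TQ"
proof (rule cringI)
  note rc = regular_elements_closed regular_elements_one
  show "abelian_group TQ"
  proof (rule abelian_groupI)
    fix x y assume xyz: "x \<in> carrier TQ" "y \<in> carrier TQ"
    obtain a s where x: "x = tq_frac R a s" "a \<in> carrier R" "s \<in> regular_elements R" "s \<in> carrier R"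
      using xyz(1) by (rule TQ_E)
    obtain b t where y: "y = tq_frac R b t" "b \<in> carrier R" "t \<in> regular_elements R" "t \<in> carrier R"
      using xyz(2) by (rule TQ_E)
    note h = x y
    show "x \<oplus>\<^bsub>TQ\<^esub> y \<in> carrier TQ" using h by (auto simp: tq_frac_add intro!: TQ_I rc)
    show "x \<oplus>\<^bsub>TQ\<^esub> y = y \<oplus>\<^bsub>TQ\<^esub> x"
      using h by (simp add: tq_frac_add rc tq_frac_eq_iff) (simp add: m_comm a_comm)
  next
    show "\<zero>\<^bsub>TQ\<^esub> \<in> carrier TQ" by (simp add: TQ_zero TQ_I rc)
  next
    fix x y z assume xyz: "x \<in> carrier TQ" "y \<in> carrier TQ" "z \<in> carrier TQ"
    obtain a s where x: "x = tq_frac R a s" "a \<in> carrier R" "s \<in> regular_elements R" "s \<in> carrier R"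
      using xyz(1) by (rule TQ_E)
    obtain b t where y: "y = tq_frac R b t" "b \<in> carrier R" "t \<in> regular_elements R" "t \<in> carrier R"
      using xyz(2) by (rule TQ_E)
    obtain c u where z: "z = tq_frac R c u" "c \<in> carrier R" "u \<in> regular_elements R" "u \<in> carrier R"
      using xyz(3) by (rule TQ_E)
    note h = x y z
    have "(a \<otimes> t \<oplus> b \<otimes> s) \<otimes> u \<oplus> c \<otimes> (s \<otimes> t) = a \<otimes> (t \<otimes> u) \<oplus> (b \<otimes> u \<oplus> c \<otimes> t) \<otimes> s"
      using x(2,4) y(2,4) z(2,4) by (simp add: l_distr r_distr m_ac a_ac)
    thus "x \<oplus>\<^bsub>TQ\<^esub> y \<oplus>\<^bsub>TQ\<^esub> z = x \<oplus>\<^bsub>TQ\<^esub> (y \<oplus>\<^bsub>TQ\<^esub> z)"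
      using h by (simp add: tq_frac_add rc m_assoc)
  next
    fix x assume "x \<in> carrier TQ"
    then obtain a s where h: "x = tq_frac R a s" "a \<in> carrier R" "s \<in> regular_elements R" "s \<in> carrier R" by (rule TQ_E)
    show "\<zero>\<^bsub>TQ\<^esub> \<oplus>\<^bsub>TQ\<^esub> x = x" using h by (simp add: TQ_zero tq_frac_add rc)
    have "tq_frac R (\<ominus> a) s \<oplus>\<^bsub>TQ\<^esub> x = \<zero>\<^bsub>TQ\<^esub>"
      using h by (simp add: TQ_zero tq_frac_add rc tq_frac_eq_iff l_minus l_neg)
    moreover have "tq_frac R (\<ominus> a) s \<in> carrier TQ" using h TQ_I by simp
    ultimately show "\<exists>y\<in>carrier TQ. y \<oplus>\<^bsub>TQ\<^esub> x = \<zero>\<^bsub>TQ\<^esub>" by blast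
  qed
  show "comm_monoid TQ"
  proof (rule comm_monoidI)
    fix x y assume xyz: "x \<in> carrier TQ" "y \<in> carrier TQ"
    obtain a s where x: "x = tq_frac R a s" "a \<in> carrier R" "s \<in> regular_elements R" "s \<in> carrier R"
      using xyz(1) by (rule TQ_E)
    obtain b t where y: "y = tq_frac R b t" "b \<in> carrier R" "t \<in> regular_elements R" "t \<in> carrier R"
      using xyz(2) by (rule TQ_E)
    note h = x y
    show "x \<otimes>\<^bsub>TQ\<^esub> y \<in> carrier TQ" using h by (auto simp: tq_frac_mult intro!: TQ_I rc)
    show "x \<otimes>\<^bsub>TQ\<^esub> y = y \<otimes>\<^bsub>TQ\<^esub> x" using h by (simp add: tq_frac_mult m_comm)
  next
    show "\<one>\<^bsub>TQ\<^esub> \<in> carrier TQ" by (simp add: TQ_one TQ_I rc)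
  next
    fix x y z assume xyz: "x \<in> carrier TQ" "y \<in> carrier TQ" "z \<in> carrier TQ"
    obtain a s where x: "x = tq_frac R a s" "a \<in> carrier R" "s \<in> regular_elements R" "s \<in> carrier R"
      using xyz(1) by (rule TQ_E)
    obtain b t where y: "y = tq_frac R b t" "b \<in> carrier R" "t \<in> regular_elements R" "t \<in> carrier R"
      using xyz(2) by (rule TQ_E)
    obtain c u where z: "z = tq_frac R c u" "c \<in> carrier R" "u \<in> regular_elements R" "u \<in> carrier R"
      using xyz(3) by (rule TQ_E)
    note h = x y z
    show "x \<otimes>\<^bsub>TQ\<^esub> y \<otimes>\<^bsub>TQ\<^esub> z = x \<otimes>\<^bsub>TQ\<^esub> (y \<otimes>\<^bsub>TQ\<^esub> z)"
      using h by (simp add: tq_frac_mult rc m_assoc)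
  next
    fix x assume "x \<in> carrier TQ"
    then obtain a s where h: "x = tq_frac R a s" "a \<in> carrier R" "s \<in> regular_elements R" "s \<in> carrier R" by (rule TQ_E)
    show "\<one>\<^bsub>TQ\<^esub> \<otimes>\<^bsub>TQ\<^esub> x = x" using h by (simp add: TQ_one tq_frac_mult rc)
  qed
  fix x y z assume xyz: "x \<in> carrier TQ" "y \<in> carrier TQ" "z \<in> carrier TQ"
  obtain a s where x: "x = tq_frac R a s" "a \<in> carrier R" "s \<in> regular_elements R" "s \<in> carrier R"
    using xyz(1) by (rule TQ_E)
  obtain b t where y: "y = tq_frac R b t" "b \<in> carrier R" "t \<in> regular_elements R" "t \<in> carrier R"
    using xyz(2) by (rule TQ_E)
  obtain c u where z: "z = tq_frac R c u" "c \<in> carrier R" "u \<in> regular_elements R" "u \<in> carrier R"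
    using xyz(3) by (rule TQ_E)
  have "((a \<otimes> t \<oplus> b \<otimes> s) \<otimes> c) \<otimes> ((s \<otimes> u) \<otimes> (t \<otimes> u))
      = ((a \<otimes> c) \<otimes> (t \<otimes> u) \<oplus> (b \<otimes> c) \<otimes> (s \<otimes> u)) \<otimes> ((s \<otimes> t) \<otimes> u)"
    using x(2,4) y(2,4) z(2,4) by (simp add: l_distr r_distr m_ac)
  thus "(x \<oplus>\<^bsub>TQ\<^esub> y) \<otimes>\<^bsub>TQ\<^esub> z = x \<otimes>\<^bsub>TQ\<^esub> z \<oplus>\<^bsub>TQ\<^esub> y \<otimes>\<^bsub>TQ\<^esub> z"
    unfolding x(1) y(1) z(1)
    using x(2-) y(2-) z(2-) by (simp add: tq_frac_mult tq_frac_add rc tq_frac_eq_iff)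
qed

section \<open>Fractions, inverses and \<open>u\<close>-invertibility in terms of
  divisibility\<close>

lemma tq_embed_closed: "a \<in> carrier R \<Longrightarrow> tq_embed R a \<in> carrier TQ"
  by (simp add: tq_embed_def TQ_I regular_elements_one)

lemma tq_embed_add: "\<lbrakk>a \<in> carrier R; b \<in> carrier R\<rbrakk> \<Longrightarrow> tq_embed R a \<oplus>\<^bsub>TQ\<^esub> tq_embed R b = tq_embed R (a \<oplus> b)"
  by (simp add: tq_embed_def tq_frac_add regular_elements_one)

lemma tq_embed_mult: "\<lbrakk>a \<in> carrier R; b \<in> carrier R\<rbrakk> \<Longrightarrow> tq_embed R a \<otimes>\<^bsub>TQ\<^esub> tq_embed R b = tq_embed R (a \<otimes> b)"
  by (simp add: tq_embed_def tq_frac_mult regular_elements_one)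

lemma tq_embed_inj: "\<lbrakk>a \<in> carrier R; b \<in> carrier R\<rbrakk> \<Longrightarrow> tq_embed R a = tq_embed R b \<longleftrightarrow> a = b"
  by (simp add: tq_embed_def tq_frac_eq_iff regular_elements_one)

lemma tq_frac_mult_embed:
  "\<lbrakk>a \<in> carrier R; s \<in> regular_elements R; b \<in> carrier R\<rbrakk>
    \<Longrightarrow> tq_frac R a s \<otimes>\<^bsub>TQ\<^esub> tq_embed R b = tq_frac R (a \<otimes> b) s"
  by (simp add: tq_embed_def tq_frac_mult regular_elements_one regular_carrier)

lemma tq_frac_eq_embed:
  "\<lbrakk>a \<in> carrier R; s \<in> regular_elements R; b \<in> carrier R\<rbrakk> \<Longrightarrow> tq_frac R a s = tq_embed R b \<longleftrightarrow> a = s \<otimes> b"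
  by (simp add: tq_embed_def tq_frac_eq_iff regular_elements_one regular_carrier m_comm)

lemma tq_frac_in_embed:
  assumes "a \<in> carrier R" "s \<in> regular_elements R"
  shows "tq_frac R a s \<in> tq_embed R ` carrier R \<longleftrightarrow> s divides a"
proof -
  have "tq_frac R a s \<in> tq_embed R ` carrier R \<longleftrightarrow> (\<exists>b\<in>carrier R. tq_frac R a s = tq_embed R b)" by blast
  thus ?thesis using tq_frac_eq_embed[OF assms] by (auto simp: factor_def)
qed

lemma tq_frac_in_inverse:
  assumes "a \<in> carrier R" "s \<in> regular_elements R" "B \<subseteq> carrier R"
  shows "tq_frac R a s \<in> tq_inverse R (tq_embed R ` B) \<longleftrightarrow> (\<forall>x\<in>B. s divides (a \<otimes> x))"
proof -
  have "tq_frac R a s \<otimes>\<^bsub>TQ\<^esub> tq_embed R x \<in> tq_embed R ` carrier R \<longleftrightarrow> s divides (a \<otimes> x)" if "x \<in> B" for x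
  proof -
    have "x \<in> carrier R" using assms(3) that by blast
    thus ?thesis using tq_frac_mult_embed[OF assms(1,2)] tq_frac_in_embed[of "a \<otimes> x" s] assms(1,2) by simp
  qed
  thus ?thesis using TQ_I[OF assms(1,2)] by (auto simp: tq_inverse_def)
qed

lemma gv_set_Idl:
  assumes "A \<subseteq> carrier R" "a \<in> carrier R" "s \<in> carrier R"
  shows "(\<forall>j\<in>Idl A. s divides (a \<otimes> j)) \<longleftrightarrow> (\<forall>j\<in>A. s divides (a \<otimes> j))"
proof -
  have "A \<subseteq> {d \<in> carrier R. s divides (a \<otimes> d)} \<Longrightarrow> Idl A \<subseteq> {d \<in> carrier R. s divides (a \<otimes> d)}"
    by (rule genideal_minimal[OF divides_ideal]) (use assms in auto)
  thus ?thesis using genideal_self[OF assms(1)] assms(1) by blast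
qed

text \<open>The condition \<open>J^-1 = R\<close> is tested on one fraction \<open>a/s\<close> at a
  time, and on generators of \<open>J\<close> only. The inclusion of \<open>R\<close> in
  \<open>J^-1\<close> is automatic, so what remains is the implication in
  \<open>gv_set\<close>.\<close>

lemma rGV_iff: "J \<in> rGV R \<longleftrightarrow> (\<exists>A. gv_set R A \<and> J = Idl A)"
proof -
  have *: "tq_inverse R (tq_embed R ` (Idl A)) = tq_embed R ` carrier R \<longleftrightarrow>
     (\<forall>a\<in>carrier R. \<forall>s\<in>regular_elements R. (\<forall>j\<in>A. s divides (a \<otimes> j)) \<longrightarrow> s divides a)"
    (is "?l \<longleftrightarrow> ?r") if A: "A \<subseteq> carrier R" for A
  proof -
    have Ac: "Idl A \<subseteq> carrier R" using idealD(1)[OF genideal_ideal[OF A]] by blast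
    have *: "tq_frac R a s \<in> tq_inverse R (tq_embed R ` (Idl A)) \<longleftrightarrow> (\<forall>j\<in>A. s divides (a \<otimes> j))"
      if "a \<in> carrier R" "s \<in> regular_elements R" for a s
      using tq_frac_in_inverse[OF that Ac] gv_set_Idl[OF A that(1) regular_carrier[OF that(2)]] by simp
    show ?thesis
    proof
      assume l: ?l
      show ?r
      proof (intro ballI impI)
        fix a s assume as: "a \<in> carrier R" "s \<in> regular_elements R" and "\<forall>j\<in>A. s divides (a \<otimes> j)"
        thus "s divides a" using *[OF as] tq_frac_in_embed[OF as] l by simp
      qed
    next
      assume r: ?r
      have "x \<in> tq_inverse R (tq_embed R ` (Idl A)) \<longleftrightarrow> x \<in> tq_embed R ` carrier R"
        if xc: "x \<in> carrier TQ" for x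
      proof -
        obtain a s where h: "x = tq_frac R a s" "a \<in> carrier R" "s \<in> regular_elements R" "s \<in> carrier R"
          using xc by (rule TQ_E)
        have "s divides a \<Longrightarrow> s divides (a \<otimes> j)" if "j \<in> A" for j
          using that A h divides_prod_r[of s a j] by auto
        thus ?thesis unfolding h(1) *[OF h(2,3)] tq_frac_in_embed[OF h(2,3)] using r h(2,3) by blast
      qed
      moreover have "tq_inverse R (tq_embed R ` (Idl A)) \<subseteq> carrier TQ" by (auto simp: tq_inverse_def)
      moreover have "tq_embed R ` carrier R \<subseteq> carrier TQ" using tq_embed_closed by blast
      ultimately show ?l by blast
    qed
  qed
  show ?thesis
  proof
    assume "J \<in> rGV R"
    then obtain A where A: "A \<subseteq> carrier R" "finite A" "J = Idl A" "J \<inter> regular_elements R \<noteq> {}"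
      "tq_inverse R (tq_embed R ` J) = tq_embed R ` carrier R" unfolding rGV_def by auto
    have "gv_set R A" unfolding gv_set_def using A(1,2,4,5) *[OF A(1)] A(3) by simp
    thus "\<exists>A. gv_set R A \<and> J = Idl A" using A(3) by blast
  next
    assume "\<exists>A. gv_set R A \<and> J = Idl A"
    then obtain A where A: "gv_set R A" "J = Idl A" by blast
    note Ac = gv_setD(1,2)[OF A(1)]
    have "tq_inverse R (tq_embed R ` (Idl A)) = tq_embed R ` carrier R"
      using *[OF Ac(2)] A(1) unfolding gv_set_def by simp
    moreover have "J \<inter> regular_elements R \<noteq> {}" using A unfolding gv_set_def by simp
    ultimately show "J \<in> rGV R" unfolding rGV_def using A(2) Ac genideal_ideal[OF Ac(2)] by auto
  qed
qed

text \<open>A product \<open>q (b/s)\<close> with \<open>b/s\<close> in \<open>Q^-1\<close> is an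
  element of \<open>R\<close> belonging to \<open>inverse_products\<close>, and sums correspond to
  sums. For the converse, the elements of \<open>R\<close> that lie in \<open>Q Q^-1\<close> form an
  ideal, which requires closure of \<open>ideal_prod\<close> under multiplication by
  \<open>R\<close>.\<close>

lemma inverse_product_iff:
  assumes Q: "ideal Q R" and d: "d \<in> carrier R"
  shows "tq_embed R d \<in> ideal_prod TQ (tq_embed R ` Q) (tq_inverse R (tq_embed R ` Q))
     \<longleftrightarrow> d \<in> Idl (inverse_products R Q)"
proof -
  interpret T: cring TQ by (rule TQ_cring)
  note Qr = idealD[OF Q]
  have Qc: "Q \<subseteq> carrier R" using Qr(1) by blast
  let ?Qi = "tq_inverse R (tq_embed R ` Q)"
  let ?P = "ideal_prod TQ (tq_embed R ` Q) ?Qi"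
  have ID: "ideal (Idl (inverse_products R Q)) R" by (rule genideal_ideal[OF inverse_products_carrier])
  have "x \<in> tq_embed R ` (Idl (inverse_products R Q))" if "x \<in> ?P" for x
    using that
  proof induction
    case (prod i j)
    then obtain q where q: "q \<in> Q" "i = tq_embed R q" by blast
    have "j \<in> carrier TQ" using prod(2) by (simp add: tq_inverse_def)
    then obtain b s where j: "j = tq_frac R b s" "b \<in> carrier R" "s \<in> regular_elements R" "s \<in> carrier R" by (rule TQ_E)
    have *: "\<forall>x\<in>Q. s divides (b \<otimes> x)" using prod(2) tq_frac_in_inverse[OF j(2,3) Qc] j(1) by simp
    then obtain e where e: "e \<in> carrier R" "b \<otimes> q = s \<otimes> e" using q(1) by (auto simp: factor_def)
    have qb: "q \<otimes> b = s \<otimes> e" using e(2) m_comm Qr(1)[OF q(1)] j(2) by simp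
    have "e \<in> inverse_products R Q"
      unfolding inverse_products_def using e(1) q(1) j(2,3) * qb by blast
    moreover have "i \<otimes>\<^bsub>TQ\<^esub> j = tq_embed R e"
    proof -
      have "i \<otimes>\<^bsub>TQ\<^esub> j = j \<otimes>\<^bsub>TQ\<^esub> i"
        using q j Qr(1) tq_embed_closed TQ_I by (intro T.m_comm) auto
      also have "\<dots> = tq_frac R (b \<otimes> q) s" using tq_frac_mult_embed q j Qr(1) by simp
      also have "\<dots> = tq_embed R e" using tq_frac_eq_embed[of "b \<otimes> q" s e] e j Qr(1)[OF q(1)] by simp
      finally show ?thesis .
    qed
    ultimately show ?case using genideal_self[OF inverse_products_carrier] by blast
  next
    case (sum x y)
    then obtain a b where "a \<in> Idl (inverse_products R Q)" "b \<in> Idl (inverse_products R Q)"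
      "x = tq_embed R a" "y = tq_embed R b" by blast
    thus ?case using idealD(1,3)[OF ID] tq_embed_add by auto
  qed
  hence 1: "d \<in> Idl (inverse_products R Q)" if "tq_embed R d \<in> ?P"
    using that tq_embed_inj[OF d] idealD(1)[OF ID] by blast
  let ?I = "{d \<in> carrier R. tq_embed R d \<in> ?P}"
  have z: "\<zero>\<^bsub>TQ\<^esub> \<in> ?Qi" unfolding TQ_zero
    using tq_frac_in_inverse[OF zero_closed regular_elements_one Qc] Qc by (auto simp: factor_def)
  \<comment> \<open>Membership in \<open>carrier TQ\<close> is carried along so that distributivity
    is available in the \<open>sum\<close> case.\<close>
  have Pr: "tq_embed R r \<otimes>\<^bsub>TQ\<^esub> x \<in> ?P \<and> x \<in> carrier TQ" if r: "r \<in> carrier R" and x: "x \<in> ?P" for r x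
    using x
  proof induction
    case (prod i j)
    then obtain q where q: "q \<in> Q" "i = tq_embed R q" by blast
    have jc: "j \<in> carrier TQ" using prod(2) by (simp add: tq_inverse_def)
    have ic: "i \<in> carrier TQ" using q Qr(1) tq_embed_closed by simp
    have "tq_embed R r \<otimes>\<^bsub>TQ\<^esub> (i \<otimes>\<^bsub>TQ\<^esub> j) = tq_embed R (r \<otimes> q) \<otimes>\<^bsub>TQ\<^esub> j"
      using T.m_assoc[OF tq_embed_closed[OF r] ic jc] tq_embed_mult[OF r Qr(1)[OF q(1)]] q(2) by simp
    moreover have "tq_embed R (r \<otimes> q) \<otimes>\<^bsub>TQ\<^esub> j \<in> ?P"
      by (rule ideal_prod.prod[OF _ prod(2)]) (use Qr(5)[OF r q(1)] in blast)
    ultimately show ?case using ic jc by simp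
  next
    case (sum x y)
    have "tq_embed R r \<otimes>\<^bsub>TQ\<^esub> (x \<oplus>\<^bsub>TQ\<^esub> y) = tq_embed R r \<otimes>\<^bsub>TQ\<^esub> x \<oplus>\<^bsub>TQ\<^esub> tq_embed R r \<otimes>\<^bsub>TQ\<^esub> y"
      using sum.IH tq_embed_closed[OF r] T.r_distr by blast
    thus ?case using sum.IH ideal_prod.sum by fastforce
  qed
  have "ideal ?I R"
  proof (rule idealI_cring)
    have "tq_embed R \<zero> \<otimes>\<^bsub>TQ\<^esub> \<zero>\<^bsub>TQ\<^esub> \<in> ?P" using ideal_prod.prod[OF _ z] Qr(2) by blast
    thus "\<zero> \<in> ?I" using tq_embed_mult[OF zero_closed zero_closed] by (simp add: TQ_zero tq_embed_def)
    show "a \<oplus> b \<in> ?I" if "a \<in> ?I" "b \<in> ?I" for a b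
      using that ideal_prod.sum[of "tq_embed R a" TQ _ _ "tq_embed R b"] by (simp add: tq_embed_add)
    show "x \<otimes> a \<in> ?I" if "a \<in> ?I" "x \<in> carrier R" for a x
      using that Pr[of x "tq_embed R a"] by (simp add: tq_embed_mult)
  qed auto
  moreover have "inverse_products R Q \<subseteq> ?I"
  proof
    fix d assume "d \<in> inverse_products R Q"
    then obtain q s b where e: "d \<in> carrier R" "q \<in> Q" "s \<in> regular_elements R" "b \<in> carrier R"
      "\<And>x. x \<in> Q \<Longrightarrow> s divides (b \<otimes> x)" "q \<otimes> b = s \<otimes> d"
      by (rule inverse_productsE) blast
    have qc: "q \<in> carrier R" using Qr(1)[OF e(2)] .
    have "tq_frac R b s \<in> ?Qi" using tq_frac_in_inverse[OF e(4,3) Qc] e(5) by simp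
    hence "tq_embed R q \<otimes>\<^bsub>TQ\<^esub> tq_frac R b s \<in> ?P"
      by (rule ideal_prod.prod[OF imageI[OF e(2)]])
    moreover have "tq_embed R q \<otimes>\<^bsub>TQ\<^esub> tq_frac R b s = tq_frac R b s \<otimes>\<^bsub>TQ\<^esub> tq_embed R q"
      using TQ_I e tq_embed_closed qc by (intro T.m_comm) auto
    moreover have "\<dots> = tq_embed R d"
      using tq_frac_mult_embed[OF e(4,3) qc] tq_frac_eq_embed[of "b \<otimes> q" s d] e qc m_comm by simp
    ultimately show "d \<in> ?I" using e(1) by simp
  qed
  ultimately have "Idl (inverse_products R Q) \<subseteq> ?I" by (rule genideal_minimal)
  thus ?thesis using 1 by blast
qed

text \<open>As \<open>Q Q^-1\<close> lies in \<open>R\<close> and GV-ideals have trivial inverse,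
  the \<open>u\<close>-closure of \<open>Q Q^-1\<close> never leaves \<open>R\<close>. So
  \<open>u\<close>-invertibility is the statement that \<open>\<one>\<close> belongs to this
  closure.\<close>

lemma u_invertible_iff:
  assumes Q: "ideal Q R"
  shows "u_invertible R (tq_embed R ` Q) \<longleftrightarrow> uinv R Q"
proof -
  interpret T: cring TQ by (rule TQ_cring)
  let ?P = "ideal_prod TQ (tq_embed R ` Q) (tq_inverse R (tq_embed R ` Q))"
  have ID: "ideal (Idl (inverse_products R Q)) R" by (rule genideal_ideal[OF inverse_products_carrier])
  have Qc: "Q \<subseteq> carrier R" using idealD(1)[OF Q] by blast
  have PR: "x \<in> tq_embed R ` carrier R" if "x \<in> ?P" for x
    using that
  proof induction
    case (prod i j)
    then obtain q where q: "q \<in> Q" "i = tq_embed R q" by blast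
    have "j \<in> carrier TQ" using prod(2) by (simp add: tq_inverse_def)
    hence "i \<otimes>\<^bsub>TQ\<^esub> j = j \<otimes>\<^bsub>TQ\<^esub> i" using q Qc tq_embed_closed by (intro T.m_comm) auto
    thus ?case using prod by (auto simp: tq_inverse_def)
  next
    case (sum x y) thus ?case using tq_embed_add by fastforce
  qed
  have sub: "u_closure R ?P \<subseteq> tq_embed R ` carrier R"
  proof
    fix x assume x: "x \<in> u_closure R ?P"
    then obtain J where J: "J \<in> rGV R" "\<forall>j\<in>J. x \<otimes>\<^bsub>TQ\<^esub> tq_embed R j \<in> ?P" and xc: "x \<in> carrier TQ"
      unfolding u_closure_def by auto
    from J obtain A where A: "gv_set R A" "\<forall>j\<in>Idl A. x \<otimes>\<^bsub>TQ\<^esub> tq_embed R j \<in> ?P"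
      unfolding rGV_iff by auto
    obtain a s where h: "x = tq_frac R a s" "a \<in> carrier R" "s \<in> regular_elements R" "s \<in> carrier R"
      using xc by (rule TQ_E)
    have "s divides a"
    proof (rule gv_setD(4)[OF A(1) h(2,3)])
      fix j assume j: "j \<in> A"
      hence jc: "j \<in> carrier R" "j \<in> Idl A" using gv_setD(2)[OF A(1)] genideal_self by blast+
      hence "tq_frac R (a \<otimes> j) s \<in> tq_embed R ` carrier R"
        using A(2) PR tq_frac_mult_embed[OF h(2,3) jc(1)] h(1) by fastforce
      thus "s divides (a \<otimes> j)" using tq_frac_in_embed h jc by simp
    qed
    thus "x \<in> tq_embed R ` carrier R" using tq_frac_in_embed h by simp
  qed
  show ?thesis
  proof
    assume "u_invertible R (tq_embed R ` Q)"
    hence "tq_embed R \<one> \<in> u_closure R ?P" unfolding u_invertible_def by auto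
    then obtain J where "J \<in> rGV R" "\<forall>j\<in>J. tq_embed R \<one> \<otimes>\<^bsub>TQ\<^esub> tq_embed R j \<in> ?P"
      unfolding u_closure_def by auto
    then obtain A where A: "gv_set R A" "\<forall>j\<in>Idl A. tq_embed R \<one> \<otimes>\<^bsub>TQ\<^esub> tq_embed R j \<in> ?P"
      unfolding rGV_iff by auto
    have "A \<subseteq> Idl (inverse_products R Q)"
    proof
      fix j assume j: "j \<in> A"
      hence jc: "j \<in> carrier R" "j \<in> Idl A" using gv_setD(2)[OF A(1)] genideal_self by blast+
      hence "tq_embed R j \<in> ?P" using A(2) tq_embed_mult[of \<one> j] by fastforce
      thus "j \<in> Idl (inverse_products R Q)" using inverse_product_iff[OF Q jc(1)] by simp
    qed
    thus "uinv R Q" unfolding uinv_def using A(1) by blast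
  next
    assume "uinv R Q"
    then obtain A where A: "gv_set R A" "A \<subseteq> Idl (inverse_products R Q)" unfolding uinv_def by blast
    have Ac: "Idl A \<subseteq> carrier R" using idealD(1)[OF genideal_ideal] gv_setD(2)[OF A(1)] by blast
    have AI: "Idl A \<subseteq> Idl (inverse_products R Q)" by (rule genideal_minimal[OF ID A(2)])
    have "tq_embed R x \<in> u_closure R ?P" if x: "x \<in> carrier R" for x
    proof -
      have "tq_embed R x \<otimes>\<^bsub>TQ\<^esub> tq_embed R j \<in> ?P" if j: "j \<in> Idl A" for j
      proof -
        have jc: "j \<in> carrier R" using j Ac by blast
        have "x \<otimes> j \<in> Idl (inverse_products R Q)" using idealD(5)[OF ID x] AI j by blast
        thus ?thesis using inverse_product_iff[OF Q] tq_embed_mult[OF x jc] x jc by simp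
      qed
      moreover have "Idl A \<in> rGV R" using A(1) rGV_iff by blast
      ultimately show ?thesis unfolding u_closure_def using tq_embed_closed[OF x] by blast
    qed
    thus "u_invertible R (tq_embed R ` Q)" unfolding u_invertible_def using sub by blast
  qed
qed

end

section \<open>Quotients by an idempotent\<close>

text \<open>This is the projection onto the direct factor \<open>eR\<close>. Idempotence of
  \<open>e\<close> follows because \<open>e\<close> and \<open>\<one>\<close> have the same image,
  see \<open>e_idem\<close>. The codomain is left abstract because the locale is used for
  \<open>idem_ring\<close>, for the projections of a direct product of a list, and for
  composites.\<close>

locale idempotent_quotient = ring_hom_cring R S h for R (structure) and S (structure) and h +
  fixes e
  assumes e_carrier [simp]: "e \<in> carrier R"
    and surj: "h ` carrier R = carrier S"
    and hom_e [simp]: "h e = \<one>\<^bsub>S\<^esub>"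
    and kernel: "\<lbrakk>x \<in> carrier R; h x = \<zero>\<^bsub>S\<^esub>\<rbrakk> \<Longrightarrow> e \<otimes> x = \<zero>"
begin

lemma lift:
  assumes "y \<in> carrier S"
  obtains x where "x \<in> carrier R" "h x = y"
  using assms unfolding surj[symmetric] by (elim imageE) simp

lemma kernel_iff: "x \<in> carrier R \<Longrightarrow> h x = \<zero>\<^bsub>S\<^esub> \<longleftrightarrow> e \<otimes> x = \<zero>"
proof
  assume x: "x \<in> carrier R" "e \<otimes> x = \<zero>"
  have "h x = h (e \<otimes> x)" using x(1) by simp
  thus "h x = \<zero>\<^bsub>S\<^esub>" using x(2) by simp
qed (rule kernel)

lemma hom_eqD: "\<lbrakk>x \<in> carrier R; y \<in> carrier R; h x = h y\<rbrakk> \<Longrightarrow> e \<otimes> x = e \<otimes> y"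
proof -
  assume x: "x \<in> carrier R" "y \<in> carrier R" "h x = h y"
  have "h (x \<ominus> y) = \<zero>\<^bsub>S\<^esub>" using x by (simp add: R.minus_eq S.r_neg)
  hence "e \<otimes> (x \<ominus> y) = \<zero>" using kernel x by simp
  hence "e \<otimes> x \<ominus> e \<otimes> y = \<zero>" using x by (simp add: R.r_distr R.minus_eq R.r_minus)
  thus ?thesis using x by (simp add: R.r_right_minus_eq)
qed

lemma e_idem: "e \<otimes> e = e"
  using hom_eqD[of e \<one>] by simp

lemma e_compl: "e \<otimes> (\<one> \<ominus> e) = \<zero>" "(\<one> \<ominus> e) \<otimes> e = \<zero>" "(\<one> \<ominus> e) \<otimes> (\<one> \<ominus> e) = \<one> \<ominus> e"
proof -
  show 1: "e \<otimes> (\<one> \<ominus> e) = \<zero>" by (simp add: R.minus_eq R.r_distr R.r_minus e_idem R.r_neg)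
  thus 2: "(\<one> \<ominus> e) \<otimes> e = \<zero>" by (simp add: R.m_comm)
  have "(\<one> \<ominus> e) \<otimes> (\<one> \<ominus> e) = (\<one> \<ominus> e) \<ominus> e \<otimes> (\<one> \<ominus> e)"
    by (simp add: R.minus_eq R.l_distr R.l_minus)
  thus "(\<one> \<ominus> e) \<otimes> (\<one> \<ominus> e) = \<one> \<ominus> e" using 1 by (simp add: R.minus_eq)
qed

lemma decompose: "x \<in> carrier R \<Longrightarrow> x = e \<otimes> x \<oplus> (\<one> \<ominus> e) \<otimes> x"
proof -
  assume x: "x \<in> carrier R"
  have "e \<otimes> x \<oplus> (\<one> \<ominus> e) \<otimes> x = (e \<oplus> (\<one> \<ominus> e)) \<otimes> x" using x by (simp add: R.l_distr)
  also have "e \<oplus> (\<one> \<ominus> e) = \<one>" using R.a_comm[of "e"] by (simp add: R.minus_eq R.a_assoc R.r_neg R.l_neg)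
  finally show ?thesis using x by simp
qed

lemma hom_compl: "h (\<one> \<ominus> e) = \<zero>\<^bsub>S\<^esub>"
  using kernel_iff[of "\<one> \<ominus> e"] e_compl by simp

text \<open>In the decomposition of \<open>R\<close> into \<open>eR\<close> and
  \<open>(1-e)R\<close> this is the pair of the \<open>e\<close>-component of \<open>s\<close> and
  the identity. A lift of a regular element of the quotient is thereby corrected to a regular
  element of \<open>R\<close> with the same image.\<close>

definition reg_lift where "reg_lift s = e \<otimes> s \<oplus> (\<one> \<ominus> e)"

lemma reg_lift_closed [simp]: "s \<in> carrier R \<Longrightarrow> reg_lift s \<in> carrier R"
  by (simp add: reg_lift_def)

lemma hom_reg_lift: "s \<in> carrier R \<Longrightarrow> h (reg_lift s) = h s"
  by (simp add: reg_lift_def hom_compl)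

lemma reg_lift_mult_e: "s \<in> carrier R \<Longrightarrow> c \<in> carrier R \<Longrightarrow> reg_lift s \<otimes> (e \<otimes> c) = e \<otimes> (s \<otimes> c)"
proof -
  assume sc: "s \<in> carrier R" "c \<in> carrier R"
  have "reg_lift s \<otimes> (e \<otimes> c) = (e \<otimes> s) \<otimes> (e \<otimes> c) \<oplus> ((\<one> \<ominus> e) \<otimes> e) \<otimes> c"
    unfolding reg_lift_def using sc by (simp add: R.l_distr R.m_assoc)
  also have "(e \<otimes> s) \<otimes> (e \<otimes> c) = (e \<otimes> e) \<otimes> (s \<otimes> c)" using sc by (simp add: R.m_ac)
  finally show ?thesis using sc by (simp add: e_idem e_compl)
qed

lemma e_compl_add: "(\<one> \<ominus> e) \<oplus> e = \<one>"
  by (simp add: R.minus_eq R.a_assoc R.l_neg)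

lemma reg_lift_mult_compl: "s \<in> carrier R \<Longrightarrow> reg_lift s \<otimes> (\<one> \<ominus> e) = \<one> \<ominus> e"
proof -
  assume s: "s \<in> carrier R"
  have "reg_lift s \<otimes> (\<one> \<ominus> e) = (e \<otimes> s) \<otimes> (\<one> \<ominus> e) \<oplus> (\<one> \<ominus> e) \<otimes> (\<one> \<ominus> e)"
    unfolding reg_lift_def using s by (simp add: R.l_distr)
  also have "(e \<otimes> s) \<otimes> (\<one> \<ominus> e) = s \<otimes> (e \<otimes> (\<one> \<ominus> e))" using s by (simp add: R.m_ac)
  finally have "reg_lift s \<otimes> (\<one> \<ominus> e) = s \<otimes> (e \<otimes> (\<one> \<ominus> e)) \<oplus> (\<one> \<ominus> e) \<otimes> (\<one> \<ominus> e)" .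
  thus ?thesis unfolding e_compl using s by simp
qed

section \<open>Regular elements and divisibility in the quotient\<close>

lemma regular_hom:
  assumes "s \<in> regular_elements R"
  shows "h s \<in> regular_elements S"
proof -
  have sc: "s \<in> carrier R" using assms by (rule R.regular_carrier)
  have "y = \<zero>\<^bsub>S\<^esub>" if y: "y \<in> carrier S" "h s \<otimes>\<^bsub>S\<^esub> y = \<zero>\<^bsub>S\<^esub>" for y
  proof -
    obtain x where x: "x \<in> carrier R" "h x = y" using lift y(1) by blast
    hence "h (s \<otimes> x) = \<zero>\<^bsub>S\<^esub>" using y sc by simp
    hence "e \<otimes> (s \<otimes> x) = \<zero>" using kernel sc x by simp
    hence "s \<otimes> (e \<otimes> x) = s \<otimes> \<zero>" using sc x by (simp add: R.m_lcomm)
    hence "e \<otimes> x = \<zero>" using R.regular_cancel[OF assms, of "e \<otimes> x" \<zero>] x by simp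
    thus ?thesis using kernel_iff x by blast
  qed
  thus ?thesis unfolding regular_elements_def using sc by simp
qed

lemma regular_lift:
  assumes "s \<in> carrier R" "h s \<in> regular_elements S"
  shows "reg_lift s \<in> regular_elements R"
proof -
  have "x = \<zero>" if x: "x \<in> carrier R" "reg_lift s \<otimes> x = \<zero>" for x
  proof -
    have "h s \<otimes>\<^bsub>S\<^esub> h x = h (reg_lift s \<otimes> x)" using assms(1) x(1) by (simp add: hom_reg_lift)
    hence "h s \<otimes>\<^bsub>S\<^esub> h x = \<zero>\<^bsub>S\<^esub>" using x by simp
    hence "h x = \<zero>\<^bsub>S\<^esub>" using assms(2) x(1) by (simp add: regular_elements_def)
    hence 1: "e \<otimes> x = \<zero>" using kernel x by simp
    have "(\<one> \<ominus> e) \<otimes> (reg_lift s \<otimes> x) = (((\<one> \<ominus> e) \<otimes> e) \<otimes> s \<oplus> (\<one> \<ominus> e) \<otimes> (\<one> \<ominus> e)) \<otimes> x"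
      unfolding reg_lift_def using assms(1) x(1) by (simp add: R.r_distr R.l_distr R.m_assoc)
    hence "(\<one> \<ominus> e) \<otimes> x = \<zero>" using x assms(1) by (simp add: e_compl)
    thus "x = \<zero>" using decompose[OF x(1)] 1 by simp
  qed
  thus ?thesis unfolding regular_elements_def using assms(1) by simp
qed

lemma divides_hom:
  assumes "x divides y" "x \<in> carrier R"
  shows "h x divides\<^bsub>S\<^esub> h y"
  using assms by (auto simp: factor_def)

text \<open>A quotient in the factor lifts after multiplication by \<open>e\<close>, and on
  \<open>eR\<close> the elements \<open>s\<close> and \<open>reg_lift s\<close> act alike. The
  latter is taken as divisor since it is regular whenever \<open>h s\<close> is.\<close>

lemma divides_lift:
  assumes "a \<in> carrier R" "s \<in> carrier R" "h s divides\<^bsub>S\<^esub> h a"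
  shows "reg_lift s divides (e \<otimes> a)"
proof -
  obtain c' where c': "c' \<in> carrier S" "h a = h s \<otimes>\<^bsub>S\<^esub> c'" using assms(3) by (auto simp: factor_def)
  then obtain c where c: "c \<in> carrier R" "h c = c'" using lift by blast
  have "h a = h (s \<otimes> c)" by (simp add: c c'(2) assms(1,2))
  hence "e \<otimes> a = e \<otimes> (s \<otimes> c)" by (intro hom_eqD) (simp_all add: assms(1,2) c(1))
  hence "e \<otimes> a = reg_lift s \<otimes> (e \<otimes> c)" using reg_lift_mult_e[OF assms(2) c(1)] by simp
  moreover have "e \<otimes> c \<in> carrier R" using c(1) by simp
  ultimately show ?thesis unfolding factor_def by blast
qed

section \<open>Correspondence of ideals\<close>

lemma vimage_ideal:
  assumes "ideal I S"
  shows "ideal {x \<in> carrier R. h x \<in> I} R"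
  by (rule R.idealI_cring) (use S.idealD[OF assms] in auto)

lemma image_ideal:
  assumes "ideal I R"
  shows "ideal (h ` I) S"
proof (rule S.idealI_cring)
  note I = R.idealD[OF assms]
  show "h ` I \<subseteq> carrier S" using I(1) by auto
  show "\<zero>\<^bsub>S\<^esub> \<in> h ` I" using I(2) hom_zero by (metis imageI)
  fix a assume "a \<in> h ` I"
  then obtain a' where a': "a' \<in> I" "a = h a'" by blast
  show "a \<oplus>\<^bsub>S\<^esub> b \<in> h ` I" if b: "b \<in> h ` I" for b
  proof -
    obtain b' where b': "b' \<in> I" "b = h b'" using b by blast
    have "a \<oplus>\<^bsub>S\<^esub> b = h (a' \<oplus> b')" using a' b' I(1) by simp
    thus ?thesis using I(3)[OF a'(1) b'(1)] by blast
  qed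
  show "x \<otimes>\<^bsub>S\<^esub> a \<in> h ` I" if x: "x \<in> carrier S" for x
  proof -
    obtain x' where x': "x' \<in> carrier R" "h x' = x" using lift x by blast
    have "x \<otimes>\<^bsub>S\<^esub> a = h (x' \<otimes> a')" using a' x' I(1) by simp
    thus ?thesis using I(5)[OF x'(1) a'(1)] by blast
  qed
qed

lemma vimage_primeideal:
  assumes "primeideal P S"
  shows "primeideal {x \<in> carrier R. h x \<in> P} R" "e \<notin> {x \<in> carrier R. h x \<in> P}"
proof -
  note P = S.primeidealD[OF assms]
  show Pe: "e \<notin> {x \<in> carrier R. h x \<in> P}" using P(2) by simp
  show "primeideal {x \<in> carrier R. h x \<in> P} R"
  proof (rule primeidealI[OF vimage_ideal[OF P(1)]])
    show "cring R" by (rule R.is_cring)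
    show "carrier R \<noteq> {x \<in> carrier R. h x \<in> P}" using Pe e_carrier by blast
    fix a b assume "a \<in> carrier R" "b \<in> carrier R" "a \<otimes> b \<in> {x \<in> carrier R. h x \<in> P}"
    thus "a \<in> {x \<in> carrier R. h x \<in> P} \<or> b \<in> {x \<in> carrier R. h x \<in> P}"
      using P(4)[of "h a" "h b"] by auto
  qed
qed

lemma image_vimage:
  assumes "I \<subseteq> carrier S"
  shows "h ` {x \<in> carrier R. h x \<in> I} = I"
proof
  show "I \<subseteq> h ` {x \<in> carrier R. h x \<in> I}"
  proof
    fix y assume y: "y \<in> I"
    then obtain x where "x \<in> carrier R" "h x = y" using assms by (blast elim: lift)
    thus "y \<in> h ` {x \<in> carrier R. h x \<in> I}" using y by auto
  qed
qed auto

lemma compl_mem_prime: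
  assumes "primeideal P R" "e \<notin> P"
  shows "\<one> \<ominus> e \<in> P"
  using R.primeidealD(4)[OF assms(1), of e "\<one> \<ominus> e"] e_compl(1)
    R.idealD(2)[OF R.primeidealD(1)[OF assms(1)]] assms(2) by simp

text \<open>The kernel of \<open>h\<close> is generated by \<open>\<one> \<ominus> e\<close>, so
  this is the usual correspondence for ideals that contain the kernel.\<close>

lemma vimage_image:
  assumes "ideal I R" "\<one> \<ominus> e \<in> I"
  shows "{x \<in> carrier R. h x \<in> h ` I} = I"
proof
  note I = R.idealD[OF assms(1)]
  show "I \<subseteq> {x \<in> carrier R. h x \<in> h ` I}" using I(1) by blast
  show "{x \<in> carrier R. h x \<in> h ` I} \<subseteq> I"
  proof
    fix x assume "x \<in> {x \<in> carrier R. h x \<in> h ` I}"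
    then obtain y where x: "x \<in> carrier R" and y: "y \<in> I" "h x = h y" by blast
    have "e \<otimes> x = e \<otimes> y" using hom_eqD[OF x I(1)[OF y(1)] y(2)] .
    hence "x = e \<otimes> y \<oplus> (\<one> \<ominus> e) \<otimes> x" using decompose[OF x] by simp
    moreover have "e \<otimes> y \<in> I" "(\<one> \<ominus> e) \<otimes> x \<in> I" using I(5)[OF e_carrier y(1)] I(6)[OF x assms(2)] by auto
    ultimately show "x \<in> I" using I(3) by metis
  qed
qed

lemma image_primeideal:
  assumes P: "primeideal P R" and e: "e \<notin> P"
  shows "primeideal (h ` P) S"
proof -
  note Pi = R.primeidealD[OF P]
  have mem: "h x \<in> h ` P \<longleftrightarrow> x \<in> P" if "x \<in> carrier R" for x
    using vimage_image[OF Pi(1) compl_mem_prime[OF P e]] that by blast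
  show ?thesis
  proof (rule primeidealI[OF image_ideal[OF Pi(1)]])
    show "cring S" by (rule S.is_cring)
    show "carrier S \<noteq> h ` P" using mem[OF e_carrier] e by auto
    fix a b assume ab: "a \<in> carrier S" "b \<in> carrier S" "a \<otimes>\<^bsub>S\<^esub> b \<in> h ` P"
    obtain a' b' where h: "a' \<in> carrier R" "h a' = a" "b' \<in> carrier R" "h b' = b" using lift ab by metis
    hence "a' \<otimes> b' \<in> P" using ab mem[of "a' \<otimes> b'"] by simp
    thus "a \<in> h ` P \<or> b \<in> h ` P" using Pi(4) h by blast
  qed
qed

text \<open>Such a \<open>P\<close> is the sum of \<open>eP\<close> and \<open>(1-e)R\<close>. If
  \<open>z\<close> in \<open>P\<close> maps to a generator of the image, then
  \<open>ez + (1-e)\<close>, that is \<open>reg_lift z\<close>, generates \<open>P\<close>. The use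
  is contrapositive: a nonprincipal prime has a nonprincipal image.\<close>

lemma principal_vimage:
  assumes P: "ideal P R" "\<one> \<ominus> e \<in> P" and y: "y \<in> carrier S" "h ` P = PIdl\<^bsub>S\<^esub> y"
  shows "principalideal P R"
proof -
  note Pi = R.idealD[OF P(1)]
  have "y \<in> h ` P" using S.cgenideal_self[OF y(1)] y(2) by simp
  then obtain z where z: "z \<in> P" "h z = y" by blast
  have zc: "z \<in> carrier R" using Pi(1)[OF z(1)] .
  have zP: "reg_lift z \<in> P" unfolding reg_lift_def using Pi(3)[OF Pi(5)[OF e_carrier z(1)] P(2)] .
  have "x \<in> PIdl (reg_lift z)" if x: "x \<in> P" for x
  proof -
    have xc: "x \<in> carrier R" using Pi(1)[OF x] .
    obtain c' where c': "c' \<in> carrier S" "h x = c' \<otimes>\<^bsub>S\<^esub> y" using x y(2) unfolding cgenideal_def by blast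
    obtain c where c: "c \<in> carrier R" "h c = c'" using lift[OF c'(1)] by blast
    have "h x = h (z \<otimes> c)" using c c' z(2) zc y(1) by (simp add: S.m_comm)
    hence "e \<otimes> x = e \<otimes> (z \<otimes> c)" by (intro hom_eqD) (use xc zc c in auto)
    hence 1: "e \<otimes> x = reg_lift z \<otimes> (e \<otimes> c)" using reg_lift_mult_e[OF zc c(1)] by simp
    have 2: "(\<one> \<ominus> e) \<otimes> x = reg_lift z \<otimes> ((\<one> \<ominus> e) \<otimes> x)"
    proof -
      have "reg_lift z \<otimes> ((\<one> \<ominus> e) \<otimes> x) = (reg_lift z \<otimes> (\<one> \<ominus> e)) \<otimes> x"
        by (rule R.m_assoc[symmetric]) (use zc xc in auto)
      thus ?thesis unfolding reg_lift_mult_compl[OF zc] by (rule sym)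
    qed
    have "x = e \<otimes> x \<oplus> (\<one> \<ominus> e) \<otimes> x" by (rule decompose[OF xc])
    also have "\<dots> = reg_lift z \<otimes> (e \<otimes> c) \<oplus> reg_lift z \<otimes> ((\<one> \<ominus> e) \<otimes> x)" using 1 2 by (rule arg_cong2)
    also have "\<dots> = reg_lift z \<otimes> (e \<otimes> c \<oplus> (\<one> \<ominus> e) \<otimes> x)"
      by (rule R.r_distr[symmetric]) (use zc xc c in auto)
    also have "\<dots> = (e \<otimes> c \<oplus> (\<one> \<ominus> e) \<otimes> x) \<otimes> reg_lift z"
      by (rule R.m_comm) (use zc xc c in auto)
    finally have "x = (e \<otimes> c \<oplus> (\<one> \<ominus> e) \<otimes> x) \<otimes> reg_lift z" .
    moreover have "e \<otimes> c \<oplus> (\<one> \<ominus> e) \<otimes> x \<in> carrier R" using xc c by simp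
    ultimately show ?thesis unfolding cgenideal_def by blast
  qed
  hence "P = PIdl (reg_lift z)" using R.cgenideal_minimal[OF P(1) zP] by blast
  thus ?thesis using principalidealI[OF P(1)] R.cgenideal_eq_genideal[OF reg_lift_closed[OF zc]] reg_lift_closed[OF zc]
    by blast
qed

section \<open>Transfer of generators, GV-sets and \<open>u\<close>-invertibility\<close>

lemma Idl_image:
  assumes "A \<subseteq> carrier R" "x \<in> Idl A"
  shows "h x \<in> Idl\<^bsub>S\<^esub> (h ` A)"
proof -
  have hA: "h ` A \<subseteq> carrier S" using assms(1) by auto
  have "Idl A \<subseteq> {x \<in> carrier R. h x \<in> Idl\<^bsub>S\<^esub> (h ` A)}"
    by (rule R.genideal_minimal[OF vimage_ideal[OF S.genideal_ideal[OF hA]]])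
       (use assms(1) S.genideal_self[OF hA] in auto)
  thus ?thesis using assms(2) by blast
qed

text \<open>The product \<open>e \<otimes> x\<close> depends only on \<open>h x\<close>, so the
  elements of \<open>S\<close> whose lifts all satisfy the conclusion form an ideal, and it suffices
  to treat generators.\<close>

lemma Idl_lift:
  assumes I: "ideal I R" and B: "B \<subseteq> carrier S" and gen: "\<And>x. \<lbrakk>x \<in> carrier R; h x \<in> B\<rbrakk> \<Longrightarrow> e \<otimes> x \<in> I"
    and x: "x \<in> carrier R" "h x \<in> Idl\<^bsub>S\<^esub> B"
  shows "e \<otimes> x \<in> I"
proof -
  note Ir = R.idealD[OF I]
  let ?J = "{y \<in> carrier S. \<forall>x\<in>carrier R. h x = y \<longrightarrow> e \<otimes> x \<in> I}"
  have "ideal ?J S"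
  proof (rule S.idealI_cring)
    show "\<zero>\<^bsub>S\<^esub> \<in> ?J" using kernel Ir(2) by auto
  next
    fix a b assume a: "a \<in> ?J" and b: "b \<in> ?J"
    obtain a' where a': "a' \<in> carrier R" "h a' = a" using lift a by blast
    obtain b' where b': "b' \<in> carrier R" "h b' = b" using lift b by blast
    have "e \<otimes> x \<in> I" if "x \<in> carrier R" "h x = a \<oplus>\<^bsub>S\<^esub> b" for x
    proof -
      have "e \<otimes> x = e \<otimes> (a' \<oplus> b')" using hom_eqD[of x "a' \<oplus> b'"] that a' b' by simp
      also have "\<dots> = e \<otimes> a' \<oplus> e \<otimes> b'" using a' b' by (simp add: R.r_distr)
      finally show ?thesis using Ir(3) a b a' b' by simp
    qed
    thus "a \<oplus>\<^bsub>S\<^esub> b \<in> ?J" using a b by simp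
  next
    fix a y assume a: "a \<in> ?J" and y: "y \<in> carrier S"
    obtain a' where a': "a' \<in> carrier R" "h a' = a" using lift a by blast
    obtain y' where y': "y' \<in> carrier R" "h y' = y" using lift y by blast
    have "e \<otimes> x \<in> I" if "x \<in> carrier R" "h x = y \<otimes>\<^bsub>S\<^esub> a" for x
    proof -
      have "e \<otimes> x = e \<otimes> (y' \<otimes> a')" using hom_eqD[of x "y' \<otimes> a'"] that a' y' by simp
      also have "\<dots> = y' \<otimes> (e \<otimes> a')" using a' y' by (simp add: R.m_lcomm)
      finally show ?thesis using Ir(5) a a' y' by simp
    qed
    thus "y \<otimes>\<^bsub>S\<^esub> a \<in> ?J" using a y by simp
  qed auto
  moreover have "B \<subseteq> ?J" using B gen by auto
  ultimately have "Idl\<^bsub>S\<^esub> B \<subseteq> ?J" by (rule S.genideal_minimal)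
  thus ?thesis using x by blast
qed

text \<open>A fraction \<open>a/s\<close> of \<open>S\<close> lifts to the fraction of
  \<open>R\<close> with numerator \<open>e a'\<close> and the regular denominator
  \<open>reg_lift s'\<close>; the GV-property of \<open>A\<close> is applied to this lift.\<close>

lemma gv_set_image:
  assumes "gv_set R A"
  shows "gv_set S (h ` A)"
proof -
  note A = R.gv_setD[OF assms]
  obtain r where r: "r \<in> Idl A" "r \<in> regular_elements R" using A(3) by blast
  have "s divides\<^bsub>S\<^esub> a" if as: "a \<in> carrier S" "s \<in> regular_elements S"
    and dv: "\<forall>j\<in>h ` A. s divides\<^bsub>S\<^esub> (a \<otimes>\<^bsub>S\<^esub> j)" for a s
  proof -
    obtain a' where a': "a' \<in> carrier R" "h a' = a" using lift as by blast
    obtain s' where s': "s' \<in> carrier R" "h s' = s" using lift S.regular_carrier[OF as(2)] by blast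
    have "reg_lift s' divides (e \<otimes> a')"
    proof (rule A(4))
      show "reg_lift s' \<in> regular_elements R" using regular_lift s' as by blast
      fix j assume j: "j \<in> A"
      hence jc: "j \<in> carrier R" using A(2) by blast
      have "h s' divides\<^bsub>S\<^esub> h (a' \<otimes> j)" using dv j a' s' jc by auto
      hence "reg_lift s' divides (e \<otimes> (a' \<otimes> j))" using divides_lift a' s' jc by simp
      thus "reg_lift s' divides (e \<otimes> a' \<otimes> j)" using a' jc by (simp add: R.m_assoc)
    qed (use a' in simp)
    hence "h (reg_lift s') divides\<^bsub>S\<^esub> h (e \<otimes> a')" using divides_hom s' by simp
    thus ?thesis using hom_reg_lift[OF s'(1)] s'(2) a' as(1) by simp
  qed
  moreover have "h r \<in> Idl\<^bsub>S\<^esub> (h ` A) \<inter> regular_elements S" using Idl_image[OF A(2) r(1)] regular_hom[OF r(2)] by blast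
  moreover have "h ` A \<subseteq> carrier S" using A(2) by auto
  ultimately show ?thesis unfolding gv_set_def using A(1) by blast
qed

lemma uinv_image:
  assumes Q: "ideal Q R" and u: "uinv R Q"
  shows "uinv S (h ` Q)"
proof -
  note Qr = R.idealD[OF Q]
  obtain A where A: "gv_set R A" "A \<subseteq> Idl (inverse_products R Q)" using u unfolding uinv_def by blast
  have "h ` inverse_products R Q \<subseteq> inverse_products S (h ` Q)"
  proof (rule image_subsetI)
    fix d assume "d \<in> inverse_products R Q"
    then obtain q s b where d: "d \<in> carrier R" "q \<in> Q" "s \<in> regular_elements R" "b \<in> carrier R"
      "\<And>x. x \<in> Q \<Longrightarrow> s divides (b \<otimes> x)" "q \<otimes> b = s \<otimes> d"
      by (rule R.inverse_productsE) blast
    have sc: "s \<in> carrier R" using d(3) by (rule R.regular_carrier)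
    have "h s divides\<^bsub>S\<^esub> (h b \<otimes>\<^bsub>S\<^esub> h x)" if "x \<in> Q" for x
      using divides_hom[OF d(5)[OF that] sc] d(4) Qr(1)[OF that] by simp
    hence "\<forall>x\<in>h ` Q. h s divides\<^bsub>S\<^esub> (h b \<otimes>\<^bsub>S\<^esub> x)" by blast
    moreover have "h q \<otimes>\<^bsub>S\<^esub> h b = h s \<otimes>\<^bsub>S\<^esub> h d"
      using arg_cong[OF d(6), of h] d(1,4) sc Qr(1)[OF d(2)] by simp
    moreover have "h b \<in> carrier S" "h d \<in> carrier S" using d(1,4) by auto
    ultimately show "h d \<in> inverse_products S (h ` Q)"
      unfolding inverse_products_def using regular_hom[OF d(3)] d(2) by blast
  qed
  hence "Idl\<^bsub>S\<^esub> (h ` inverse_products R Q) \<subseteq> Idl\<^bsub>S\<^esub> (inverse_products S (h ` Q))"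
    by (rule S.subset_Idl_subset[OF S.inverse_products_carrier])
  hence "h ` A \<subseteq> Idl\<^bsub>S\<^esub> (inverse_products S (h ` Q))"
    using A(2) Idl_image[OF R.inverse_products_carrier] by blast
  thus ?thesis unfolding uinv_def using gv_set_image[OF A(1)] by blast
qed

text \<open>The preimage splits into a copy of \<open>Q\<close> and all of \<open>(1-e)R\<close>. A
  GV-set for the first component, lifted and multiplied by \<open>e\<close>, together with the
  single element \<open>\<one> \<ominus> e\<close> for the second, is a GV-set of \<open>R\<close>
  inside the product of the preimage with its inverse.\<close>

lemma uinv_vimage:
  assumes Q: "ideal Q S" and u: "uinv S Q"
  shows "uinv R {x \<in> carrier R. h x \<in> Q}"
proof -
  let ?Q = "{x \<in> carrier R. h x \<in> Q}"
  let ?f = "\<one> \<ominus> e"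
  let ?I = "Idl (inverse_products R ?Q)"
  note Qr = S.idealD[OF Q]
  have I: "ideal ?I R" by (rule R.genideal_ideal[OF R.inverse_products_carrier])
  have fQ: "?f \<in> ?Q"
  proof -
    have "h ?f \<in> Q" unfolding hom_compl by (rule Qr(2))
    thus ?thesis by simp
  qed
  obtain A where A: "gv_set S A" "A \<subseteq> Idl\<^bsub>S\<^esub> (inverse_products S Q)" using u unfolding uinv_def by blast
  note Ar = S.gv_setD[OF A(1)]
  have "\<forall>a\<in>A. \<exists>x\<in>carrier R. h x = a" using lift Ar(2) by blast
  then obtain l where l: "\<And>a. a \<in> A \<Longrightarrow> l a \<in> carrier R \<and> h (l a) = a" by metis
  let ?B = "insert ?f ((\<lambda>a. e \<otimes> l a) ` A)"
  have B: "?B \<subseteq> carrier R" using l by auto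
  have BI: "ideal (Idl ?B) R" by (rule R.genideal_ideal[OF B])
  have el: "e \<otimes> x \<in> Idl ?B" if x: "x \<in> carrier R" "h x \<in> Idl\<^bsub>S\<^esub> A" for x
  proof (rule Idl_lift[OF BI Ar(2) _ x])
    fix x assume x: "x \<in> carrier R" "h x \<in> A"
    have "e \<otimes> x = e \<otimes> l (h x)" by (rule hom_eqD) (use x l[OF x(2)] in auto)
    moreover have "e \<otimes> l (h x) \<in> ?B" using x(2) by blast
    ultimately show "e \<otimes> x \<in> Idl ?B" using R.genideal_self[OF B] by auto
  qed
  have gv: "gv_set R ?B"
  proof -
    obtain r' where r': "r' \<in> Idl\<^bsub>S\<^esub> A" "r' \<in> regular_elements S" using Ar(3) by blast
    obtain r where r: "r \<in> carrier R" "h r = r'" using lift S.regular_carrier[OF r'(2)] by blast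
    have "e \<otimes> r \<in> Idl ?B" using el r r' by simp
    moreover have "?f \<in> Idl ?B" using R.genideal_self[OF B] by blast
    ultimately have "reg_lift r \<in> Idl ?B" unfolding reg_lift_def using R.idealD(3)[OF BI] by blast
    moreover have "reg_lift r \<in> regular_elements R" using regular_lift r r' by simp
    moreover have "s divides a" if as: "a \<in> carrier R" "s \<in> regular_elements R"
      and dv: "\<forall>j\<in>?B. s divides (a \<otimes> j)" for a s
    proof -
      have sc: "s \<in> carrier R" using as(2) by (rule R.regular_carrier)
      have "h s divides\<^bsub>S\<^esub> h a"
      proof (rule Ar(4))
        fix j assume j: "j \<in> A"
        have "s divides (a \<otimes> (e \<otimes> l j))" using dv j by blast
        hence "h s divides\<^bsub>S\<^esub> h (a \<otimes> (e \<otimes> l j))" using divides_hom sc by blast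
        moreover have "j \<in> carrier S" using j Ar(2) by blast
        ultimately show "h s divides\<^bsub>S\<^esub> (h a \<otimes>\<^bsub>S\<^esub> j)" using as(1) l[OF j] by simp
      qed (use as regular_hom in auto)
      then obtain c where c: "c \<in> carrier R" "e \<otimes> a = reg_lift s \<otimes> c"
        using divides_lift[OF as(1) sc] by (auto simp: factor_def)
      \<comment> \<open>The extra factor \<open>e\<close> moves into the cofactor, where
        \<open>reg_lift s\<close> can be exchanged for \<open>s\<close>; the divisibility is needed
        for \<open>s\<close> itself.\<close>
      have "e \<otimes> a = e \<otimes> (e \<otimes> a)" using as(1) by (simp add: R.m_assoc[symmetric] e_idem)
      also have "\<dots> = reg_lift s \<otimes> (e \<otimes> c)" using c sc by (simp add: R.m_lcomm)
      also have "\<dots> = s \<otimes> (e \<otimes> c)" using reg_lift_mult_e[OF sc c(1)] c(1) sc by (simp add: R.m_lcomm)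
      finally have 1: "e \<otimes> a = s \<otimes> (e \<otimes> c)" .
      obtain d where d: "d \<in> carrier R" "a \<otimes> ?f = s \<otimes> d" using dv by (auto simp: factor_def)
      have "a = e \<otimes> a \<oplus> a \<otimes> ?f" using decompose[OF as(1)] as(1) by (simp add: R.m_comm)
      also have "\<dots> = s \<otimes> (e \<otimes> c \<oplus> d)" using 1 d c sc by (simp add: R.r_distr)
      finally show ?thesis using c d by (auto simp: factor_def)
    qed
    ultimately show ?thesis unfolding gv_set_def using B Ar(1) by blast
  qed
  have eI: "e \<otimes> x \<in> ?I" if x: "x \<in> carrier R" "h x \<in> Idl\<^bsub>S\<^esub> (inverse_products S Q)" for x
  proof (rule Idl_lift[OF I S.inverse_products_carrier _ x])
    fix d assume dc: "d \<in> carrier R" and "h d \<in> inverse_products S Q"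
    then obtain q' s' b' where d: "q' \<in> Q" "s' \<in> regular_elements S" "b' \<in> carrier S"
      "\<And>x. x \<in> Q \<Longrightarrow> s' divides\<^bsub>S\<^esub> (b' \<otimes>\<^bsub>S\<^esub> x)" "q' \<otimes>\<^bsub>S\<^esub> b' = s' \<otimes>\<^bsub>S\<^esub> h d"
      by - (erule S.inverse_productsE, blast)
    obtain q where q: "q \<in> carrier R" "h q = q'" using lift Qr(1)[OF d(1)] by blast
    obtain s where s: "s \<in> carrier R" "h s = s'" using lift S.regular_carrier[OF d(2)] by blast
    obtain b where b: "b \<in> carrier R" "h b = b'" using lift d(3) by blast
    have qQ: "q \<in> ?Q" using q d(1) by simp
    have sr: "reg_lift s \<in> regular_elements R" using regular_lift s d(2) by simp
    have "reg_lift s divides (e \<otimes> b \<otimes> x)" if x: "x \<in> ?Q" for x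
    proof -
      have "h s divides\<^bsub>S\<^esub> h (b \<otimes> x)" using d(4)[of "h x"] x s b by simp
      hence "reg_lift s divides (e \<otimes> (b \<otimes> x))" using divides_lift[of "b \<otimes> x" s] s b x by simp
      thus ?thesis using b x by (simp add: R.m_assoc)
    qed
    moreover have "q \<otimes> (e \<otimes> b) = reg_lift s \<otimes> (e \<otimes> d)"
    proof -
      have "h (q \<otimes> b) = h (s \<otimes> d)" using d(5) q s b dc by simp
      hence "e \<otimes> (q \<otimes> b) = e \<otimes> (s \<otimes> d)" by (intro hom_eqD) (use q s b dc in auto)
      thus ?thesis using reg_lift_mult_e[OF s(1) dc] q b by (simp add: R.m_lcomm)
    qed
    moreover have "e \<otimes> b \<in> carrier R" "e \<otimes> d \<in> carrier R" using b dc by auto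
    ultimately have "e \<otimes> d \<in> inverse_products R ?Q"
      unfolding inverse_products_def using sr qQ by blast
    thus "e \<otimes> d \<in> ?I" using R.genideal_self[OF R.inverse_products_carrier] by blast
  qed
  have "?f \<in> ?I"
    using R.subset_inverse_products[of ?Q] fQ R.genideal_self[OF R.inverse_products_carrier] by blast
  moreover have "e \<otimes> l a \<in> ?I" if "a \<in> A" for a using eI[of "l a"] l[OF that] A(2) that by auto
  ultimately have "?B \<subseteq> ?I" by blast
  thus ?thesis unfolding uinv_def using gv by blast
qed

text \<open>The preimage of \<open>P\<close> omits \<open>e\<close>, hence so does the prime found
  inside it, and the image of that prime is again prime. The preimage is regular because
  \<open>reg_lift\<close> corrects a lift of a regular element of \<open>P\<close>.\<close>

lemma primes_contain_uinv_image:
  assumes H: "primes_contain_uinv R"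
  shows "primes_contain_uinv S"
  unfolding primes_contain_uinv_def
proof (intro allI impI)
  fix P assume P: "primeideal P S" "P \<inter> regular_elements S \<noteq> {}"
  note Pv = vimage_primeideal[OF P(1)]
  obtain s' where s': "s' \<in> P" "s' \<in> regular_elements S" using P(2) by blast
  obtain s where s: "s \<in> carrier R" "h s = s'" using lift S.regular_carrier[OF s'(2)] by blast
  have "reg_lift s \<in> {x \<in> carrier R. h x \<in> P} \<inter> regular_elements R"
    using regular_lift hom_reg_lift s s' by simp
  then obtain Q where Q: "primeideal Q R" "Q \<subseteq> {x \<in> carrier R. h x \<in> P}" "uinv R Q"
    using H Pv(1) unfolding primes_contain_uinv_def by blast
  have "e \<notin> Q" using Q(2) Pv(2) by blast
  hence "primeideal (h ` Q) S" by (rule image_primeideal[OF Q(1)])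
  moreover have "h ` Q \<subseteq> P" using Q(2) by blast
  moreover have "uinv S (h ` Q)" by (rule uinv_image[OF R.primeidealD(1)[OF Q(1)] Q(3)])
  ultimately show "\<exists>Q. primeideal Q S \<and> Q \<subseteq> P \<and> uinv S Q" by blast
qed

end

section \<open>Domains whose nonzero primes contain \<open>u\<close>-invertible primes\<close>

text \<open>Here \<open>u\<close> is a uniformizer. Instead of a factorization of \<open>x\<close>,
  only a power of \<open>u\<close> that \<open>x\<close> divides is assumed, since that is what
  \<open>u_factored_power\<close> leads to. Cancelling \<open>u\<close> from \<open>x\<close> and
  from the power, as long as \<open>x\<close> is not a unit, writes \<open>x\<close> as a power of
  \<open>u\<close> times a unit.\<close>

lemma (in domain) discrete_valuation_ringI:
  assumes u: "u \<in> carrier R" "u \<noteq> \<zero>" "u \<notin> Units R"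
    and dv: "\<And>x. \<lbrakk>x \<in> carrier R; x \<notin> Units R\<rbrakk> \<Longrightarrow> u divides x"
    and arch: "\<And>x. \<lbrakk>x \<in> carrier R; x \<noteq> \<zero>\<rbrakk> \<Longrightarrow> \<exists>k::nat. x divides u [^] k"
  shows "discrete_valuation_ring R"
proof -
  have fact: "\<exists>n::nat. \<exists>y\<in>Units R. x = u [^] n \<otimes> y"
    if "x \<in> carrier R" "x \<noteq> \<zero>" "x divides u [^] (k::nat)" for x k
    using that
  proof (induction k arbitrary: x)
    case 0
    then obtain c where "c \<in> carrier R" "\<one> = x \<otimes> c" by (auto simp: factor_def)
    hence "x \<in> Units R" using 0(1) m_comm[of c x] unfolding Units_def by force
    thus ?case using 0(1) by (intro exI[of _ "0::nat"] bexI[of _ x]) auto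
  next
    case (Suc k)
    show ?case
    proof (cases "x \<in> Units R")
      case True
      thus ?thesis using Suc(2) by (intro exI[of _ "0::nat"] bexI[of _ x]) auto
    next
      case False
      then obtain y where y: "y \<in> carrier R" "x = u \<otimes> y" using dv[OF Suc(2)] by (auto simp: factor_def)
      have y0: "y \<noteq> \<zero>" using y Suc(3) u(1) by auto
      obtain c where c: "c \<in> carrier R" "u [^] Suc k = x \<otimes> c" using Suc(4) by (auto simp: factor_def)
      have "u \<otimes> (u [^] k) = u [^] Suc k" using u(1) by (simp add: m_comm)
      also have "\<dots> = u \<otimes> (y \<otimes> c)" unfolding c(2) y(2) using c(1) y(1) u(1) by (simp add: m_assoc)
      finally have "u [^] k = y \<otimes> c" using m_lcancel[OF u(2,1)] u(1) y c by simp
      hence "y divides u [^] k" using c(1) by (auto simp: factor_def)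
      then obtain n :: nat and z where nz: "z \<in> Units R" "y = u [^] n \<otimes> z"
        using Suc.IH[OF y(1) y0] by blast
      have "x = u [^] (Suc n) \<otimes> z"
        unfolding y(2) nz(2) using Units_closed[OF nz(1)] u(1) by (simp add: m_assoc m_lcomm)
      thus ?thesis using nz(1) by blast
    qed
  qed
  have fact: "\<exists>n::nat. \<exists>y\<in>Units R. x = u [^] n \<otimes> y" if "x \<in> carrier R" "x \<noteq> \<zero>" for x
    using fact[OF that] arch[OF that] by blast
  have pr: "\<exists>a\<in>carrier R. I = PIdl a" if I: "ideal I R" for I
  proof (cases "I = {\<zero>}")
    case True
    have "PIdl \<zero> = {\<zero>}" using cgenideal_eq_genideal[OF zero_closed] genideal_zero by simp
    thus ?thesis using True by blast
  next
    case False
    note Ir = idealD[OF I]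
    have pw: "u [^] n \<in> I" if "u [^] (n::nat) \<otimes> y \<in> I" "y \<in> Units R" for n y
    proof -
      have "(u [^] n \<otimes> y) \<otimes> inv y \<in> I" using Ir(6) that by simp
      thus ?thesis using that(2) u(1) by (simp add: m_assoc Units_closed)
    qed
    obtain x where "x \<in> I" "x \<noteq> \<zero>" using False Ir(2) by blast
    hence ex: "\<exists>n::nat. u [^] n \<in> I" using fact[of x] Ir(1) pw by blast
    \<comment> \<open>The smallest power of \<open>u\<close> in \<open>I\<close> generates
      \<open>I\<close>; there is one because a nonzero element of \<open>I\<close> differs from a
      power of \<open>u\<close> by a unit.\<close>
    define n :: nat where "n = (LEAST n. u [^] n \<in> I)"
    have n: "u [^] n \<in> I" unfolding n_def using ex by (rule LeastI_ex)
    have "I \<subseteq> PIdl (u [^] n)"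
    proof
      fix x assume x: "x \<in> I"
      show "x \<in> PIdl (u [^] n)"
      proof (cases "x = \<zero>")
        case True thus ?thesis using idealD(2)[OF cgenideal_ideal] u(1) by simp
      next
        case False
        then obtain m :: nat and y where my: "y \<in> Units R" "x = u [^] m \<otimes> y" using fact Ir(1)[OF x] by blast
        hence "u [^] m \<in> I" using pw x by blast
        hence "n \<le> m" unfolding n_def by (rule Least_le)
        then obtain j where j: "m = j + n" by (metis le_iff_add add.commute)
        have "x = (y \<otimes> u [^] j) \<otimes> u [^] n"
          using my j u(1) by (simp add: nat_pow_mult[symmetric] m_ac Units_closed)
        thus ?thesis unfolding cgenideal_def using my u(1) by (auto simp: Units_closed)
      qed
    qed
    hence "I = PIdl (u [^] n)" using cgenideal_minimal[OF I n] by blast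
    thus ?thesis using u(1) by auto
  qed
  have Pu: "ideal (PIdl u) R" by (rule cgenideal_ideal[OF u(1)])
  have nu: "x \<in> PIdl u" if x: "x \<in> carrier R" "x \<notin> Units R" for x
  proof -
    obtain c where "c \<in> carrier R" "x = u \<otimes> c" using dv[OF x] by (auto simp: factor_def)
    thus ?thesis unfolding cgenideal_def using m_comm[OF u(1)] by blast
  qed
  have unit: "J = carrier R" if J: "ideal J R" "x \<in> J" "x \<in> Units R" for J x
  proof -
    have "inv x \<otimes> x \<in> J" by (rule idealD(5)[OF J(1) Units_inv_closed[OF J(3)] J(2)])
    thus ?thesis using J(3) ideal.one_imp_carrier[OF J(1)] by simp
  qed
  have "\<one> \<notin> PIdl u"
  proof
    assume "\<one> \<in> PIdl u"
    then obtain c where "c \<in> carrier R" "\<one> = c \<otimes> u" unfolding cgenideal_def by blast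
    hence "u \<in> Units R" using u(1) m_comm[of c u] unfolding Units_def by force
    thus False using u(3) by blast
  qed
  hence ne: "carrier R \<noteq> PIdl u" using one_closed by blast
  have max: "maximalideal (PIdl u) R"
  proof (rule maximalidealI[OF Pu ne])
    fix J assume J: "ideal J R" "PIdl u \<subseteq> J" "J \<subseteq> carrier R"
    show "J = PIdl u \<or> J = carrier R"
    proof (cases "J \<subseteq> PIdl u")
      case False
      then obtain x where "x \<in> J" "x \<in> Units R" using nu J(3) by blast
      thus ?thesis using unit[OF J(1)] by blast
    qed (use J in blast)
  qed
  have uniq: "M = PIdl u" if M: "maximalideal M R" for M
  proof -
    interpret M: maximalideal M R by fact
    have "x \<in> PIdl u" if "x \<in> M" for x
      using nu[of x] unit[OF M.is_ideal that] M.I_notcarr M.Icarr[OF that] by blast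
    thus ?thesis using M.I_maximal[OF Pu] idealD(1)[OF Pu] ne by blast
  qed
  have "principal_domain R" by unfold_locales (rule pr)
  moreover have "local_ring R" unfolding local_ring_def using is_cring max uniq by blast
  moreover have "\<not> field R" using field.field_Units[of R] u by blast
  ultimately show ?thesis unfolding discrete_valuation_ring_def by blast
qed

text \<open>As \<open>P\<close> contains no GV-set, some \<open>d = q (b/s)\<close> in
  \<open>N N^-1\<close> is outside \<open>P\<close>. For \<open>a\<close> in \<open>N\<close> then
  \<open>a d = q (a b/s)\<close>, where \<open>a b/s\<close> is in \<open>R\<close>: in the
  localization at a prime \<open>P\<close>, where \<open>d\<close> becomes a unit, \<open>q\<close>
  generates \<open>N\<close>.\<close>

lemma (in cring) uinv_local_generator:
  assumes N: "ideal N R" "uinv R N" and P: "ideal P R" "\<And>A. gv_set R A \<Longrightarrow> \<not> A \<subseteq> P"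
  obtains n d where "n \<in> N" "d \<in> carrier R" "d \<notin> P" "\<forall>a\<in>N. \<exists>c\<in>carrier R. a \<otimes> d = n \<otimes> c"
proof -
  note Nr = idealD[OF N(1)]
  obtain A where A: "gv_set R A" "A \<subseteq> Idl (inverse_products R N)" using N(2) unfolding uinv_def by blast
  have "\<not> inverse_products R N \<subseteq> P" using genideal_minimal[OF P(1)] A P(2) by blast
  then obtain d where d0: "d \<in> inverse_products R N" "d \<notin> P" by blast
  then obtain q s b where d: "d \<in> carrier R" "q \<in> N" "s \<in> regular_elements R" "b \<in> carrier R"
    "\<And>x. x \<in> N \<Longrightarrow> s divides (b \<otimes> x)" "q \<otimes> b = s \<otimes> d"
    by - (erule inverse_productsE, blast)
  have "\<exists>c\<in>carrier R. a \<otimes> d = q \<otimes> c" if a: "a \<in> N" for a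
  proof -
    obtain c where c: "c \<in> carrier R" "b \<otimes> a = s \<otimes> c" using d(5)[OF a] by (auto simp: factor_def)
    note cr = Nr(1)[OF a] Nr(1)[OF d(2)] regular_carrier[OF d(3)] d(1,4) c(1)
    have "s \<otimes> (a \<otimes> d) = a \<otimes> (q \<otimes> b)" using cr d(6) by (simp add: m_lcomm)
    also have "\<dots> = q \<otimes> (b \<otimes> a)" using cr by (simp add: m_ac)
    also have "\<dots> = s \<otimes> (q \<otimes> c)" using cr c(2) by (simp add: m_lcomm)
    finally have "a \<otimes> d = q \<otimes> c" using regular_cancel[OF d(3)] cr by simp
    thus ?thesis using c(1) by blast
  qed
  thus ?thesis using that d(1,2) d0(2) by blast
qed

context domain
begin

lemma regular_elements_eq: "regular_elements R = carrier R - {\<zero>}"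
  unfolding regular_elements_def using integral_iff one_not_zero r_one r_null
  by (auto, metis one_closed r_null r_one)

text \<open>In the localization at \<open>Q\<close> both ideals are principal, say
  \<open>N = (n)\<close> and \<open>Q = (q)\<close>. As \<open>q\<close> is not in \<open>N\<close>,
  from \<open>n = q c\<close> follows that \<open>c\<close> is in \<open>N\<close>, so
  \<open>c = n c2\<close>, and cancelling \<open>n\<close> gives \<open>1 = q c2\<close>, although
  \<open>q\<close> lies in the maximal ideal. The multipliers \<open>d\<close> and \<open>e\<close>
  outside \<open>Q\<close> clear the denominators.\<close>

lemma good_prime_incomparable:
  assumes N: "good_prime R N" and Q: "good_prime R Q" and sub: "N \<subseteq> Q"
  shows "N = Q"
proof (rule ccontr)
  assume "N \<noteq> Q"
  then obtain q0 where q0: "q0 \<in> Q" "q0 \<notin> N" using sub by blast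
  note Nr = good_primeD[OF N] and Qr = good_primeD[OF Q]
  note Ni = idealD[OF Nr(2)] and Qi = idealD[OF Qr(2)]
  note Np = primeidealD(4)[OF Nr(1)] and Qp = primeidealD(4)[OF Qr(1)]
  have gvQ: "\<And>A. gv_set R A \<Longrightarrow> \<not> A \<subseteq> Q" using Q unfolding good_prime_def by blast
  obtain n e where n: "n \<in> N" "e \<in> carrier R" "e \<notin> Q" "\<forall>a\<in>N. \<exists>c\<in>carrier R. a \<otimes> e = n \<otimes> c"
    by (rule uinv_local_generator[OF Nr(2,4) Qr(2) gvQ])
  obtain q d where q: "q \<in> Q" "d \<in> carrier R" "d \<notin> Q" "\<forall>a\<in>Q. \<exists>c\<in>carrier R. a \<otimes> d = q \<otimes> c"
    by (rule uinv_local_generator[OF Qr(2,4) Qr(2) gvQ])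
  note cr = Ni(1)[OF n(1)] n(2) Qi(1)[OF q(1)] q(2) Qi(1)[OF q0(1)]
  obtain c0 where c0: "c0 \<in> carrier R" "q0 \<otimes> d = q \<otimes> c0" using q(4) q0(1) by blast
  have "q0 \<otimes> d \<notin> N" using Np[of q0 d] cr q0(2) q(3) sub by blast
  hence qN: "q \<notin> N" using c0 Ni(6) by auto
  have "n \<in> Q" using n(1) sub by blast
  then obtain c where c: "c \<in> carrier R" "n \<otimes> d = q \<otimes> c" using q(4) by blast
  hence "q \<otimes> c \<in> N" using Ni(6)[OF q(2) n(1)] by simp
  hence "c \<in> N" using Np cr c(1) qN by blast
  then obtain c2 where c2: "c2 \<in> carrier R" "c \<otimes> e = n \<otimes> c2" using n(4) by blast
  have "n \<noteq> \<zero>"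
  proof
    assume n0: "n = \<zero>"
    obtain a where a: "a \<in> N" "a \<in> regular_elements R" using uinv_regular[OF Nr(2,4)] by blast
    then obtain c where "c \<in> carrier R" "a \<otimes> e = n \<otimes> c" using n(4) by blast
    hence "a \<otimes> e = \<zero>" using n0 by simp
    hence "e = \<zero>" using a n(2) by (simp add: regular_elements_def)
    thus False using n(3) Qi(2) by blast
  qed
  moreover have "n \<otimes> (d \<otimes> e) = n \<otimes> (q \<otimes> c2)"
  proof -
    have "n \<otimes> (d \<otimes> e) = (n \<otimes> d) \<otimes> e" using cr by (simp add: m_assoc)
    also have "\<dots> = q \<otimes> (c \<otimes> e)" using c cr by (simp add: m_assoc)
    also have "\<dots> = n \<otimes> (q \<otimes> c2)" using c2 cr by (simp add: m_lcomm)
    finally show ?thesis .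
  qed
  ultimately have "d \<otimes> e = q \<otimes> c2" using m_lcancel[of n "d \<otimes> e" "q \<otimes> c2"] cr c2(1) by simp
  hence "d \<otimes> e \<in> Q" using Qi(6)[OF c2(1) q(1)] by simp
  thus False using Qp cr n(3) q(3) by blast
qed

text \<open>If a good \<open>Q\<close> contains \<open>I\<close> and differs from the prime
  \<open>Q0\<close> just split off, it does not contain \<open>Q0\<close> by incomparability, so it
  contains \<open>colon R I Q0\<close>. Each factor of the product thus accounts for at most one
  good prime.\<close>

lemma u_factored_finite_good_primes:
  assumes "u_factored R I"
  shows "finite {Q. good_prime R Q \<and> I \<subseteq> Q}"
  using assms
proof induction
  case (gv I A)
  have "{Q. good_prime R Q \<and> I \<subseteq> Q} = {}" using gv unfolding good_prime_def by blast
  thus ?case by (simp only: finite.emptyI)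
next
  case (prime I Q0)
  have "{Q. good_prime R Q \<and> I \<subseteq> Q} \<subseteq> insert Q0 {Q. good_prime R Q \<and> colon R I Q0 \<subseteq> Q}"
  proof
    fix Q assume "Q \<in> {Q. good_prime R Q \<and> I \<subseteq> Q}"
    hence Q: "good_prime R Q" "I \<subseteq> Q" by auto
    note Qr = good_primeD[OF Q(1)] and Q0 = good_primeD[OF prime.hyps(2)]
    have "colon R I Q0 \<subseteq> Q" if "Q \<noteq> Q0"
    proof
      fix x assume x: "x \<in> colon R I Q0"
      have "\<not> Q0 \<subseteq> Q" using good_prime_incomparable[OF prime.hyps(2) Q(1)] that by blast
      then obtain q where q: "q \<in> Q0" "q \<notin> Q" by blast
      hence "x \<otimes> q \<in> Q" "x \<in> carrier R" using x Q(2) by (auto simp: colon_def)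
      thus "x \<in> Q" using primeidealD(4)[OF Qr(1)] q Q0(3) by blast
    qed
    thus "Q \<in> insert Q0 {Q. good_prime R Q \<and> colon R I Q0 \<subseteq> Q}" using Q(1) by blast
  qed
  thus ?case using prime.IH by (meson finite.insertI finite_subset)
qed

text \<open>The exponent counts how often \<open>Q\<close> itself occurs in the product inside
  \<open>I\<close>. Every other factor, including the GV-part, has an element outside
  \<open>Q\<close>, and \<open>d\<close> is the product of these.\<close>

lemma u_factored_power:
  assumes "u_factored R I" and Q: "good_prime R Q" and u: "u \<in> Q"
  shows "\<exists>k::nat. \<exists>d\<in>carrier R - Q. d \<otimes> u [^] k \<in> I"
  using assms(1)
proof induction
  case (gv I A)
  then obtain d where d: "d \<in> A" "d \<notin> Q" using Q unfolding good_prime_def by blast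
  hence "d \<in> I" "d \<in> carrier R" using gv gv_setD(2) by auto
  thus ?case using d(2) by (intro exI[of _ "0::nat"] bexI[of _ d]) auto
next
  case (prime I Q1)
  note Qr = good_primeD[OF Q] and Q1 = good_primeD[OF prime.hyps(2)]
  have uc: "u \<in> carrier R" using u Qr(3) by blast
  obtain k :: nat and d where d: "d \<in> carrier R" "d \<notin> Q" "d \<otimes> u [^] k \<in> colon R I Q1" using prime.IH by blast
  show ?case
  proof (cases "Q1 \<subseteq> Q")
    case True
    hence "u \<in> Q1" using good_prime_incomparable[OF prime.hyps(2) Q] u by simp
    hence "(d \<otimes> u [^] k) \<otimes> u \<in> I" using d(3) by (simp add: colon_def)
    hence "d \<otimes> u [^] Suc k \<in> I" using d(1) uc by (simp add: m_assoc)
    thus ?thesis using d(1,2) by blast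
  next
    case False
    then obtain q where q: "q \<in> Q1" "q \<notin> Q" by blast
    have qc: "q \<in> carrier R" using q Q1(3) by blast
    have "(d \<otimes> u [^] k) \<otimes> q \<in> I" using d(3) q by (simp add: colon_def)
    hence "(d \<otimes> q) \<otimes> u [^] k \<in> I" using d(1) uc qc by (simp add: m_ac)
    moreover have "d \<otimes> q \<notin> Q" using primeidealD(4)[OF Qr(1)] d q qc by blast
    ultimately show ?thesis using d(1) qc by blast
  qed
qed

section \<open>Localizations at good primes as discrete valuation rings\<close>

lemma TQ_domain: "domain TQ"
proof -
  interpret T: cring TQ by (rule TQ_cring)
  show ?thesis
  proof (unfold_locales)
    show "\<one>\<^bsub>TQ\<^esub> \<noteq> \<zero>\<^bsub>TQ\<^esub>"
      using one_not_zero by (simp add: TQ_one TQ_zero tq_frac_eq_iff regular_elements_one)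
    fix x y assume xy: "x \<otimes>\<^bsub>TQ\<^esub> y = \<zero>\<^bsub>TQ\<^esub>" "x \<in> carrier TQ" "y \<in> carrier TQ"
    obtain a s where x: "x = tq_frac R a s" "a \<in> carrier R" "s \<in> regular_elements R" "s \<in> carrier R"
      using xy(2) by (rule TQ_E)
    obtain b t where y: "y = tq_frac R b t" "b \<in> carrier R" "t \<in> regular_elements R" "t \<in> carrier R"
      using xy(3) by (rule TQ_E)
    have "a \<otimes> b = \<zero>"
      using xy(1) x y by (simp add: TQ_zero tq_frac_mult tq_frac_eq_iff regular_elements_one regular_elements_closed)
    hence "a = \<zero> \<or> b = \<zero>" using integral x(2) y(2) by blast
    thus "x = \<zero>\<^bsub>TQ\<^esub> \<or> y = \<zero>\<^bsub>TQ\<^esub>"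
      using x y by (auto simp: TQ_zero tq_frac_eq_iff regular_elements_one)
  qed
qed

text \<open>This is the localization at a prime \<open>Q\<close> inside \<open>T(R)\<close>; the
  denominators, lying outside an ideal of a domain, are nonzero and therefore regular.\<close>

definition localization :: "'a set \<Rightarrow> ('a \<times> 'a) set set" where
  "localization Q = {tq_frac R a s | a s. a \<in> carrier R \<and> s \<in> carrier R - Q}"

lemma localization_subring:
  assumes "primeideal Q R"
  shows "subring (localization Q) TQ" "tq_embed R ` carrier R \<subseteq> localization Q"
proof -
  interpret T: domain TQ by (rule TQ_domain)
  note Q = primeidealD[OF assms]
  have reg: "s \<in> regular_elements R" if "s \<in> carrier R - Q" for s
    using that idealD(2)[OF Q(1)] regular_elements_eq by blast
  have cl: "s \<otimes> t \<in> carrier R - Q" if "s \<in> carrier R - Q" "t \<in> carrier R - Q" for s t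
    using Q(4)[of s t] that by blast
  show emb: "tq_embed R ` carrier R \<subseteq> localization Q"
    unfolding localization_def tq_embed_def using Q(2) one_closed by blast
  show "subring (localization Q) TQ"
  proof (rule T.subringI)
    show "localization Q \<subseteq> carrier TQ" unfolding localization_def using TQ_I reg by blast
    have "\<one>\<^bsub>TQ\<^esub> = tq_embed R \<one>" by (simp add: TQ_one tq_embed_def)
    thus "\<one>\<^bsub>TQ\<^esub> \<in> localization Q" using emb one_closed by blast
  next
    fix x assume "x \<in> localization Q"
    then obtain a s where x: "x = tq_frac R a s" "a \<in> carrier R" "s \<in> carrier R - Q" unfolding localization_def by blast
    hence s: "s \<in> regular_elements R" "s \<in> carrier R" using reg by auto
    have "tq_frac R (\<ominus> a) s \<oplus>\<^bsub>TQ\<^esub> x = \<zero>\<^bsub>TQ\<^esub>"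
      using x(1,2) s by (simp add: TQ_zero tq_frac_add regular_elements_closed regular_elements_one tq_frac_eq_iff l_minus l_neg)
    hence "\<ominus>\<^bsub>TQ\<^esub> x = tq_frac R (\<ominus> a) s" using x(1,2) s TQ_I by (intro T.minus_equality) auto
    thus "\<ominus>\<^bsub>TQ\<^esub> x \<in> localization Q" unfolding localization_def using x(2,3) by blast
  next
    fix x y assume "x \<in> localization Q" "y \<in> localization Q"
    then obtain a s b t where h: "x = tq_frac R a s" "a \<in> carrier R" "s \<in> carrier R - Q"
      "y = tq_frac R b t" "b \<in> carrier R" "t \<in> carrier R - Q" unfolding localization_def by blast
    have "x \<otimes>\<^bsub>TQ\<^esub> y = tq_frac R (a \<otimes> b) (s \<otimes> t)" "x \<oplus>\<^bsub>TQ\<^esub> y = tq_frac R (a \<otimes> t \<oplus> b \<otimes> s) (s \<otimes> t)"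
      using h reg by (simp_all add: tq_frac_mult tq_frac_add)
    moreover have "a \<otimes> b \<in> carrier R" "a \<otimes> t \<oplus> b \<otimes> s \<in> carrier R" using h by auto
    ultimately show "x \<otimes>\<^bsub>TQ\<^esub> y \<in> localization Q" "x \<oplus>\<^bsub>TQ\<^esub> y \<in> localization Q"
      unfolding localization_def using cl[OF h(3,6)] by blast+
  qed
qed

lemma localization_unit:
  assumes Q: "primeideal Q R" and a: "a \<in> carrier R" and s: "s \<in> carrier R - Q"
  shows "tq_frac R a s \<in> Units (TQ\<lparr>carrier := localization Q\<rparr>) \<longleftrightarrow> a \<notin> Q"
proof -
  interpret T: domain TQ by (rule TQ_domain)
  note Qr = primeidealD[OF Q]
  have reg: "s \<in> regular_elements R" if "s \<in> carrier R - Q" for s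
    using that idealD(2)[OF Qr(1)] regular_elements_eq by blast
  show ?thesis
  proof
    assume "tq_frac R a s \<in> Units (TQ\<lparr>carrier := localization Q\<rparr>)"
    then obtain y where y: "y \<in> localization Q" "tq_frac R a s \<otimes>\<^bsub>TQ\<^esub> y = \<one>\<^bsub>TQ\<^esub>" unfolding Units_def by auto
    then obtain b t where h: "y = tq_frac R b t" "b \<in> carrier R" "t \<in> carrier R - Q" unfolding localization_def by blast
    have "a \<otimes> b = s \<otimes> t"
      using y(2) h a s reg by (simp add: TQ_one tq_frac_mult tq_frac_eq_iff regular_elements_closed regular_elements_one)
    moreover have "s \<otimes> t \<notin> Q" using Qr(4)[of s t] s h by blast
    ultimately show "a \<notin> Q" using idealD(6)[OF Qr(1)] h(2) by metis
  next
    assume aQ: "a \<notin> Q"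
    have "tq_frac R a s \<otimes>\<^bsub>TQ\<^esub> tq_frac R s a = \<one>\<^bsub>TQ\<^esub>" "tq_frac R s a \<otimes>\<^bsub>TQ\<^esub> tq_frac R a s = \<one>\<^bsub>TQ\<^esub>"
      using a s aQ reg by (simp_all add: TQ_one tq_frac_mult tq_frac_eq_iff regular_elements_closed regular_elements_one m_comm)
    moreover have "tq_frac R a s \<in> localization Q" "tq_frac R s a \<in> localization Q"
      unfolding localization_def using a s aQ by blast+
    ultimately show "tq_frac R a s \<in> Units (TQ\<lparr>carrier := localization Q\<rparr>)" unfolding Units_def by auto
  qed
qed

lemma tq_embed_pow:
  assumes "a \<in> carrier R"
  shows "tq_embed R (a [^] (k::nat)) = tq_embed R a [^]\<^bsub>TQ\<^esub> k"
proof (induction k)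
  case 0 show ?case using monoid.nat_pow_0 by (simp add: TQ_one tq_embed_def)
next
  case (Suc k)
  interpret T: domain TQ by (rule TQ_domain)
  show ?case using Suc assms tq_embed_mult[of "a [^] k" a] by simp
qed

text \<open>The uniformizer is the local generator \<open>q\<close> of \<open>Q\<close>. That every
  nonzero \<open>a/s\<close> divides a power of \<open>q\<close> comes from the factorization of the
  regular ideal \<open>(a)\<close>, which puts \<open>e q^k\<close> into \<open>(a)\<close> for some
  \<open>e\<close> outside \<open>Q\<close>.\<close>

lemma localization_discrete_valuation_ring:
  assumes H: "primes_contain_uinv R" and Q: "good_prime R Q"
  shows "discrete_valuation_ring (TQ\<lparr>carrier := localization Q\<rparr>)"
proof -
  let ?W = "TQ\<lparr>carrier := localization Q\<rparr>"
  interpret T: domain TQ by (rule TQ_domain)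
  note Qr = good_primeD[OF Q] and Qp = primeidealD[OF good_primeD(1)[OF Q]]
  note Qi = idealD[OF Qp(1)]
  note sub = localization_subring[OF Qr(1)]
  have gvQ: "\<And>A. gv_set R A \<Longrightarrow> \<not> A \<subseteq> Q" using Q unfolding good_prime_def by blast
  interpret W: domain ?W by (rule T.subring_is_domain[OF sub(1)])
  have reg: "s \<in> regular_elements R" if "s \<in> carrier R - Q" for s
    using that Qi(2) regular_elements_eq by blast
  obtain q d where q: "q \<in> Q" "d \<in> carrier R" "d \<notin> Q" "\<forall>a\<in>Q. \<exists>c\<in>carrier R. a \<otimes> d = q \<otimes> c"
    by (rule uinv_local_generator[OF Qr(2,4) Qr(2) gvQ])
  have qc: "q \<in> carrier R" using Qi(1)[OF q(1)] .
  have oneQ: "\<one> \<in> carrier R - Q" using Qp(2) by simp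
  show ?thesis
  proof (rule W.discrete_valuation_ringI)
    show "tq_embed R q \<in> carrier ?W" using sub(2) qc by auto
    have "q \<noteq> \<zero>"
    proof
      assume q0: "q = \<zero>"
      obtain a where a: "a \<in> Q" "a \<in> regular_elements R" using uinv_regular[OF Qr(2,4)] by blast
      then obtain c where "c \<in> carrier R" "a \<otimes> d = q \<otimes> c" using q(4) by blast
      hence "a \<otimes> d = \<zero>" using q0 by simp
      hence "d = \<zero>" using a q(2) by (simp add: regular_elements_def)
      thus False using q(3) Qi(2) by blast
    qed
    thus "tq_embed R q \<noteq> \<zero>\<^bsub>?W\<^esub>" using tq_embed_inj[OF qc zero_closed] by (simp add: TQ_zero tq_embed_def)
    show "tq_embed R q \<notin> Units ?W"
      using localization_unit[OF Qr(1) qc oneQ] q(1) by (simp add: tq_embed_def)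
  next
    fix x assume x: "x \<in> carrier ?W" "x \<notin> Units ?W"
    then obtain a s where h: "x = tq_frac R a s" "a \<in> carrier R" "s \<in> carrier R - Q"
      unfolding localization_def by auto
    hence "a \<in> Q" using x(2) localization_unit[OF Qr(1)] by blast
    then obtain c where c: "c \<in> carrier R" "a \<otimes> d = q \<otimes> c" using q(4) by blast
    have sd: "s \<otimes> d \<in> carrier R - Q" using Qp(4)[of s d] h(3) q(2,3) by blast
    have "x = tq_embed R q \<otimes>\<^bsub>TQ\<^esub> tq_frac R c (s \<otimes> d)"
    proof -
      have "a \<otimes> (s \<otimes> d) = s \<otimes> (a \<otimes> d)" using h(2,3) q(2) by (simp add: m_lcomm)
      hence "a \<otimes> (s \<otimes> d) = s \<otimes> (q \<otimes> c)" using c(2) by simp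
      thus ?thesis using h reg[OF h(3)] reg[OF sd] c(1) qc q(2) regular_elements_one
        by (simp add: tq_embed_def tq_frac_mult tq_frac_eq_iff regular_elements_closed m_comm)
    qed
    moreover have "tq_frac R c (s \<otimes> d) \<in> localization Q" unfolding localization_def using c(1) sd by blast
    ultimately show "tq_embed R q divides\<^bsub>?W\<^esub> x" unfolding factor_def by auto
  next
    fix x assume x: "x \<in> carrier ?W" "x \<noteq> \<zero>\<^bsub>?W\<^esub>"
    then obtain a s where h: "x = tq_frac R a s" "a \<in> carrier R" "s \<in> carrier R - Q"
      unfolding localization_def by auto
    have "a \<noteq> \<zero>" using x(2) h reg[OF h(3)] regular_elements_one
      by (auto simp: TQ_zero tq_frac_eq_iff)
    hence "PIdl a \<inter> regular_elements R \<noteq> {}" using cgenideal_self[OF h(2)] h(2) regular_elements_eq by blast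
    hence "u_factored R (PIdl a)" by (rule regular_ideal_u_factored[OF H cgenideal_ideal[OF h(2)]])
    then obtain k :: nat and e where e: "e \<in> carrier R" "e \<notin> Q" "e \<otimes> q [^] k \<in> PIdl a"
      using u_factored_power[OF _ Q q(1)] by blast
    then obtain c where c: "c \<in> carrier R" "e \<otimes> q [^] k = c \<otimes> a" unfolding cgenideal_def by blast
    have er: "e \<in> regular_elements R" using e reg by simp
    have "tq_embed R (q [^] k) = x \<otimes>\<^bsub>TQ\<^esub> tq_frac R (c \<otimes> s) e"
    proof -
      have sc: "s \<in> carrier R" using h(3) by simp
      have "(q [^] k) \<otimes> (s \<otimes> e) = (e \<otimes> q [^] k) \<otimes> s" using e sc qc by (simp add: m_ac)
      also have "\<dots> = a \<otimes> (c \<otimes> s)" using c sc h(2) by (simp add: m_ac)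
      finally show ?thesis using h reg[OF h(3)] er c(1) qc e(1) regular_elements_one
        by (simp add: tq_embed_def tq_frac_mult tq_frac_eq_iff regular_elements_closed)
    qed
    moreover have "tq_frac R (c \<otimes> s) e \<in> localization Q"
      unfolding localization_def using c(1) h(3) e(1,2) by blast
    moreover have "tq_embed R q [^]\<^bsub>?W\<^esub> k = tq_embed R (q [^] k)"
      using tq_embed_pow[OF qc] T.nat_pow_consistent by metis
    ultimately show "\<exists>k::nat. x divides\<^bsub>?W\<^esub> (tq_embed R q [^]\<^bsub>?W\<^esub> k)"
      unfolding factor_def by auto
  qed
qed

lemma krull_domain_of_uinv_primes:
  assumes H: "primes_contain_uinv R"
  shows "krull_domain R"
proof -
  let ?V = "localization ` {Q. good_prime R Q}"
  have gp: "primeideal Q R" if "good_prime R Q" for Q using good_primeD(1)[OF that] .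
  have reg: "s \<in> regular_elements R" if "s \<in> carrier R - Q" "good_prime R Q" for s Q
    using that idealD(2)[OF good_primeD(2)[OF that(2)]] regular_elements_eq by blast
  have "x \<in> tq_embed R ` carrier R" if xc: "x \<in> carrier TQ" and xV: "x \<in> \<Inter>?V" for x
  proof -
    obtain a s where h: "x = tq_frac R a s" "a \<in> carrier R" "s \<in> regular_elements R" "s \<in> carrier R"
      using xc by (rule TQ_E)
    have "s divides a"
    proof (rule divides_of_good_primes[OF H h(2,3)])
      fix Q assume Q: "good_prime R Q"
      hence "x \<in> localization Q" using xV by blast
      then obtain c t where c: "x = tq_frac R c t" "c \<in> carrier R" "t \<in> carrier R - Q"
        unfolding localization_def by blast
      have "a \<otimes> t = s \<otimes> c" using h c reg[OF c(3) Q] by (simp add: tq_frac_eq_iff m_comm)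
      thus "\<exists>d\<in>carrier R - Q. s divides (a \<otimes> d)" using c(2,3) unfolding factor_def by blast
    qed
    thus ?thesis using tq_frac_in_embed h by simp
  qed
  moreover have "tq_embed R ` carrier R \<subseteq> carrier TQ" using tq_embed_closed by blast
  moreover have "tq_embed R ` carrier R \<subseteq> \<Inter>?V" using localization_subring(2)[OF gp] by blast
  ultimately have int: "tq_embed R ` carrier R = carrier TQ \<inter> \<Inter>?V" by blast
  \<comment> \<open>If \<open>x\<close> is a nonunit of the localization at \<open>Q\<close>, then
    \<open>Q\<close> contains \<open>(x)\<close>; only finitely many good primes contain this
    factored ideal.\<close>
  have fin: "finite {V \<in> ?V. tq_embed R x \<notin> Units (TQ\<lparr>carrier := V\<rparr>)}" if x: "x \<in> carrier R - {\<zero>}" for x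
  proof -
    have xc: "x \<in> carrier R" using x by simp
    have "PIdl x \<inter> regular_elements R \<noteq> {}" using cgenideal_self[OF xc] x regular_elements_eq by blast
    hence "u_factored R (PIdl x)" by (rule regular_ideal_u_factored[OF H cgenideal_ideal[OF xc]])
    hence "finite (localization ` {Q. good_prime R Q \<and> PIdl x \<subseteq> Q})"
      using u_factored_finite_good_primes by blast
    moreover have "{V \<in> ?V. tq_embed R x \<notin> Units (TQ\<lparr>carrier := V\<rparr>)} \<subseteq> localization ` {Q. good_prime R Q \<and> PIdl x \<subseteq> Q}"
    proof
      fix V assume "V \<in> {V \<in> ?V. tq_embed R x \<notin> Units (TQ\<lparr>carrier := V\<rparr>)}"
      then obtain Q where Q: "good_prime R Q" "V = localization Q" and n: "tq_embed R x \<notin> Units (TQ\<lparr>carrier := V\<rparr>)" by blast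
      have "\<one> \<in> carrier R - Q" using primeidealD(2)[OF gp[OF Q(1)]] by simp
      hence "x \<in> Q" using localization_unit[OF gp[OF Q(1)] xc] n Q(2) unfolding tq_embed_def by blast
      hence "PIdl x \<subseteq> Q" by (rule cgenideal_minimal[OF good_primeD(2)[OF Q(1)]])
      thus "V \<in> localization ` {Q. good_prime R Q \<and> PIdl x \<subseteq> Q}" using Q by blast
    qed
    ultimately show ?thesis by (rule finite_subset[rotated])
  qed
  show ?thesis
    unfolding krull_domain_def Let_def
    using domain_axioms localization_subring[OF gp] localization_discrete_valuation_ring[OF H] int fin
    by (intro conjI exI[of _ ?V]) auto
qed

end

section \<open>Ideals of Krull domains\<close>

text \<open>Writing \<open>(a, b) = (c)\<close> with \<open>a = a' c\<close> and
  \<open>b = b' c\<close>, and cancelling a nonzero \<open>c\<close>, one gets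
  \<open>1 = x a' + y b'\<close>. In a local ring \<open>a'\<close> or \<open>b'\<close> is then a
  unit.\<close>

lemma (in principal_domain) local_divides_total:
  assumes loc: "local_ring R" and a: "a \<in> carrier R" and b: "b \<in> carrier R"
  shows "a divides b \<or> b divides a"
proof -
  obtain M where M: "maximalideal M R" and uniq: "\<And>N. maximalideal N R \<Longrightarrow> N = M"
    using loc unfolding local_ring_def by blast
  interpret M: maximalideal M R by fact
  have oneM: "\<one> \<notin> M" using M.one_imp_carrier M.I_notcarr by blast
  have nonunit: "x \<in> M" if x: "x \<in> carrier R" "x \<notin> Units R" for x
  proof -
    have "\<one> \<notin> PIdl x"
    proof
      assume "\<one> \<in> PIdl x"
      then obtain c where "c \<in> carrier R" "\<one> = c \<otimes> x" unfolding cgenideal_def by blast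
      hence "x \<in> Units R" using x(1) m_comm[of c x] unfolding Units_def by force
      thus False using x(2) by blast
    qed
    then obtain N where "maximalideal N R" "PIdl x \<subseteq> N" by (rule exists_maximal[OF cgenideal_ideal[OF x(1)]])
    thus ?thesis using uniq cgenideal_self[OF x(1)] by blast
  qed
  note J = adjoin[OF cgenideal_ideal[OF a] b]
  obtain c where c: "c \<in> carrier R" "adjoin (PIdl a) b = PIdl c" using exists_gen[OF J(1)] by blast
  have "a \<in> PIdl c" "b \<in> PIdl c" using J(2,3) c(2) cgenideal_self[OF a] by auto
  then obtain a' b' where ab: "a' \<in> carrier R" "a = a' \<otimes> c" "b' \<in> carrier R" "b = b' \<otimes> c"
    unfolding cgenideal_def by blast
  have "c \<in> adjoin (PIdl a) b" using c cgenideal_self by simp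
  then obtain x y where xy: "x \<in> carrier R" "y \<in> carrier R" "c = x \<otimes> a \<oplus> y \<otimes> b"
    unfolding adjoin_def cgenideal_def by blast
  have div: "u \<otimes> c divides v \<otimes> c" if uv: "u \<in> Units R" "v \<in> carrier R" for u v
  proof -
    have "(u \<otimes> c) \<otimes> (inv u \<otimes> v) = (u \<otimes> inv u) \<otimes> (v \<otimes> c)"
      using c(1) uv Units_closed[OF uv(1)] Units_inv_closed[OF uv(1)] by (simp add: m_ac del: Units_r_inv Units_l_inv)
    hence "v \<otimes> c = (u \<otimes> c) \<otimes> (inv u \<otimes> v)" using uv c(1) by simp
    thus ?thesis using uv by (intro dividesI[of "inv u \<otimes> v"]) auto
  qed
  show ?thesis
  proof (cases "c = \<zero>")
    case True
    hence "a = \<zero>" "b = \<zero>" using ab by auto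
    thus ?thesis by (auto simp: factor_def)
  next
    case False
    have "\<one> \<otimes> c = (x \<otimes> a' \<oplus> y \<otimes> b') \<otimes> c"
    proof -
      have "\<one> \<otimes> c = x \<otimes> (a' \<otimes> c) \<oplus> y \<otimes> (b' \<otimes> c)" using xy(3) ab(2,4) c(1) by simp
      thus ?thesis using ab(1,3) xy(1,2) c(1) by (simp add: l_distr m_assoc)
    qed
    hence 1: "\<one> = x \<otimes> a' \<oplus> y \<otimes> b'" using m_rcancel[OF False c(1)] xy(1,2) ab(1,3) by simp
    have "a' \<in> Units R \<or> b' \<in> Units R"
    proof (rule ccontr)
      assume "\<not> (a' \<in> Units R \<or> b' \<in> Units R)"
      hence "a' \<in> M" "b' \<in> M" using nonunit ab(1,3) by auto
      hence "x \<otimes> a' \<oplus> y \<otimes> b' \<in> M" using idealD(3,5)[OF M.is_ideal] xy(1,2) by blast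
      thus False using 1 oneM by simp
    qed
    thus ?thesis using div ab by metis
  qed
qed

text \<open>Of two elements of \<open>I\<close> one divides the other, so the multiples of elements
  of \<open>I\<close> form an ideal. Its generator is a multiple of some \<open>w\<close> in
  \<open>I\<close>, which divides everything. This gives an element of least value without
  introducing a valuation.\<close>

lemma (in principal_domain) local_exists_minimal_divisor:
  assumes loc: "local_ring R" and I: "I \<subseteq> carrier R" "I \<noteq> {}"
  shows "\<exists>w\<in>I. \<forall>y\<in>I. w divides y"
proof -
  let ?U = "{x \<in> carrier R. \<exists>w\<in>I. w divides x}"
  have add: "x \<oplus> y \<in> ?U" if xy: "x \<in> ?U" "y \<in> ?U" for x y
  proof -
    obtain v w where vw: "v \<in> I" "w \<in> I" "v divides x" "w divides y" using xy by blast
    have c: "v \<in> carrier R" "w \<in> carrier R" "x \<in> carrier R" "y \<in> carrier R" using vw I xy by auto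
    have *: "x \<oplus> y \<in> ?U" if "v \<in> I" "v divides x" "v divides y" "x \<in> carrier R" "y \<in> carrier R" for v x y
    proof -
      obtain c d where cd: "c \<in> carrier R" "d \<in> carrier R" "x = v \<otimes> c" "y = v \<otimes> d"
        using \<open>v divides x\<close> \<open>v divides y\<close> unfolding factor_def by blast
      have "x \<oplus> y = v \<otimes> (c \<oplus> d)" using cd I(1) \<open>v \<in> I\<close> by (auto simp: r_distr)
      hence "v divides (x \<oplus> y)" using cd(1,2) by (intro dividesI[of "c \<oplus> d"]) auto
      thus ?thesis using that by blast
    qed
    from local_divides_total[OF loc c(1,2)] show ?thesis
    proof
      assume "v divides w"
      hence "v divides y" using divides_trans[of v w y] vw c by blast
      thus ?thesis using * vw c by blast
    next
      assume "w divides v"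
      hence "w divides x" using divides_trans[of w v x] vw c by blast
      thus ?thesis using *[of w x y] vw c by blast
    qed
  qed
  have "ideal ?U R"
  proof (rule idealI_cring[OF _ _ add])
    obtain w where "w \<in> I" using I(2) by blast
    moreover have "w divides \<zero>" using I(1) \<open>w \<in> I\<close> by (intro dividesI[of \<zero>]) auto
    ultimately show "\<zero> \<in> ?U" by blast
  next
    fix a x assume ax: "a \<in> ?U" "x \<in> carrier R"
    then obtain w where w: "w \<in> I" "w divides a" by blast
    then obtain c where "c \<in> carrier R" "a = w \<otimes> c" unfolding factor_def by blast
    hence "x \<otimes> a = w \<otimes> (x \<otimes> c)" "x \<otimes> c \<in> carrier R" using ax w I(1) by (auto simp: m_lcomm)
    hence "w divides (x \<otimes> a)" by (intro dividesI[of "x \<otimes> c"])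
    thus "x \<otimes> a \<in> ?U" using w ax by blast
  qed auto
  then obtain c where c: "c \<in> carrier R" "?U = PIdl c" using exists_gen by blast
  have "c \<in> ?U" unfolding c(2) by (rule cgenideal_self[OF c(1)])
  then obtain w where w: "w \<in> I" "w divides c" by blast
  have "w divides y" if y: "y \<in> I" for y
  proof -
    have yc: "y \<in> carrier R" "w \<in> carrier R" using y w I(1) by auto
    have "y divides y" using yc(1) by (intro dividesI[of \<one>]) auto
    hence "y \<in> ?U" using y yc(1) by blast
    then obtain e where e: "e \<in> carrier R" "y = e \<otimes> c" unfolding c(2) cgenideal_def by blast
    obtain f where f: "f \<in> carrier R" "c = w \<otimes> f" using w(2) unfolding factor_def by blast
    have "y = w \<otimes> (e \<otimes> f)" unfolding e(2) f(2) using e(1) f(1) yc(2) by (simp add: m_lcomm)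
    thus ?thesis using e(1) f(1) by (intro dividesI[of "e \<otimes> f"]) auto
  qed
  thus ?thesis using w(1) by blast
qed

text \<open>The elements divisible by all powers of \<open>p\<close> form an ideal
  \<open>(g)\<close>. If \<open>g\<close> is nonzero, then \<open>g = p h\<close> where
  \<open>h\<close> is again divisible by all powers, so \<open>h = k g\<close>, and cancelling
  \<open>g\<close> makes \<open>p\<close> a unit.\<close>

lemma (in principal_domain) divisible_by_powers_eq_zero:
  assumes p: "p \<in> carrier R" "p \<notin> Units R" and c: "c \<in> carrier R" "\<And>n::nat. p [^] n divides c"
  shows "c = \<zero>"
proof -
  let ?C = "{x \<in> carrier R. \<forall>n::nat. p [^] n divides x}"
  have "ideal ?C R"
  proof (rule idealI_cring)
    show "\<zero> \<in> ?C" using p(1) by (auto intro!: dividesI[of \<zero>])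
  next
    fix a b assume ab: "a \<in> ?C" "b \<in> ?C"
    have "p [^] n divides (a \<oplus> b)" for n :: nat
    proof -
      obtain c d where cd: "c \<in> carrier R" "d \<in> carrier R" "a = p [^] n \<otimes> c" "b = p [^] n \<otimes> d"
        using ab unfolding factor_def by blast
      have "a \<oplus> b = p [^] n \<otimes> (c \<oplus> d)" unfolding cd(3,4) using cd(1,2) p(1) by (simp add: r_distr)
      thus ?thesis using cd(1,2) by (intro dividesI[of "c \<oplus> d"]) auto
    qed
    thus "a \<oplus> b \<in> ?C" using ab by simp
  next
    fix a x assume ax: "a \<in> ?C" "x \<in> carrier R"
    have "p [^] n divides (x \<otimes> a)" for n :: nat
    proof -
      obtain c where c: "c \<in> carrier R" "a = p [^] n \<otimes> c" using ax unfolding factor_def by blast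
      have "x \<otimes> a = p [^] n \<otimes> (x \<otimes> c)" unfolding c(2) using c(1) p(1) ax(2) by (simp add: m_lcomm)
      thus ?thesis using c(1) ax(2) by (intro dividesI[of "x \<otimes> c"]) auto
    qed
    thus "x \<otimes> a \<in> ?C" using ax by simp
  qed auto
  then obtain g where g: "g \<in> carrier R" "?C = PIdl g" using exists_gen by blast
  have gC: "g \<in> ?C" unfolding g(2) by (rule cgenideal_self[OF g(1)])
  hence "p [^] (1::nat) divides g" by blast
  then obtain h where h: "h \<in> carrier R" "g = p \<otimes> h" using p(1) unfolding factor_def by auto
  have "g = \<zero>"
  proof (rule ccontr)
    assume g0: "g \<noteq> \<zero>"
    have p0: "p \<noteq> \<zero>" using g0 h by auto
    have "p [^] n divides h" for n :: nat
    proof -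
      have "p [^] Suc n divides g" using gC by blast
      then obtain d where d: "d \<in> carrier R" "g = p [^] Suc n \<otimes> d" unfolding factor_def by blast
      have "p [^] Suc n \<otimes> d = p \<otimes> (p [^] n \<otimes> d)" using p(1) d(1) by (simp add: m_ac)
      hence "p \<otimes> h = p \<otimes> (p [^] n \<otimes> d)" using h(2) d(2) by simp
      hence "h = p [^] n \<otimes> d" using m_lcancel[OF p0 p(1) h(1)] p(1) d(1) by simp
      thus ?thesis using d(1) by (intro dividesI[of d])
    qed
    hence "h \<in> PIdl g" using h(1) g(2) by blast
    then obtain k where k: "k \<in> carrier R" "h = k \<otimes> g" unfolding cgenideal_def by blast
    have "g \<otimes> \<one> = g \<otimes> (p \<otimes> k)"
    proof -
      have "g \<otimes> \<one> = p \<otimes> h" using g(1) h(2) by simp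
      also have "\<dots> = p \<otimes> (k \<otimes> g)" using k(2) by simp
      also have "\<dots> = g \<otimes> (p \<otimes> k)" using p(1) k(1) g(1) by (simp add: m_ac)
      finally show ?thesis .
    qed
    hence "\<one> = p \<otimes> k" using m_lcancel[OF g0 g(1) one_closed] p(1) k(1) by simp
    hence "p \<in> Units R" using p(1) k(1) m_comm[of p k] unfolding Units_def by force
    thus False using p(2) by blast
  qed
  moreover have "c \<in> PIdl g" using c g(2) by blast
  ultimately show ?thesis unfolding cgenideal_def by auto
qed

context domain
begin

text \<open>If \<open>t\<close> is not in the valuation ring, then \<open>c = t^-1\<close> is a
  nonunit of it. Since \<open>x = c^n (x t^n)\<close>, every power of \<open>c\<close> divides
  \<open>x\<close>, which forces \<open>x = \<zero>\<close>.\<close>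

lemma valuation_overring_completely_integrally_closed:
  assumes V: "subring V TQ" "tq_embed R ` carrier R \<subseteq> V" "discrete_valuation_ring (TQ\<lparr>carrier := V\<rparr>)"
    and t: "t \<in> carrier TQ" and x: "x \<in> carrier R" "x \<noteq> \<zero>"
    and pow: "\<And>n::nat. tq_embed R x \<otimes>\<^bsub>TQ\<^esub> t [^]\<^bsub>TQ\<^esub> n \<in> V"
  shows "t \<in> V"
proof (rule ccontr)
  assume tV: "t \<notin> V"
  let ?W = "TQ\<lparr>carrier := V\<rparr>"
  interpret T: domain TQ by (rule TQ_domain)
  interpret W: principal_domain ?W using V(3) unfolding discrete_valuation_ring_def by blast
  have loc: "local_ring ?W" using V(3) unfolding discrete_valuation_ring_def by blast
  have VT: "V \<subseteq> carrier TQ" by (rule subringE(1)[OF V(1)])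
  obtain a s where h: "t = tq_frac R a s" "a \<in> carrier R" "s \<in> regular_elements R" "s \<in> carrier R"
    using t by (rule TQ_E)
  have emb: "tq_embed R y \<in> V" if "y \<in> carrier R" for y using V(2) that by blast
  have ts: "t \<otimes>\<^bsub>TQ\<^esub> tq_embed R s = tq_embed R a"
    using h by (simp add: tq_frac_mult_embed tq_frac_eq_embed m_comm)
  have s0: "tq_embed R s \<noteq> \<zero>\<^bsub>TQ\<^esub>"
    using tq_embed_inj[OF h(4) zero_closed] h(3) regular_elements_eq by (simp add: TQ_zero tq_embed_def)
  have ec: "tq_embed R s \<in> carrier TQ" "tq_embed R a \<in> carrier TQ" "tq_embed R x \<in> carrier TQ"
    using tq_embed_closed h(2,4) x(1) by auto
  have "\<not> tq_embed R s divides\<^bsub>?W\<^esub> tq_embed R a"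
  proof
    assume "tq_embed R s divides\<^bsub>?W\<^esub> tq_embed R a"
    then obtain c where c: "c \<in> V" "tq_embed R a = tq_embed R s \<otimes>\<^bsub>TQ\<^esub> c" unfolding factor_def by auto
    hence "tq_embed R s \<otimes>\<^bsub>TQ\<^esub> t = tq_embed R s \<otimes>\<^bsub>TQ\<^esub> c" using ts T.m_comm[OF t ec(1)] by simp
    hence "t = c" using T.m_lcancel[OF s0 ec(1) t] c(1) VT by blast
    thus False using tV c(1) by blast
  qed
  hence "tq_embed R a divides\<^bsub>?W\<^esub> tq_embed R s"
    using W.local_divides_total[OF loc, of "tq_embed R s" "tq_embed R a"] emb h(2,4) by simp
  then obtain c where c: "c \<in> V" "tq_embed R s = tq_embed R a \<otimes>\<^bsub>TQ\<^esub> c" unfolding factor_def by auto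
  have cT: "c \<in> carrier TQ" using c(1) VT by blast
  have "tq_embed R s \<otimes>\<^bsub>TQ\<^esub> (t \<otimes>\<^bsub>TQ\<^esub> c) = (t \<otimes>\<^bsub>TQ\<^esub> tq_embed R s) \<otimes>\<^bsub>TQ\<^esub> c"
    using cT t ec(1) by (simp add: T.m_ac)
  also have "\<dots> = tq_embed R s" unfolding ts by (rule c(2)[symmetric])
  also have "\<dots> = tq_embed R s \<otimes>\<^bsub>TQ\<^esub> \<one>\<^bsub>TQ\<^esub>" using ec(1) by simp
  finally have "tq_embed R s \<otimes>\<^bsub>TQ\<^esub> (t \<otimes>\<^bsub>TQ\<^esub> c) = tq_embed R s \<otimes>\<^bsub>TQ\<^esub> \<one>\<^bsub>TQ\<^esub>" .
  hence tc: "t \<otimes>\<^bsub>TQ\<^esub> c = \<one>\<^bsub>TQ\<^esub>"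
    using T.m_lcancel[OF s0 ec(1), of "t \<otimes>\<^bsub>TQ\<^esub> c" "\<one>\<^bsub>TQ\<^esub>"] t cT by simp
  have cU: "c \<notin> Units ?W"
  proof
    assume "c \<in> Units ?W"
    then obtain d where d: "d \<in> V" "c \<otimes>\<^bsub>TQ\<^esub> d = \<one>\<^bsub>TQ\<^esub>" unfolding Units_def by auto
    have dT: "d \<in> carrier TQ" using d(1) VT by blast
    have "t = t \<otimes>\<^bsub>TQ\<^esub> (c \<otimes>\<^bsub>TQ\<^esub> d)" using d(2) t by simp
    also have "\<dots> = d" using tc t cT dT by (simp add: T.m_assoc[symmetric])
    finally show False using tV d(1) by simp
  qed
  have "c [^]\<^bsub>?W\<^esub> n divides\<^bsub>?W\<^esub> tq_embed R x" for n :: nat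
  proof -
    have "t [^]\<^bsub>TQ\<^esub> n \<otimes>\<^bsub>TQ\<^esub> c [^]\<^bsub>TQ\<^esub> n = \<one>\<^bsub>TQ\<^esub>"
      using T.nat_pow_distrib[OF t cT, of n] tc by simp
    hence "c [^]\<^bsub>TQ\<^esub> n \<otimes>\<^bsub>TQ\<^esub> (tq_embed R x \<otimes>\<^bsub>TQ\<^esub> t [^]\<^bsub>TQ\<^esub> n) = tq_embed R x"
      using t cT ec(3) by (simp add: T.m_lcomm T.m_comm[of "c [^]\<^bsub>TQ\<^esub> n"])
    hence "tq_embed R x = c [^]\<^bsub>?W\<^esub> n \<otimes>\<^bsub>?W\<^esub> (tq_embed R x \<otimes>\<^bsub>TQ\<^esub> t [^]\<^bsub>TQ\<^esub> n)"
      using T.nat_pow_consistent[of c n V] by simp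
    thus ?thesis by (rule dividesI[rotated]) (use pow in simp)
  qed
  hence "tq_embed R x = \<zero>\<^bsub>?W\<^esub>"
    using W.divisible_by_powers_eq_zero[of c "tq_embed R x"] c(1) cU emb[OF x(1)] by simp
  thus False using tq_embed_inj[OF x(1) zero_closed] x(2) by (simp add: TQ_zero tq_embed_def)
qed

text \<open>By complete integral closure, \<open>(I I\<^sup>-\<^sup>1)\<^sup>-\<^sup>1 = R\<close> for every nonzero ideal \<open>I\<close>; finite character
  then yields finitely many elements of \<open>I I\<^sup>-\<^sup>1\<close> that already have trivial inverse.\<close>

lemma krull_domain_uinv:
  assumes K: "krull_domain R" and I: "ideal I R" and x: "x \<in> I" "x \<noteq> \<zero>"
  shows "uinv R I"
proof -
  interpret T: domain TQ by (rule TQ_domain)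
  obtain \<V> where V: "\<forall>V\<in>\<V>. subring V TQ \<and> tq_embed R ` carrier R \<subseteq> V
      \<and> discrete_valuation_ring (TQ\<lparr>carrier := V\<rparr>)"
    and int: "tq_embed R ` carrier R = carrier TQ \<inter> \<Inter>\<V>"
    and fin: "\<forall>y\<in>carrier R - {\<zero>}. finite {V \<in> \<V>. tq_embed R y \<notin> Units (TQ\<lparr>carrier := V\<rparr>)}"
    using K unfolding krull_domain_def Let_def by (elim conjE exE)
  have sub: "subring V TQ" and emb: "tq_embed R ` carrier R \<subseteq> V"
    and dvr: "discrete_valuation_ring (TQ\<lparr>carrier := V\<rparr>)" if "V \<in> \<V>" for V
    using V that by simp_all
  note Ir = idealD[OF I]
  have xc: "x \<in> carrier R" using Ir(1)[OF x(1)] .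
  have xr: "x \<in> regular_elements R" using xc x(2) regular_elements_eq by blast
  let ?B = "Idl (inverse_products R I)"
  have B: "ideal ?B R" by (rule genideal_ideal[OF inverse_products_carrier])
  note Br = idealD[OF B]
  have xB: "x \<in> ?B"
    using subset_inverse_products[of I] Ir(1) x(1) genideal_self[OF inverse_products_carrier] by blast
  \<comment> \<open>Let \<open>t = a/s\<close> map \<open>I I^-1\<close> into \<open>R\<close>. If
    \<open>t^n I\<close> is in \<open>R\<close>, then \<open>t^n\<close> is in \<open>I^-1\<close>,
    so \<open>t^(n+1) I\<close> is in \<open>R\<close> again. Hence \<open>x t^n\<close> is in
    \<open>R\<close> for all \<open>n\<close>, and complete integral closure applies in every
    valuation ring.\<close>
  have closed: "s divides a"
    if a: "a \<in> carrier R" and s: "s \<in> regular_elements R" and dv: "\<And>j. j \<in> ?B \<Longrightarrow> s divides (a \<otimes> j)" for a s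
  proof -
    have sc: "s \<in> carrier R" using s by (rule regular_carrier)
    have sp: "s [^] n \<in> regular_elements R" for n :: nat
      by (induction n) (auto intro: regular_elements_one regular_elements_closed s)
    have pw: "s [^] n divides (a [^] n \<otimes> q)" if "q \<in> I" for n :: nat and q
      using that
    proof (induction n arbitrary: q)
      case 0 thus ?case using Ir(1)[OF 0] by (intro dividesI[of q]) auto
    next
      case (Suc n)
      have qc: "q \<in> carrier R" using Ir(1)[OF Suc(2)] .
      obtain d where d: "d \<in> carrier R" "a [^] n \<otimes> q = s [^] n \<otimes> d" using Suc.IH[OF Suc(2)] unfolding factor_def by blast
      have "q \<otimes> a [^] n = s [^] n \<otimes> d" using d(2) a qc by (simp add: m_comm)
      moreover have "\<forall>y\<in>I. s [^] n divides (a [^] n \<otimes> y)" using Suc.IH by blast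
      moreover have "a [^] n \<in> carrier R" using a by simp
      ultimately have "d \<in> inverse_products R I"
        unfolding inverse_products_def using d(1) Suc(2) sp[of n] by blast
      hence "s divides (a \<otimes> d)" using dv genideal_self[OF inverse_products_carrier] by blast
      then obtain e where e: "e \<in> carrier R" "a \<otimes> d = s \<otimes> e" unfolding factor_def by blast
      have "a [^] Suc n \<otimes> q = a \<otimes> (a [^] n \<otimes> q)" using a qc by (simp add: m_ac)
      also have "\<dots> = s [^] n \<otimes> (a \<otimes> d)" using d a sc by (simp add: m_lcomm)
      also have "\<dots> = s [^] Suc n \<otimes> e" using e sc by (simp add: m_assoc)
      finally show ?case using e(1) by (intro dividesI[of e])
    qed
    let ?t = "tq_frac R a s"
    have t: "?t \<in> carrier TQ" using TQ_I a s by blast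
    have tp: "?t [^]\<^bsub>TQ\<^esub> n = tq_frac R (a [^] n) (s [^] n)" for n :: nat
    proof (induction n)
      case 0 show ?case by (simp add: TQ_one)
    next
      case (Suc n) thus ?case using a s sp[of n] by (simp add: tq_frac_mult)
    qed
    have "tq_embed R x \<otimes>\<^bsub>TQ\<^esub> ?t [^]\<^bsub>TQ\<^esub> n \<in> tq_embed R ` carrier R" for n :: nat
    proof -
      have "tq_embed R x \<otimes>\<^bsub>TQ\<^esub> ?t [^]\<^bsub>TQ\<^esub> n = ?t [^]\<^bsub>TQ\<^esub> n \<otimes>\<^bsub>TQ\<^esub> tq_embed R x"
        using t tq_embed_closed[OF xc] by (intro T.m_comm) auto
      also have "\<dots> = tq_frac R (a [^] n \<otimes> x) (s [^] n)" unfolding tp using tq_frac_mult_embed a sp xc by simp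
      finally show ?thesis using tq_frac_in_embed[OF _ sp] pw[OF x(1)] a xc by simp
    qed
    hence "?t \<in> V" if "V \<in> \<V>" for V
      using valuation_overring_completely_integrally_closed[OF sub[OF that] emb[OF that] dvr[OF that] t xc x(2)]
        emb[OF that] by blast
    hence "?t \<in> tq_embed R ` carrier R" using int t by blast
    thus ?thesis using tq_frac_in_embed[OF a s] by blast
  qed
  \<comment> \<open>Outside this finite set of valuation rings \<open>x\<close> is a unit, so
    \<open>x\<close> alone takes care of them. For each ring in the set one element of least value
    in \<open>I I^-1\<close> is added to the GV-set.\<close>
  let ?F = "{V \<in> \<V>. tq_embed R x \<notin> Units (TQ\<lparr>carrier := V\<rparr>)}"
  have finF: "finite ?F" using fin xc x(2) by blast
  have "\<exists>w\<in>?B. \<forall>y\<in>?B. tq_embed R w divides\<^bsub>TQ\<lparr>carrier := V\<rparr>\<^esub> tq_embed R y" if V: "V \<in> \<V>" for V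
  proof -
    interpret W: principal_domain "TQ\<lparr>carrier := V\<rparr>" using dvr[OF V] unfolding discrete_valuation_ring_def by blast
    have loc: "local_ring (TQ\<lparr>carrier := V\<rparr>)" using dvr[OF V] unfolding discrete_valuation_ring_def by blast
    have "tq_embed R ` ?B \<subseteq> carrier (TQ\<lparr>carrier := V\<rparr>)" using emb[OF V] Br(1) by auto
    moreover have "tq_embed R ` ?B \<noteq> {}" using xB by blast
    ultimately show ?thesis using W.local_exists_minimal_divisor[OF loc, of "tq_embed R ` ?B"] by blast
  qed
  then obtain w where w: "\<And>V. V \<in> \<V> \<Longrightarrow> w V \<in> ?B"
    "\<And>V y. \<lbrakk>V \<in> \<V>; y \<in> ?B\<rbrakk> \<Longrightarrow> tq_embed R (w V) divides\<^bsub>TQ\<lparr>carrier := V\<rparr>\<^esub> tq_embed R y" by metis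
  let ?A = "insert x (w ` ?F)"
  have AB: "?A \<subseteq> ?B" using xB w(1) by blast
  have Ac: "?A \<subseteq> carrier R" using AB Br(1) by blast
  have "s divides a" if a: "a \<in> carrier R" and s: "s \<in> regular_elements R"
    and dv: "\<forall>j\<in>?A. s divides (a \<otimes> j)" for a s
  proof (rule closed[OF a s])
    fix j assume j: "j \<in> ?B"
    have jc: "j \<in> carrier R" using Br(1)[OF j] .
    let ?t = "tq_frac R a s"
    have t: "?t \<in> carrier TQ" using TQ_I a s by blast
    have tA: "?t \<otimes>\<^bsub>TQ\<^esub> tq_embed R y \<in> tq_embed R ` carrier R" if y: "y \<in> ?A" for y
    proof -
      have "y \<in> carrier R" "s divides (a \<otimes> y)" using y Ac dv by blast+
      thus ?thesis using tq_frac_mult_embed[OF a s] tq_frac_in_embed[of "a \<otimes> y" s] a s by simp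
    qed
    have "?t \<otimes>\<^bsub>TQ\<^esub> tq_embed R j \<in> V" if V: "V \<in> \<V>" for V
    proof -
      note Vr = subringE[OF sub[OF V]]
      have jV: "tq_embed R j \<in> V" using emb[OF V] jc by blast
      show ?thesis
      proof (cases "V \<in> ?F")
        case True
        have wA: "w V \<in> ?A" using True by blast
        obtain v where v: "v \<in> V" "tq_embed R j = tq_embed R (w V) \<otimes>\<^bsub>TQ\<^esub> v"
          using w(2)[OF V j] unfolding factor_def by auto
        have "?t \<otimes>\<^bsub>TQ\<^esub> tq_embed R j = (?t \<otimes>\<^bsub>TQ\<^esub> tq_embed R (w V)) \<otimes>\<^bsub>TQ\<^esub> v"
          unfolding v(2) using t v(1) Vr(1) tq_embed_closed wA Ac by (intro T.m_assoc[symmetric]) blast+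
        moreover have "?t \<otimes>\<^bsub>TQ\<^esub> tq_embed R (w V) \<in> V" using tA[OF wA] emb[OF V] by blast
        ultimately show ?thesis using Vr(6) v(1) by simp
      next
        case False
        hence "tq_embed R x \<in> Units (TQ\<lparr>carrier := V\<rparr>)" using V by blast
        then obtain y where y: "y \<in> V" "tq_embed R x \<otimes>\<^bsub>TQ\<^esub> y = \<one>\<^bsub>TQ\<^esub>" unfolding Units_def by auto
        have c: "y \<in> carrier TQ" "tq_embed R j \<in> carrier TQ" "tq_embed R x \<in> carrier TQ"
          using y(1) Vr(1) tq_embed_closed jc xc by auto
        have "(?t \<otimes>\<^bsub>TQ\<^esub> tq_embed R x) \<otimes>\<^bsub>TQ\<^esub> (y \<otimes>\<^bsub>TQ\<^esub> tq_embed R j)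
            = ?t \<otimes>\<^bsub>TQ\<^esub> ((tq_embed R x \<otimes>\<^bsub>TQ\<^esub> y) \<otimes>\<^bsub>TQ\<^esub> tq_embed R j)"
          using t c by (simp add: T.m_assoc)
        hence "?t \<otimes>\<^bsub>TQ\<^esub> tq_embed R j = (?t \<otimes>\<^bsub>TQ\<^esub> tq_embed R x) \<otimes>\<^bsub>TQ\<^esub> (y \<otimes>\<^bsub>TQ\<^esub> tq_embed R j)"
          using y(2) c by simp
        moreover have "?t \<otimes>\<^bsub>TQ\<^esub> tq_embed R x \<in> V" using tA emb[OF V] by blast
        ultimately show ?thesis using Vr(6) y(1) jV by simp
      qed
    qed
    moreover have "?t \<otimes>\<^bsub>TQ\<^esub> tq_embed R j \<in> carrier TQ" using t tq_embed_closed[OF jc] by simp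
    ultimately have "?t \<otimes>\<^bsub>TQ\<^esub> tq_embed R j \<in> tq_embed R ` carrier R" using int by blast
    thus "s divides (a \<otimes> j)" using tq_frac_mult_embed[OF a s jc] tq_frac_in_embed[of "a \<otimes> j" s] a s jc by simp
  qed
  moreover have "finite ?A" using finF by simp
  moreover have "x \<in> Idl ?A \<inter> regular_elements R" using genideal_self[OF Ac] xr by blast
  ultimately have "gv_set R ?A" unfolding gv_set_def using Ac by blast
  thus ?thesis unfolding uinv_def using AB by blast
qed

end

section \<open>Decomposition into direct factors\<close>

text \<open>The ring \<open>eR\<close> keeps the element type of \<open>R\<close> and drops record
  extensions, as \<open>general_krull_ring\<close> asks of the factors.\<close>

definition idem_ring :: "('a, 'm) ring_scheme \<Rightarrow> 'a \<Rightarrow> 'a ring" where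
  "idem_ring R e = \<lparr>carrier = {x \<in> carrier R. e \<otimes>\<^bsub>R\<^esub> x = x}, monoid.mult = monoid.mult R,
     one = e, ring.zero = \<zero>\<^bsub>R\<^esub>, add = add R\<rparr>"

definition nonprincipal_primes_contain_uinv :: "('a, 'm) ring_scheme \<Rightarrow> bool" where
  "nonprincipal_primes_contain_uinv R \<longleftrightarrow> (\<forall>P. primeideal P R \<longrightarrow> \<not> principalideal P R \<longrightarrow>
     (\<exists>Q. primeideal Q R \<and> Q \<subseteq> P \<and> uinv R Q))"

lemma (in cring) idem_ring_quotient:
  assumes e: "e \<in> carrier R" "e \<otimes> e = e"
  shows "idempotent_quotient R (idem_ring R e) (\<lambda>x. e \<otimes> x) e"
proof -
  have "cring (idem_ring R e)"
  proof (rule cringI)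
    show "abelian_group (idem_ring R e)"
    proof (rule abelian_groupI)
      fix x assume x: "x \<in> carrier (idem_ring R e)"
      hence "e \<otimes> (\<ominus> x) = \<ominus> x" using e by (simp add: idem_ring_def r_minus)
      thus "\<exists>y\<in>carrier (idem_ring R e). y \<oplus>\<^bsub>idem_ring R e\<^esub> x = \<zero>\<^bsub>idem_ring R e\<^esub>"
        using x by (intro bexI[of _ "\<ominus> x"]) (auto simp: idem_ring_def l_neg)
    qed (use e in \<open>auto simp: idem_ring_def r_distr a_ac\<close>)
    show "comm_monoid (idem_ring R e)"
    proof (rule comm_monoidI)
      fix x y assume xy: "x \<in> carrier (idem_ring R e)" "y \<in> carrier (idem_ring R e)"
      have "e \<otimes> (x \<otimes> y) = x \<otimes> y" using m_assoc[of e x y] xy e by (simp add: idem_ring_def)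
      thus "x \<otimes>\<^bsub>idem_ring R e\<^esub> y \<in> carrier (idem_ring R e)" using xy by (simp add: idem_ring_def)
    qed (use e in \<open>auto simp: idem_ring_def m_ac\<close>)
  qed (auto simp: idem_ring_def l_distr)
  moreover have "(\<lambda>x. e \<otimes> x) \<in> ring_hom R (idem_ring R e)"
  proof (rule ring_hom_memI)
    fix x y assume xy: "x \<in> carrier R" "y \<in> carrier R"
    have ee: "e \<otimes> (e \<otimes> z) = e \<otimes> z" if "z \<in> carrier R" for z
      using that e by (simp add: m_assoc[symmetric])
    show "e \<otimes> x \<in> carrier (idem_ring R e)" using xy e ee by (simp add: idem_ring_def)
    have "(e \<otimes> x) \<otimes> (e \<otimes> y) = e \<otimes> (e \<otimes> (x \<otimes> y))" using xy e by (simp add: m_ac)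
    thus "e \<otimes> (x \<otimes> y) = e \<otimes> x \<otimes>\<^bsub>idem_ring R e\<^esub> (e \<otimes> y)" using xy ee by (simp add: idem_ring_def)
    show "e \<otimes> (x \<oplus> y) = e \<otimes> x \<oplus>\<^bsub>idem_ring R e\<^esub> e \<otimes> y" using xy e by (simp add: idem_ring_def r_distr)
  qed (use e in \<open>simp add: idem_ring_def\<close>)
  ultimately have "ring_hom_cring R (idem_ring R e) (\<lambda>x. e \<otimes> x)"
    by (intro ring_hom_cring.intro ring_hom_cring_axioms.intro is_cring)
  moreover have "(\<lambda>x. e \<otimes> x) ` carrier R = carrier (idem_ring R e)"
  proof
    show "(\<lambda>x. e \<otimes> x) ` carrier R \<subseteq> carrier (idem_ring R e)"
      using e by (auto simp: idem_ring_def m_assoc[symmetric])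
    show "carrier (idem_ring R e) \<subseteq> (\<lambda>x. e \<otimes> x) ` carrier R"
    proof
      fix x assume "x \<in> carrier (idem_ring R e)"
      hence "x \<in> carrier R" "x = e \<otimes> x" by (auto simp: idem_ring_def)
      thus "x \<in> (\<lambda>x. e \<otimes> x) ` carrier R" by (rule rev_image_eqI)
    qed
  qed
  ultimately show ?thesis
    by (intro idempotent_quotient.intro idempotent_quotient_axioms.intro) (use e in \<open>auto simp: idem_ring_def\<close>)
qed

text \<open>Multiplication by \<open>e\<close> kills \<open>P\<close>, so the image of the prime
  \<open>P\<close> in \<open>eR\<close> is the zero ideal.\<close>

lemma (in cring) idem_ring_domain:
  assumes e: "e \<in> carrier R" "e \<otimes> e = e"
    and P: "primeideal P R" "p \<in> carrier R" "P = PIdl p" "e \<notin> P" "e \<otimes> p = \<zero>"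
  shows "domain (idem_ring R e)"
proof (intro domain.intro domain_axioms.intro)
  note Pr = primeidealD[OF P(1)]
  note Pi = idealD[OF Pr(1)]
  show "cring (idem_ring R e)"
    using idem_ring_quotient[OF e] by (simp add: idempotent_quotient_def ring_hom_cring_def)
  have "e \<noteq> \<zero>" using P(4) Pi(2) by metis
  thus "\<one>\<^bsub>idem_ring R e\<^esub> \<noteq> \<zero>\<^bsub>idem_ring R e\<^esub>" by (simp add: idem_ring_def)
  fix a b assume ab: "a \<otimes>\<^bsub>idem_ring R e\<^esub> b = \<zero>\<^bsub>idem_ring R e\<^esub>"
    "a \<in> carrier (idem_ring R e)" "b \<in> carrier (idem_ring R e)"
  have z: "y = \<zero>" if y: "y \<in> P" "e \<otimes> y = y" for y
  proof -
    obtain c where c: "c \<in> carrier R" "y = c \<otimes> p" using y(1) P(3) unfolding cgenideal_def by blast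
    hence "e \<otimes> y = c \<otimes> (e \<otimes> p)" using e(1) P(2) by (simp add: m_lcomm)
    thus ?thesis using P(5) y(2) c(1) by simp
  qed
  have "a \<in> carrier R" "b \<in> carrier R" "a \<otimes> b \<in> P" "e \<otimes> a = a" "e \<otimes> b = b"
    using ab Pi(2) by (simp_all add: idem_ring_def)
  hence "a = \<zero> \<or> b = \<zero>" using Pr(4)[of a b] z[of a] z[of b] by blast
  thus "a = \<zero>\<^bsub>idem_ring R e\<^esub> \<or> b = \<zero>\<^bsub>idem_ring R e\<^esub>" by (simp add: idem_ring_def)
qed

text \<open>The nilpotent \<open>m\<close> lies in every prime, so every maximal ideal contains
  \<open>M\<close> and therefore equals it.\<close>

lemma (in cring) special_primary_ringI:
  assumes M: "primeideal M R" and m: "m \<in> carrier R" "M = PIdl m"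
    and n: "n \<ge> 1" "m [^] (n::nat) = \<zero>" and uniq: "\<And>N. \<lbrakk>primeideal N R; M \<subseteq> N\<rbrakk> \<Longrightarrow> N = M"
  shows "special_primary_ring R"
proof -
  note Mr = primeidealD[OF M]
  obtain N where N: "maximalideal N R" "M \<subseteq> N" using exists_maximal[OF Mr(1,2)] by blast
  have max: "maximalideal M R" using uniq[OF maximalideal_prime[OF N(1)] N(2)] N(1) by simp
  have "N = M" if N: "maximalideal N R" for N
  proof -
    note Nr = primeidealD[OF maximalideal_prime[OF N]]
    have "m [^] n \<in> N" using n(2) idealD(2)[OF Nr(1)] by simp
    hence "m \<in> N" using primeideal_pow[OF maximalideal_prime[OF N] m(1)] by blast
    hence "M \<subseteq> N" unfolding m(2) by (rule cgenideal_minimal[OF Nr(1)])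
    thus ?thesis using uniq[OF maximalideal_prime[OF N]] by blast
  qed
  hence loc: "local_ring R" unfolding local_ring_def using is_cring max by blast
  have pr: "principalideal M R"
    using principalidealI[OF Mr(1)] m cgenideal_eq_genideal[OF m(1)] by blast
  have mM: "m \<in> M" unfolding m(2) by (rule cgenideal_self[OF m(1)])
  \<comment> \<open>Powers of the ideal are compared with powers of its generator: the upper bound
    leaves nothing but \<open>\<zero>\<close> in the \<open>n\<close>-th power of \<open>M\<close>,
    and the lower bound shows that it contains \<open>\<zero>\<close>.\<close>
  have pow: "m [^] k \<in> M [^]\<^bsub>ideals_set R\<^esub> k \<and> M [^]\<^bsub>ideals_set R\<^esub> k \<subseteq> PIdl (m [^] k)" for k :: nat
  proof (induction k)
    case 0
    have "PIdl \<one> = carrier R" using cgenideal_eq_genideal[OF one_closed] genideal_one by simp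
    thus ?case by (simp add: ideals_set_def)
  next
    case (Suc k)
    let ?P = "PIdl (m [^] Suc k)"
    have P: "ideal ?P R" using cgenideal_ideal m(1) by simp
    have *: "M [^]\<^bsub>ideals_set R\<^esub> Suc k = ideal_prod R (M [^]\<^bsub>ideals_set R\<^esub> k) M" by (simp add: ideals_set_def)
    have "x \<in> ?P" if "x \<in> ideal_prod R (M [^]\<^bsub>ideals_set R\<^esub> k) M" for x
      using that
    proof induction
      case (prod i j)
      then obtain c d where "c \<in> carrier R" "i = c \<otimes> m [^] k" "d \<in> carrier R" "j = d \<otimes> m"
        using Suc m(2) unfolding cgenideal_def by blast
      hence "i \<otimes> j = (c \<otimes> d) \<otimes> m [^] Suc k" "c \<otimes> d \<in> carrier R" using m(1) by (simp_all add: m_ac)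
      thus ?case unfolding cgenideal_def by blast
    next
      case (sum x y) thus ?case using idealD(3)[OF P] by blast
    qed
    moreover have "m [^] Suc k \<in> ideal_prod R (M [^]\<^bsub>ideals_set R\<^esub> k) M"
      using ideal_prod.prod[OF conjunct1[OF Suc] mM] by simp
    ultimately show ?case unfolding * by blast
  qed
  have "PIdl \<zero> = {\<zero>}" using cgenideal_eq_genideal[OF zero_closed] genideal_zero by simp
  hence "M [^]\<^bsub>ideals_set R\<^esub> n = {\<zero>}" using pow[of n] n(2) by auto
  thus ?thesis unfolding special_primary_ring_def using loc max pr n(1) by blast
qed

context cring
begin

section \<open>The direct factor attached to a minimal prime\<close>

lemma principalidealE:
  assumes "principalideal P R"
  obtains p where "p \<in> carrier R" "P = PIdl p"
  using principalideal.generate[OF assms] cgenideal_eq_genideal by blast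

text \<open>The generator \<open>p\<close> of a regular principal prime divides a regular element,
  hence is regular; then \<open>1 = p (1/p)\<close> lies in \<open>P P^-1\<close>.\<close>

lemma primes_contain_uinv_of_nonprincipal:
  assumes H: "nonprincipal_primes_contain_uinv R"
  shows "primes_contain_uinv R"
  unfolding primes_contain_uinv_def
proof (intro allI impI)
  fix P assume P: "primeideal P R" "P \<inter> regular_elements R \<noteq> {}"
  show "\<exists>Q. primeideal Q R \<and> Q \<subseteq> P \<and> uinv R Q"
  proof (cases "principalideal P R")
    case False thus ?thesis using H P(1) unfolding nonprincipal_primes_contain_uinv_def by blast
  next
    case True
    then obtain p where p: "p \<in> carrier R" "P = PIdl p" by (rule principalidealE)
    obtain r where r: "r \<in> P" "r \<in> regular_elements R" using P(2) by blast
    then obtain c where c: "c \<in> carrier R" "r = c \<otimes> p" using p unfolding cgenideal_def by blast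
    have pr: "p \<in> regular_elements R"
    proof -
      have "x = \<zero>" if "x \<in> carrier R" "p \<otimes> x = \<zero>" for x
      proof -
        have "r \<otimes> x = c \<otimes> (p \<otimes> x)" using c p(1) that(1) by (simp add: m_assoc)
        thus ?thesis using that r(2) c(1) by (simp add: regular_elements_def)
      qed
      thus ?thesis unfolding regular_elements_def using p(1) by blast
    qed
    have "\<forall>x\<in>P. p divides (\<one> \<otimes> x)"
    proof
      fix x assume "x \<in> P"
      then obtain c where c: "c \<in> carrier R" "x = c \<otimes> p" using p unfolding cgenideal_def by blast
      thus "p divides (\<one> \<otimes> x)" using p(1) by (intro dividesI[of c]) (auto simp: m_comm)
    qed
    moreover have "p \<in> P" using cgenideal_self[OF p(1)] p(2) by simp
    ultimately have "\<one> \<in> inverse_products R P" unfolding inverse_products_def using pr one_closed by blast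
    hence "{\<one>} \<subseteq> Idl (inverse_products R P)" using genideal_self[OF inverse_products_carrier] by blast
    hence "uinv R P" unfolding uinv_def using gv_set_one by blast
    thus ?thesis using P(1) by blast
  qed
qed

text \<open>For \<open>y\<close> in \<open>Q^-1\<close> and \<open>q1\<close> in \<open>Q\<close>
  outside \<open>P\<close>, the element \<open>(y p) q1 = (y q1) p\<close> is in \<open>P\<close>,
  so \<open>y p\<close> is in \<open>P = (p)\<close>. Hence \<open>p Q Q^-1\<close> is contained in
  \<open>p Q\<close>. A GV-set supplies \<open>j\<close> outside \<open>Q\<close> with
  \<open>p j = p q\<close> for some \<open>q\<close> in \<open>Q\<close>, and \<open>j - q\<close>
  annihilates \<open>p\<close>.\<close>

lemma annihilator_of_principal_prime:
  assumes P: "primeideal P R" "p \<in> carrier R" "P = PIdl p" and Q: "good_prime R Q" and sub: "P \<subset> Q"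
  shows "\<exists>s\<in>carrier R - Q. s \<otimes> p = \<zero>"
proof -
  note Qr = good_primeD[OF Q]
  note Qi = idealD[OF Qr(2)] and Pi = idealD[OF primeidealD(1)[OF P(1)]]
  have pP: "p \<in> P" using cgenideal_self[OF P(2)] P(3) by simp
  obtain q1 where q1: "q1 \<in> Q" "q1 \<notin> P" using sub by blast
  let ?J = "{j \<in> carrier R. \<exists>q\<in>Q. p \<otimes> j = p \<otimes> q}"
  have J: "ideal ?J R"
  proof (rule idealI_cring)
    show "\<zero> \<in> ?J" using Qi(2) by blast
  next
    fix a b assume "a \<in> ?J" "b \<in> ?J"
    then obtain q t where h: "a \<in> carrier R" "b \<in> carrier R" "q \<in> Q" "t \<in> Q" "p \<otimes> a = p \<otimes> q" "p \<otimes> b = p \<otimes> t"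
      by blast
    hence "p \<otimes> (a \<oplus> b) = p \<otimes> (q \<oplus> t)" using P(2) Qi(1) by (simp add: r_distr)
    thus "a \<oplus> b \<in> ?J" using Qi(3) h by blast
  next
    fix a x assume "a \<in> ?J" "x \<in> carrier R"
    then obtain q where h: "a \<in> carrier R" "x \<in> carrier R" "q \<in> Q" "p \<otimes> a = p \<otimes> q" by blast
    have "p \<otimes> (x \<otimes> a) = p \<otimes> (x \<otimes> q)"
      using m_lcomm[OF P(2) h(2,1)] m_lcomm[OF P(2) h(2) Qi(1)[OF h(3)]] h(4) by simp
    thus "x \<otimes> a \<in> ?J" using Qi(5) h by blast
  qed auto
  have "inverse_products R Q \<subseteq> ?J"
  proof
    fix d assume "d \<in> inverse_products R Q"
    then obtain q s b where d: "d \<in> carrier R" "q \<in> Q" "s \<in> regular_elements R" "b \<in> carrier R"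
      "\<And>x. x \<in> Q \<Longrightarrow> s divides (b \<otimes> x)" "q \<otimes> b = s \<otimes> d"
      by - (erule inverse_productsE, blast)
    have "p \<in> Q" using pP sub by blast
    then obtain c where c: "c \<in> carrier R" "b \<otimes> p = s \<otimes> c" using d(5) unfolding factor_def by blast
    obtain d1 where d1: "d1 \<in> carrier R" "b \<otimes> q1 = s \<otimes> d1" using d(5)[OF q1(1)] unfolding factor_def by blast
    note cr = regular_carrier[OF d(3)] d(1,4) c(1) d1(1) P(2) Qi(1)[OF d(2)] Qi(1)[OF q1(1)]
    have "s \<otimes> (c \<otimes> q1) = (b \<otimes> p) \<otimes> q1" unfolding c(2) using cr by (simp add: m_assoc)
    also have "\<dots> = (b \<otimes> q1) \<otimes> p" using cr by (simp add: m_ac)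
    also have "\<dots> = s \<otimes> (d1 \<otimes> p)" unfolding d1(2) using cr by (simp add: m_assoc)
    finally have "c \<otimes> q1 = d1 \<otimes> p" using regular_cancel[OF d(3)] cr by simp
    hence "c \<otimes> q1 \<in> P" using Pi(5)[OF d1(1) pP] by simp
    hence "c \<in> P" using primeidealD(4)[OF P(1)] cr q1(2) by blast
    then obtain c' where c': "c' \<in> carrier R" "c = c' \<otimes> p" using P(3) unfolding cgenideal_def by blast
    have "s \<otimes> (p \<otimes> d) = p \<otimes> (q \<otimes> b)" unfolding d(6) using cr by (simp add: m_lcomm)
    also have "\<dots> = q \<otimes> (b \<otimes> p)" using cr by (simp add: m_ac)
    also have "\<dots> = q \<otimes> (s \<otimes> (c' \<otimes> p))" using c(2) c'(2) by simp
    also have "\<dots> = s \<otimes> (p \<otimes> (q \<otimes> c'))" using cr c'(1) by (simp add: m_ac)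
    finally have "p \<otimes> d = p \<otimes> (q \<otimes> c')" using regular_cancel[OF d(3)] cr c'(1) by simp
    moreover have "q \<otimes> c' \<in> Q" using Qi(6)[OF c'(1) d(2)] .
    ultimately show "d \<in> ?J" using d(1) by blast
  qed
  hence JI: "Idl (inverse_products R Q) \<subseteq> ?J" by (rule genideal_minimal[OF J])
  obtain A where A: "gv_set R A" "A \<subseteq> Idl (inverse_products R Q)" using Qr(4) unfolding uinv_def by blast
  obtain j where j: "j \<in> A" "j \<notin> Q" using Q A(1) unfolding good_prime_def by blast
  then obtain q where q: "q \<in> Q" "p \<otimes> j = p \<otimes> q" and jc: "j \<in> carrier R" using A(2) JI by blast
  have qc: "q \<in> carrier R" using Qi(1)[OF q(1)] .
  have "j \<ominus> q \<notin> Q"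
  proof
    assume "j \<ominus> q \<in> Q"
    hence "(j \<ominus> q) \<oplus> q \<in> Q" using Qi(3) q(1) by blast
    moreover have "(j \<ominus> q) \<oplus> q = j" using jc qc by (simp add: minus_eq a_assoc l_neg)
    ultimately show False using j(2) by simp
  qed
  moreover have "(j \<ominus> q) \<otimes> p = \<zero>"
  proof -
    have "(j \<ominus> q) \<otimes> p = j \<otimes> p \<ominus> q \<otimes> p" using jc qc P(2) by (simp add: minus_eq l_distr l_minus)
    hence "(j \<ominus> q) \<otimes> p = p \<otimes> j \<ominus> p \<otimes> q" using m_comm[OF jc P(2)] m_comm[OF qc P(2)] by simp
    thus ?thesis using q(2) jc qc P(2) by (simp add: r_right_minus_eq)
  qed
  ultimately show ?thesis using jc qc by blast
qed

text \<open>With \<open>M = (m)\<close> one has \<open>p = c m\<close>, and \<open>m\<close> is not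
  in \<open>P\<close>, so \<open>c = d p\<close>. Then \<open>p = d m p\<close>, and
  \<open>\<one> \<ominus> d \<otimes> m\<close> annihilates \<open>p\<close> from outside
  \<open>M\<close>.\<close>

lemma principal_prime_over_principal:
  assumes P: "primeideal P R" "p \<in> carrier R" "P = PIdl p"
    and M: "primeideal M R" "principalideal M R" "P \<subset> M"
  obtains s where "s \<in> carrier R" "s \<notin> M" "s \<otimes> p = \<zero>"
proof -
  note Pi = idealD[OF primeidealD(1)[OF P(1)]] and Mi = idealD[OF primeidealD(1)[OF M(1)]]
  obtain m where m: "m \<in> carrier R" "M = PIdl m" using M(2) by (rule principalidealE)
  have pP: "p \<in> P" using cgenideal_self[OF P(2)] P(3) by simp
  then obtain c where c: "c \<in> carrier R" "p = c \<otimes> m" using M(3) m(2) unfolding cgenideal_def by blast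
  have "m \<notin> P" using cgenideal_minimal[OF primeidealD(1)[OF P(1)], of m] m(2) M(3) by blast
  hence "c \<in> P" using primeidealD(4)[OF P(1) c(1) m(1)] c(2) pP by auto
  then obtain d where d: "d \<in> carrier R" "c = d \<otimes> p" using P(3) unfolding cgenideal_def by blast
  have pe: "p = (d \<otimes> m) \<otimes> p"
  proof -
    have "p = (d \<otimes> p) \<otimes> m" using c(2) d(2) by simp
    thus ?thesis using d(1) m(1) P(2) by (simp add: m_ac)
  qed
  have "(\<one> \<ominus> d \<otimes> m) \<otimes> p = p \<ominus> (d \<otimes> m) \<otimes> p"
    using d(1) m(1) P(2) by (simp add: minus_eq l_distr l_minus)
  also have "\<dots> = \<zero>" using pe P(2) d(1) m(1) by (metis m_closed r_right_minus_eq)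
  finally have z: "(\<one> \<ominus> d \<otimes> m) \<otimes> p = \<zero>" .
  have dm: "d \<otimes> m \<in> M" using Mi(5)[OF d(1)] cgenideal_self[OF m(1)] m(2) by simp
  have "\<one> \<ominus> d \<otimes> m \<notin> M"
  proof
    assume "\<one> \<ominus> d \<otimes> m \<in> M"
    hence "(\<one> \<ominus> d \<otimes> m) \<oplus> d \<otimes> m \<in> M" using Mi(3) dm by blast
    moreover have "(\<one> \<ominus> d \<otimes> m) \<oplus> d \<otimes> m = \<one>" using d(1) m(1) by (simp add: minus_eq a_assoc l_neg)
    ultimately show False using primeidealD(2)[OF M(1)] by simp
  qed
  moreover have "\<one> \<ominus> d \<otimes> m \<in> carrier R" using d(1) m(1) by simp
  ultimately show ?thesis using that z by blast
qed

text \<open>Powers of a regular element are regular, but every element of \<open>P\<close> has a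
  power killed by an element outside \<open>P\<close>, hence by a nonzero one.\<close>

lemma minimal_prime_not_regular:
  assumes P: "primeideal P R" and min: "\<And>Q. \<lbrakk>primeideal Q R; Q \<subseteq> P\<rbrakk> \<Longrightarrow> Q = P"
  shows "P \<inter> regular_elements R = {}"
proof (rule ccontr)
  assume "P \<inter> regular_elements R \<noteq> {}"
  then obtain r where r: "r \<in> P" "r \<in> regular_elements R" by blast
  obtain s and n :: nat where s: "s \<in> carrier R" "s \<notin> P" "s \<otimes> r [^] n = \<zero>"
    by (rule minimal_prime_annihilated_power[OF P min r(1)])
  have "r [^] n \<in> regular_elements R" for n :: nat
    by (induction n) (auto intro: regular_elements_one regular_elements_closed r(2))
  hence "s = \<zero>" using s regular_cancel[of "r [^] n" s \<zero>] regular_carrier[OF r(2)] by (simp add: m_comm)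
  thus False using s(2) idealD(2)[OF primeidealD(1)[OF P]] by blast
qed

text \<open>Otherwise \<open>P\<close> would contain a \<open>u\<close>-invertible prime, equal to
  \<open>P\<close> by minimality, and so a regular element.\<close>

lemma minimal_prime_principal:
  assumes H: "nonprincipal_primes_contain_uinv R"
    and P: "primeideal P R" and min: "\<And>Q. \<lbrakk>primeideal Q R; Q \<subseteq> P\<rbrakk> \<Longrightarrow> Q = P"
  obtains p where "p \<in> carrier R" "P = PIdl p"
proof (cases "principalideal P R")
  case True thus ?thesis using principalidealE that by blast
next
  case False
  then obtain Q where Q: "primeideal Q R" "Q \<subseteq> P" "uinv R Q"
    using H P unfolding nonprincipal_primes_contain_uinv_def by blast
  hence "Q = P" using min by blast
  thus ?thesis using uinv_regular[OF primeidealD(1)[OF Q(1)] Q(3)] minimal_prime_not_regular[OF P min] by blast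
qed

text \<open>With \<open>A\<close> the annihilator of \<open>p\<^sup>n\<close>, the ideal \<open>A + (p\<^sup>n)\<close> contains a regular element
  \<open>r = a + b p\<^sup>n\<close>. Then \<open>a/r\<close> is an idempotent of \<open>T(R)\<close>, and it lies in \<open>R\<close> because it does so
  locally at every good prime.\<close>

lemma idempotent_of_minimal_prime:
  assumes H: "nonprincipal_primes_contain_uinv R"
    and P: "primeideal P R" and min: "\<And>Q. \<lbrakk>primeideal Q R; Q \<subseteq> P\<rbrakk> \<Longrightarrow> Q = P"
    and p: "p \<in> carrier R" "P = PIdl p"
    and s0: "s0 \<in> carrier R" "s0 \<notin> P" "s0 \<otimes> p [^] (n::nat) = \<zero>"
  obtains e where "e \<in> carrier R" "e \<otimes> e = e" "e \<notin> P" "e \<otimes> p [^] n = \<zero>"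
proof -
  note Pr = primeidealD[OF P]
  note Pi = idealD[OF Pr(1)]
  have nreg: "P \<inter> regular_elements R = {}" by (rule minimal_prime_not_regular[OF P min])
  have pP: "p \<in> P" using cgenideal_self[OF p(1)] p(2) by simp
  let ?x = "p [^] n"
  have xc: "?x \<in> carrier R" using p(1) by simp
  have "n \<noteq> 0"
  proof
    assume "n = 0"
    hence "s0 = \<zero>" using s0(1,3) by simp
    thus False using s0(2) Pi(2) by simp
  qed
  then obtain k where k: "n = Suc k" using not0_implies_Suc by blast
  have xP: "?x \<in> P" unfolding k nat_pow_Suc using Pi(5)[OF _ pP] p(1) by simp
  have ann: "s \<otimes> ?x = \<zero>" if "s \<in> carrier R" "s \<otimes> p = \<zero>" for s
  proof -
    have "s \<otimes> ?x = (s \<otimes> p) \<otimes> p [^] k" unfolding k nat_pow_Suc using that(1) p(1) by (simp add: m_ac)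
    thus ?thesis using that(2) p(1) by simp
  qed
  let ?A = "{y \<in> carrier R. y \<otimes> ?x = \<zero>}"
  have A: "ideal ?A R"
    by (rule idealI_cring) (use xc in \<open>auto simp: l_distr m_assoc\<close>)
  note I = adjoin[OF A xc]
  \<comment> \<open>A prime \<open>M\<close> over this ideal without regular elements would properly
    contain \<open>P\<close>, as it contains \<open>s0\<close>. If \<open>M\<close> is principal, an
    element outside \<open>M\<close> annihilates \<open>p\<close>, yet the annihilator
    \<open>?A\<close> lies in \<open>M\<close>; if not, \<open>M\<close> contains a
    \<open>u\<close>-invertible prime and with it a regular element.\<close>
  have "adjoin ?A ?x \<inter> regular_elements R \<noteq> {}"
  proof
    assume dis: "adjoin ?A ?x \<inter> regular_elements R = {}"
    obtain M where M: "primeideal M R" "adjoin ?A ?x \<subseteq> M" "M \<inter> regular_elements R = {}"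
      by (rule exists_prime_disjoint[OF I(1) dis regular_elements_one _ regular_elements_closed])
         (auto dest: regular_carrier)
    have "p \<in> M" using primeideal_pow[OF M(1) p(1)] I(3) M(2) by blast
    hence "P \<subseteq> M" unfolding p(2) by (rule cgenideal_minimal[OF primeidealD(1)[OF M(1)]])
    moreover have "s0 \<in> M" using s0 I(2) M(2) by blast
    ultimately have PM: "P \<subset> M" using s0(2) by blast
    show False
    proof (cases "principalideal M R")
      case True
      then obtain s where s: "s \<in> carrier R" "s \<notin> M" "s \<otimes> p = \<zero>"
        using principal_prime_over_principal[OF P p M(1) _ PM] by blast
      hence "s \<in> ?A" using ann by blast
      thus False using s(2) I(2) M(2) by blast
    next
      case False
      then obtain Q where "primeideal Q R" "Q \<subseteq> M" "uinv R Q"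
        using H M(1) unfolding nonprincipal_primes_contain_uinv_def by blast
      thus False using uinv_regular[OF primeidealD(1)] M(3) by blast
    qed
  qed
  then obtain r where r: "r \<in> adjoin ?A ?x" "r \<in> regular_elements R" by blast
  then obtain a b where ab: "a \<in> carrier R" "a \<otimes> ?x = \<zero>" "b \<in> carrier R" "r = a \<oplus> b \<otimes> ?x"
    unfolding adjoin_def by blast
  have rc: "r \<in> carrier R" using r(2) by (rule regular_carrier)
  \<comment> \<open>At a good \<open>Q\<close> not above \<open>P\<close>, the power
    \<open>?x\<close> is outside \<open>Q\<close> and makes the numerator zero. At a good
    \<open>Q\<close> above \<open>P\<close>, some \<open>s\<close> outside \<open>Q\<close>
    annihilates \<open>p\<close>, and \<open>a s = r s\<close> shows that \<open>a/r\<close> is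
    \<open>1\<close> there.\<close>
  have "r divides a"
  proof (rule divides_of_good_primes[OF primes_contain_uinv_of_nonprincipal[OF H] ab(1) r(2)])
    fix Q assume Q: "good_prime R Q"
    note Qr = good_primeD[OF Q]
    show "\<exists>d\<in>carrier R - Q. r divides (a \<otimes> d)"
    proof (cases "P \<subseteq> Q")
      case False
      hence "p \<notin> Q" using cgenideal_minimal[OF Qr(2), of p] p(2) by blast
      hence "?x \<notin> Q" using primeideal_pow[OF Qr(1) p(1)] by blast
      moreover have "r divides (a \<otimes> ?x)" unfolding ab(2) using rc by (intro dividesI[of \<zero>]) auto
      ultimately show ?thesis using xc by blast
    next
      case True
      have "P \<noteq> Q" using uinv_regular[OF Qr(2,4)] nreg by blast
      then obtain s where s: "s \<in> carrier R" "s \<notin> Q" "s \<otimes> p = \<zero>"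
        using annihilator_of_principal_prime[OF P p Q] True by blast
      have "r \<otimes> s = a \<otimes> s \<oplus> b \<otimes> (s \<otimes> ?x)" unfolding ab(4) using ab(1,3) xc s(1) by (simp add: l_distr r_distr m_ac)
      hence "a \<otimes> s = r \<otimes> s" using ann[OF s(1,3)] ab(1,3) s(1) by simp
      hence "r divides (a \<otimes> s)" using s(1) by (intro dividesI[of s])
      thus ?thesis using s by blast
    qed
  qed
  then obtain e where e: "e \<in> carrier R" "a = r \<otimes> e" unfolding factor_def by blast
  have "r \<otimes> (e \<otimes> ?x) = r \<otimes> \<zero>" using ab(2) e rc xc by (simp add: m_assoc)
  hence ex: "e \<otimes> ?x = \<zero>" using regular_cancel[OF r(2), of "e \<otimes> ?x" \<zero>] e(1) xc by simp
  \<comment> \<open>Since \<open>a\<close> kills \<open>?x\<close>, one has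
    \<open>a r = a a\<close>, so \<open>a/r\<close> is idempotent.\<close>
  have "r \<otimes> (r \<otimes> (e \<otimes> e)) = r \<otimes> (r \<otimes> e)"
  proof -
    have "a \<otimes> r = a \<otimes> a \<oplus> b \<otimes> (a \<otimes> ?x)" unfolding ab(4) using ab(1,3) xc by (simp add: r_distr m_lcomm)
    hence "a \<otimes> r = a \<otimes> a" using ab by simp
    thus ?thesis unfolding e(2) using e(1) rc by (simp add: m_ac)
  qed
  hence "r \<otimes> (e \<otimes> e) = r \<otimes> e" using regular_cancel[OF r(2)] rc e(1) by simp
  hence ee: "e \<otimes> e = e" using regular_cancel[OF r(2)] rc e(1) by simp
  have "e \<notin> P"
  proof
    assume "e \<in> P"
    hence "a \<in> P" unfolding e(2) using Pi(5) rc by blast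
    moreover have "b \<otimes> ?x \<in> P" using Pi(5) ab(3) xP by blast
    ultimately have "r \<in> P" unfolding ab(4) using Pi(3) by blast
    thus False using r(2) nreg by blast
  qed
  thus ?thesis using that e(1) ee ex by blast
qed

text \<open>The alternative is whether an element outside \<open>P\<close> annihilates
  \<open>p\<close>. If so, \<open>e\<close> can be chosen with \<open>e p = 0\<close>, and
  \<open>eR\<close> is a domain. If not, no good prime contains \<open>P\<close>, and the image of
  \<open>P\<close> is the only prime of \<open>eR\<close>. The last clause says that
  \<open>eR\<close> is indecomposable; it makes distinct factors orthogonal in
  \<open>general_krull_ringI\<close>.\<close>

lemma minimal_prime_factor:
  assumes H: "nonprincipal_primes_contain_uinv R"
    and P: "primeideal P R" and min: "\<And>Q. \<lbrakk>primeideal Q R; Q \<subseteq> P\<rbrakk> \<Longrightarrow> Q = P"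
  obtains e where "e \<in> carrier R" "e \<otimes> e = e" "e \<notin> P"
    "krull_domain (idem_ring R e) \<or> special_primary_ring (idem_ring R e)"
    "\<And>f. \<lbrakk>f \<in> carrier R; f \<otimes> f = f\<rbrakk> \<Longrightarrow> e \<otimes> f = \<zero> \<or> e \<otimes> f = e"
proof -
  note Pr = primeidealD[OF P]
  note Pi = idealD[OF Pr(1)]
  obtain p where p: "p \<in> carrier R" "P = PIdl p" by (rule minimal_prime_principal[OF H P min])
  have pP: "p \<in> P" using cgenideal_self[OF p(1)] p(2) by simp
  have H': "primes_contain_uinv R" by (rule primes_contain_uinv_of_nonprincipal[OF H])
  have nreg: "P \<inter> regular_elements R = {}" by (rule minimal_prime_not_regular[OF P min])
  \<comment> \<open>An idempotent \<open>g\<close> in \<open>P\<close> equals its positive powers,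
    so \<open>e p^n = 0\<close> gives \<open>e g = 0\<close>. Of \<open>f\<close> and
    \<open>\<one> \<ominus> f\<close> one is in \<open>P\<close>.\<close>
  have conn: "e \<otimes> f = \<zero> \<or> e \<otimes> f = e"
    if e: "e \<in> carrier R" "e \<otimes> e = e" "e \<otimes> p [^] (n::nat) = \<zero>" and f: "f \<in> carrier R" "f \<otimes> f = f" for e f n
  proof -
    have kill: "e \<otimes> g = \<zero>" if g: "g \<in> P" "g \<otimes> g = g" for g
    proof -
      obtain c where c: "c \<in> carrier R" "g = c \<otimes> p" using g(1) p(2) unfolding cgenideal_def by blast
      have gc: "g \<in> carrier R" using c p(1) by simp
      have "e \<otimes> g [^] k = e \<otimes> g" if "k \<noteq> 0" for k :: nat
        using that
      proof (induction k)
        case (Suc k)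
        have "e \<otimes> g [^] Suc k = (e \<otimes> g [^] k) \<otimes> g" using gc e(1) by (simp add: m_assoc)
        moreover have "(e \<otimes> g) \<otimes> g = e \<otimes> g" using gc e(1) g(2) by (simp add: m_assoc)
        ultimately show ?case using Suc.IH gc e(1) by (cases "k = 0") simp_all
      qed simp
      moreover have "e \<otimes> g [^] n = \<zero>"
      proof -
        have "g [^] n = c [^] n \<otimes> p [^] n" unfolding c(2) using c(1) p(1) by (rule nat_pow_distrib)
        moreover have "e \<otimes> (c [^] n \<otimes> p [^] n) = c [^] n \<otimes> (e \<otimes> p [^] n)"
          using e(1) c(1) p(1) by (intro m_lcomm) auto
        ultimately show ?thesis using e(3) c(1) by simp
      qed
      moreover have "n \<noteq> 0 \<or> e = \<zero>" using e(1,3) by (cases "n = 0") auto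
      ultimately show ?thesis using gc by auto
    qed
    have f1: "f \<otimes> (\<one> \<ominus> f) = \<zero>" using f by (simp add: minus_eq r_distr r_minus r_neg)
    have f2: "(\<one> \<ominus> f) \<otimes> (\<one> \<ominus> f) = \<one> \<ominus> f"
    proof -
      have "(\<one> \<ominus> f) \<otimes> (\<one> \<ominus> f) = (\<one> \<ominus> f) \<ominus> f \<otimes> (\<one> \<ominus> f)" using f(1) by (simp add: minus_eq l_distr l_minus)
      thus ?thesis using f1 f(1) by (simp add: minus_eq)
    qed
    have "f \<in> P \<or> \<one> \<ominus> f \<in> P" using Pr(4)[of f "\<one> \<ominus> f"] f(1) f1 Pi(2) by simp
    thus ?thesis
    proof
      assume "f \<in> P" thus ?thesis using kill f(2) by blast
    next
      assume "\<one> \<ominus> f \<in> P"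
      hence "e \<otimes> (\<one> \<ominus> f) = \<zero>" using kill f2 by blast
      hence "e \<ominus> e \<otimes> f = \<zero>" using e(1) f(1) by (simp add: minus_eq r_distr r_minus)
      thus ?thesis using e(1) f(1) by (simp add: r_right_minus_eq)
    qed
  qed
  show ?thesis
  proof (cases "\<exists>s\<in>carrier R - P. s \<otimes> p = \<zero>")
    case True
    then obtain s where s: "s \<in> carrier R" "s \<notin> P" "s \<otimes> p [^] (1::nat) = \<zero>" using p(1) by auto
    obtain e where e: "e \<in> carrier R" "e \<otimes> e = e" "e \<notin> P" "e \<otimes> p [^] (1::nat) = \<zero>"
      by (rule idempotent_of_minimal_prime[OF H P min p s])
    have "domain (idem_ring R e)" by (rule idem_ring_domain[OF e(1,2) P p e(3)]) (use e(4) p(1) in simp)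
    moreover have "primes_contain_uinv (idem_ring R e)"
      by (rule idempotent_quotient.primes_contain_uinv_image[OF idem_ring_quotient[OF e(1,2)] H'])
    ultimately have "krull_domain (idem_ring R e)" by (rule domain.krull_domain_of_uinv_primes)
    thus ?thesis using that e conn by blast
  next
    case False
    obtain s and n :: nat where s: "s \<in> carrier R" "s \<notin> P" "s \<otimes> p [^] n = \<zero>"
      by (rule minimal_prime_annihilated_power[OF P min pP])
    obtain e where e: "e \<in> carrier R" "e \<otimes> e = e" "e \<notin> P" "e \<otimes> p [^] n = \<zero>"
      by (rule idempotent_of_minimal_prime[OF H P min p s])
    have n: "n \<ge> 1"
    proof (rule ccontr)
      assume "\<not> n \<ge> 1"
      hence "e = \<zero>" using e(1,4) by (simp add: not_less_eq_eq)
      thus False using e(3) Pi(2) by simp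
    qed
    have zS: "\<zero>\<^bsub>idem_ring R e\<^esub> = \<zero>" by (simp add: idem_ring_def)
    interpret q: idempotent_quotient R "idem_ring R e" "\<lambda>x. e \<otimes> x" e by (rule idem_ring_quotient[OF e(1,2)])
    let ?S = "idem_ring R e" and ?h = "\<lambda>x. e \<otimes> x"
    have fP: "\<one> \<ominus> e \<in> P" by (rule q.compl_mem_prime[OF P e(3)])
    \<comment> \<open>A good prime above \<open>P\<close> would yield an annihilator of
      \<open>p\<close> outside itself, hence outside \<open>P\<close>, which this case
      excludes.\<close>
    have no_good: "\<not> P \<subseteq> Q" if Q: "good_prime R Q" for Q
    proof
      assume sub: "P \<subseteq> Q"
      have "P \<noteq> Q" using uinv_regular[OF good_primeD(2,4)[OF Q]] nreg by blast
      thus False using annihilator_of_principal_prime[OF P p Q] sub False by blast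
    qed
    \<comment> \<open>A larger \<open>N\<close> would be nonprincipal and so contain a regular
      \<open>r\<close>, and with it \<open>reg_lift r\<close>. That element is a unit of
      \<open>R\<close> by the local criterion: no good prime contains \<open>P\<close>, so each
      contains \<open>e\<close> and misses \<open>\<one> \<ominus> e\<close>, on which
      \<open>reg_lift r\<close> acts as the identity.\<close>
    have eq: "N = P" if N: "primeideal N R" "P \<subseteq> N" "e \<notin> N" for N
    proof (rule ccontr)
      assume "N \<noteq> P"
      hence PN: "P \<subset> N" using N(2) by blast
      have "\<not> principalideal N R"
      proof
        assume "principalideal N R"
        then obtain s where "s \<in> carrier R" "s \<notin> N" "s \<otimes> p = \<zero>"
          using principal_prime_over_principal[OF P p N(1) _ PN] by blast
        thus False using False PN by blast
      qed
      then obtain Q where "primeideal Q R" "Q \<subseteq> N" "uinv R Q"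
        using H N(1) unfolding nonprincipal_primes_contain_uinv_def by blast
      then obtain r where r: "r \<in> N" "r \<in> regular_elements R" using uinv_regular[OF primeidealD(1)] by blast
      note Ni = idealD[OF primeidealD(1)[OF N(1)]]
      have rc: "r \<in> carrier R" using r(1) Ni(1) by blast
      have lN: "q.reg_lift r \<in> N"
        unfolding q.reg_lift_def using Ni(3) Ni(5)[OF e(1) r(1)] fP N(2) by blast
      have lr: "q.reg_lift r \<in> regular_elements R" by (rule q.regular_lift[OF rc q.regular_hom[OF r(2)]])
      have "q.reg_lift r divides \<one>"
      proof (rule divides_of_good_primes[OF H' one_closed lr])
        fix Q assume Q: "good_prime R Q"
        note Qr = good_primeD[OF Q]
        have "p \<notin> Q" using no_good[OF Q] cgenideal_minimal[OF Qr(2), of p] p(2) by blast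
        hence "p [^] n \<notin> Q" using primeideal_pow[OF Qr(1) p(1)] by blast
        hence eQ: "e \<in> Q" using primeidealD(4)[OF Qr(1), of e "p [^] n"] e(1,4) nat_pow_closed[OF p(1)] idealD(2)[OF Qr(2)] by metis
        have "\<one> \<ominus> e \<notin> Q"
        proof
          assume "\<one> \<ominus> e \<in> Q"
          hence "(\<one> \<ominus> e) \<oplus> e \<in> Q" using idealD(3)[OF Qr(2)] eQ by blast
          thus False using primeidealD(2)[OF Qr(1)] unfolding q.e_compl_add by blast
        qed
        moreover have "\<one> \<otimes> (\<one> \<ominus> e) = q.reg_lift r \<otimes> (\<one> \<ominus> e)"
          unfolding q.reg_lift_mult_compl[OF rc] by (rule l_one[OF minus_closed[OF one_closed e(1)]])
        hence "q.reg_lift r divides (\<one> \<otimes> (\<one> \<ominus> e))"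
          by (rule dividesI[OF minus_closed[OF one_closed e(1)]])
        ultimately show "\<exists>d\<in>carrier R - Q. q.reg_lift r divides (\<one> \<otimes> d)" using e(1) by blast
      qed
      then obtain c where "c \<in> carrier R" "\<one> = q.reg_lift r \<otimes> c" unfolding factor_def by blast
      hence "\<one> \<in> N" using Ni(6)[OF _ lN] by simp
      thus False using primeidealD(2)[OF N(1)] by blast
    qed
    have "special_primary_ring ?S"
    proof (rule q.S.special_primary_ringI[where n = n])
      show M: "primeideal (?h ` P) ?S" by (rule q.image_primeideal[OF P e(3)])
      show "e \<otimes> p \<in> carrier ?S" using q.hom_closed p(1) by simp
      show "?h ` P = PIdl\<^bsub>?S\<^esub> (e \<otimes> p)"
      proof
        show "PIdl\<^bsub>?S\<^esub> (e \<otimes> p) \<subseteq> ?h ` P"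
          by (rule q.S.cgenideal_minimal[OF q.S.primeidealD(1)[OF M]]) (use pP in blast)
        show "?h ` P \<subseteq> PIdl\<^bsub>?S\<^esub> (e \<otimes> p)"
        proof (rule image_subsetI)
          fix y assume "y \<in> P"
          then obtain c where c: "c \<in> carrier R" "y = c \<otimes> p" using p(2) unfolding cgenideal_def by blast
          have "e \<otimes> y = (e \<otimes> c) \<otimes>\<^bsub>?S\<^esub> (e \<otimes> p)" unfolding c(2) by (rule q.hom_mult[OF c(1) p(1)])
          moreover have "e \<otimes> c \<in> carrier ?S" using q.hom_closed c(1) by simp
          ultimately show "e \<otimes> y \<in> PIdl\<^bsub>?S\<^esub> (e \<otimes> p)" unfolding cgenideal_def by blast
        qed
      qed
      show "n \<ge> 1" by (rule n)
      show "(e \<otimes> p) [^]\<^bsub>?S\<^esub> n = \<zero>\<^bsub>?S\<^esub>"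
        using q.ring.hom_nat_pow[OF p(1), of n] unfolding e(4) zS by (rule sym)
      fix N assume N: "primeideal N ?S" "?h ` P \<subseteq> N"
      note Nv = q.vimage_primeideal[OF N(1)]
      have "{x \<in> carrier R. e \<otimes> x \<in> N} = P" by (rule eq[OF Nv(1) _ Nv(2)]) (use N(2) Pi(1) in auto)
      moreover have "?h ` {x \<in> carrier R. e \<otimes> x \<in> N} = N"
        by (rule q.image_vimage) (use q.S.idealD(1)[OF q.S.primeidealD(1)[OF N(1)]] in blast)
      ultimately show "N = ?h ` P" by simp
    qed
    thus ?thesis using that e conn by blast
  qed
qed

end

section \<open>Direct products of lists of rings\<close>

lemma RDirProd_list_Cons_mem:
  "a # as \<in> carrier (RDirProd_list (S # Ss)) \<longleftrightarrow> a \<in> carrier S \<and> as \<in> carrier (RDirProd_list Ss)"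
  by (auto simp: RDirProd_list_carrier)

lemma RDirProd_list_Cons_cases:
  assumes "x \<in> carrier (RDirProd_list (S # Ss))"
  obtains a as where "x = a # as" "a \<in> carrier S" "as \<in> carrier (RDirProd_list Ss)"
  using assms by (auto simp: RDirProd_list_carrier)

lemma RDirProd_list_Cons_ops:
  assumes "a \<in> carrier S" "as \<in> carrier (RDirProd_list Ss)" "b \<in> carrier S" "bs \<in> carrier (RDirProd_list Ss)"
  shows "(a # as) \<otimes>\<^bsub>RDirProd_list (S # Ss)\<^esub> (b # bs) = (a \<otimes>\<^bsub>S\<^esub> b) # (as \<otimes>\<^bsub>RDirProd_list Ss\<^esub> bs)"
    and "(a # as) \<oplus>\<^bsub>RDirProd_list (S # Ss)\<^esub> (b # bs) = (a \<oplus>\<^bsub>S\<^esub> b) # (as \<oplus>\<^bsub>RDirProd_list Ss\<^esub> bs)"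
proof -
  have c: "(a, as) \<in> carrier (RDirProd S (RDirProd_list Ss))" "(b, bs) \<in> carrier (RDirProd S (RDirProd_list Ss))"
    using assms by (auto simp: RDirProd_carrier)
  show "(a # as) \<otimes>\<^bsub>RDirProd_list (S # Ss)\<^esub> (b # bs) = (a \<otimes>\<^bsub>S\<^esub> b) # (as \<otimes>\<^bsub>RDirProd_list Ss\<^esub> bs)"
    using ring_hom_mult[OF RDirProd_list_hom1 c] by (simp add: RDirProd_def DirProd_def monoid.defs)
  show "(a # as) \<oplus>\<^bsub>RDirProd_list (S # Ss)\<^esub> (b # bs) = (a \<oplus>\<^bsub>S\<^esub> b) # (as \<oplus>\<^bsub>RDirProd_list Ss\<^esub> bs)"
    using ring_hom_add[OF RDirProd_list_hom1 c] by (simp add: RDirProd_def DirProd_def monoid.defs)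
qed

lemma RDirProd_list_Cons_one: "\<one>\<^bsub>RDirProd_list (S # Ss)\<^esub> = \<one>\<^bsub>S\<^esub> # \<one>\<^bsub>RDirProd_list Ss\<^esub>"
  by (simp add: RDirProd_list_one)

lemma RDirProd_list_cring:
  assumes "\<And>S. S \<in> set Ss \<Longrightarrow> cring S"
  shows "cring (RDirProd_list Ss)"
proof -
  have r: "ring (RDirProd_list Ss)"
    by (rule RDirProd_list_is_ring) (use assms cring.axioms(1) nth_mem in blast)
  have "x \<otimes>\<^bsub>RDirProd_list Ss\<^esub> y = y \<otimes>\<^bsub>RDirProd_list Ss\<^esub> x"
    if "x \<in> carrier (RDirProd_list Ss)" "y \<in> carrier (RDirProd_list Ss)" for x y
    using assms that
  proof (induction Ss arbitrary: x y)
    case Nil thus ?case by (simp add: monoid.defs)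
  next
    case (Cons S Ss)
    obtain a as where x: "x = a # as" "a \<in> carrier S" "as \<in> carrier (RDirProd_list Ss)"
      using Cons.prems(2) by (rule RDirProd_list_Cons_cases)
    obtain b bs where y: "y = b # bs" "b \<in> carrier S" "bs \<in> carrier (RDirProd_list Ss)"
      using Cons.prems(3) by (rule RDirProd_list_Cons_cases)
    interpret S: cring S using Cons.prems(1) by simp
    have "as \<otimes>\<^bsub>RDirProd_list Ss\<^esub> bs = bs \<otimes>\<^bsub>RDirProd_list Ss\<^esub> as"
      by (rule Cons.IH[OF _ x(3) y(3)]) (use Cons.prems(1) in simp)
    thus ?case unfolding x(1) y(1) using x y S.m_comm by (simp add: RDirProd_list_Cons_ops)
  qed
  thus ?thesis by (intro cring.intro r comm_monoid.intro comm_monoid_axioms.intro ring.axioms(2)[OF r]) auto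
qed

text \<open>The new idempotent is \<open>e\<close> times a lift of \<open>f\<close>. It is outside
  \<open>P\<close> because its image \<open>f\<close> is outside the image of
  \<open>P\<close>.\<close>

lemma idempotent_quotient_comp:
  fixes R (structure) and S (structure) and T (structure)
  assumes hq: "idempotent_quotient R S h e" and gq: "idempotent_quotient S T g f"
    and P: "primeideal P R" "e \<notin> P" "f \<notin> h ` P"
  obtains e' where "idempotent_quotient R T (\<lambda>x. g (h x)) e'" "e' \<notin> P"
proof -
  interpret h: idempotent_quotient R S h e by (rule hq)
  interpret g: idempotent_quotient S T g f by (rule gq)
  obtain f' where f': "f' \<in> carrier R" "h f' = f" using h.lift[OF g.e_carrier] by blast
  have "(\<lambda>x. g (h x)) \<in> ring_hom R T"
    using ring_hom_trans[OF h.homh g.homh] by (simp add: comp_def)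
  hence "ring_hom_cring R T (\<lambda>x. g (h x))"
    by (intro ring_hom_cring.intro ring_hom_cring_axioms.intro h.R.is_cring g.S.is_cring)
  moreover have "(\<lambda>x. g (h x)) ` carrier R = carrier T"
    using h.surj g.surj by (metis image_image)
  moreover have "g (h (e \<otimes>\<^bsub>R\<^esub> f')) = \<one>\<^bsub>T\<^esub>" using f' by simp
  moreover have "(e \<otimes>\<^bsub>R\<^esub> f') \<otimes>\<^bsub>R\<^esub> x = \<zero>\<^bsub>R\<^esub>" if x: "x \<in> carrier R" "g (h x) = \<zero>\<^bsub>T\<^esub>" for x
  proof -
    have "f \<otimes>\<^bsub>S\<^esub> h x = \<zero>\<^bsub>S\<^esub>" by (rule g.kernel) (use x in auto)
    hence "h (f' \<otimes>\<^bsub>R\<^esub> x) = \<zero>\<^bsub>S\<^esub>" using f' x(1) by simp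
    hence "e \<otimes>\<^bsub>R\<^esub> (f' \<otimes>\<^bsub>R\<^esub> x) = \<zero>\<^bsub>R\<^esub>" by (intro h.kernel) (use f' x in auto)
    thus ?thesis using f' x(1) by (simp add: h.R.m_assoc)
  qed
  ultimately have "idempotent_quotient R T (\<lambda>x. g (h x)) (e \<otimes>\<^bsub>R\<^esub> f')"
    by (intro idempotent_quotient.intro idempotent_quotient_axioms.intro) (use f' in auto)
  moreover have "e \<otimes>\<^bsub>R\<^esub> f' \<notin> P"
  proof
    assume "e \<otimes>\<^bsub>R\<^esub> f' \<in> P"
    hence "h (e \<otimes>\<^bsub>R\<^esub> f') \<in> h ` P" by blast
    thus False using P(3) f' by simp
  qed
  ultimately show ?thesis by (rule that)
qed

lemma RDirProd_list_head_quotient: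
  assumes "\<And>T. T \<in> set (S # Ss) \<Longrightarrow> cring T"
  shows "idempotent_quotient (RDirProd_list (S # Ss)) S hd (\<one>\<^bsub>S\<^esub> # \<zero>\<^bsub>RDirProd_list Ss\<^esub>)"
    and "idempotent_quotient (RDirProd_list (S # Ss)) (RDirProd_list Ss) tl (\<zero>\<^bsub>S\<^esub> # \<one>\<^bsub>RDirProd_list Ss\<^esub>)"
proof -
  let ?L = "RDirProd_list (S # Ss)" and ?L' = "RDirProd_list Ss"
  interpret S: cring S using assms by simp
  interpret L': cring ?L' by (rule RDirProd_list_cring) (use assms in simp)
  interpret L: cring ?L by (rule RDirProd_list_cring) (use assms in simp)
  have z: "\<zero>\<^bsub>?L\<^esub> = \<zero>\<^bsub>S\<^esub> # \<zero>\<^bsub>?L'\<^esub>" by (rule RDirProd_list_zero')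
  have "hd \<in> ring_hom ?L S"
    by (rule ring_hom_memI) (auto elim!: RDirProd_list_Cons_cases simp: RDirProd_list_Cons_ops RDirProd_list_Cons_one)
  hence hd: "ring_hom_cring ?L S hd"
    by (intro ring_hom_cring.intro ring_hom_cring_axioms.intro L.is_cring S.is_cring)
  have "tl \<in> ring_hom ?L ?L'"
    by (rule ring_hom_memI) (auto elim!: RDirProd_list_Cons_cases simp: RDirProd_list_Cons_ops RDirProd_list_Cons_one)
  hence tl: "ring_hom_cring ?L ?L' tl"
    by (intro ring_hom_cring.intro ring_hom_cring_axioms.intro L.is_cring L'.is_cring)
  have "a \<in> hd ` carrier ?L" if "a \<in> carrier S" for a
    using that by (intro image_eqI[of _ _ "a # \<zero>\<^bsub>?L'\<^esub>"]) (auto simp: RDirProd_list_Cons_mem)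
  hence hds: "hd ` carrier ?L = carrier S" by (auto elim!: RDirProd_list_Cons_cases)
  have "as \<in> tl ` carrier ?L" if "as \<in> carrier ?L'" for as
    using that by (intro image_eqI[of _ _ "\<zero>\<^bsub>S\<^esub> # as"]) (auto simp: RDirProd_list_Cons_mem)
  hence tls: "tl ` carrier ?L = carrier ?L'" by (auto elim!: RDirProd_list_Cons_cases)
  show "idempotent_quotient ?L S hd (\<one>\<^bsub>S\<^esub> # \<zero>\<^bsub>?L'\<^esub>)"
    by (intro idempotent_quotient.intro idempotent_quotient_axioms.intro hd hds)
       (auto elim!: RDirProd_list_Cons_cases simp: RDirProd_list_Cons_mem RDirProd_list_Cons_ops z)
  show "idempotent_quotient ?L ?L' tl (\<zero>\<^bsub>S\<^esub> # \<one>\<^bsub>?L'\<^esub>)"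
    by (intro idempotent_quotient.intro idempotent_quotient_axioms.intro tl tls)
       (auto elim!: RDirProd_list_Cons_cases simp: RDirProd_list_Cons_mem RDirProd_list_Cons_ops z)
qed

text \<open>The idempotents of the head and of the tail add up to one, so a prime misses one of
  them; in the tail case the prime is carried to the product of the tail. The empty product is the
  zero ring and has no primes.\<close>

lemma RDirProd_list_prime_quotient:
  assumes "\<And>S. S \<in> set Ss \<Longrightarrow> cring S" "primeideal P (RDirProd_list Ss)"
  shows "\<exists>S\<in>set Ss. \<exists>h e. idempotent_quotient (RDirProd_list Ss) S h e \<and> e \<notin> P"
  using assms
proof (induction Ss arbitrary: P)
  case Nil
  interpret P: primeideal P nil_ring using Nil.prems(2) by simp
  have c: "carrier nil_ring = {[]}" and z: "\<zero>\<^bsub>nil_ring\<^esub> = []" by (simp_all add: monoid.defs)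
  have "[] \<in> P" using cring.idealD(2)[OF P.is_cring P.is_ideal] unfolding z .
  hence "P = carrier nil_ring" using P.Icarr unfolding c by blast
  thus ?case using P.I_notcarr by blast
next
  case (Cons S Ss)
  let ?L = "RDirProd_list (S # Ss)" and ?L' = "RDirProd_list Ss"
  let ?e = "\<one>\<^bsub>S\<^esub> # \<zero>\<^bsub>?L'\<^esub>" and ?f = "\<zero>\<^bsub>S\<^esub> # \<one>\<^bsub>?L'\<^esub>"
  note q = RDirProd_list_head_quotient[OF Cons.prems(1)]
  interpret S: cring S using Cons.prems(1) by simp
  interpret L': cring ?L' by (rule RDirProd_list_cring) (use Cons.prems(1) in simp)
  interpret L: cring ?L by (rule RDirProd_list_cring) (use Cons.prems(1) in simp)
  show ?case
  proof (cases "?e \<in> P")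
    case False thus ?thesis using q(1) by (meson list.set_intros(1))
  next
    case True
    have fP: "?f \<notin> P"
    proof
      assume "?f \<in> P"
      hence "?e \<oplus>\<^bsub>?L\<^esub> ?f \<in> P" using L.idealD(3)[OF L.primeidealD(1)[OF Cons.prems(2)] True] by blast
      thus False using L.primeidealD(2)[OF Cons.prems(2)]
        by (simp add: RDirProd_list_Cons_ops RDirProd_list_Cons_one)
    qed
    have tP: "primeideal (tl ` P) ?L'" by (rule idempotent_quotient.image_primeideal[OF q(2) Cons.prems(2) fP])
    obtain T h e where T: "T \<in> set Ss" "idempotent_quotient ?L' T h e" "e \<notin> tl ` P"
      using Cons.IH[OF _ tP] Cons.prems(1) by (metis list.set_intros(2))
    obtain e' where "idempotent_quotient ?L T (\<lambda>x. h (tl x)) e'" "e' \<notin> P"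
      by (rule idempotent_quotient_comp[OF q(2) T(2) Cons.prems(2) fP T(3)])
    thus ?thesis using T(1) by (meson list.set_intros(2))
  qed
qed

section \<open>Characterization of general Krull rings\<close>

context cring
begin

lemma idem_map_ring_hom:
  assumes "\<And>e. e \<in> set es \<Longrightarrow> e \<in> carrier R \<and> e \<otimes> e = e"
  shows "(\<lambda>x. map (\<lambda>e. e \<otimes> x) es) \<in> ring_hom R (RDirProd_list (map (idem_ring R) es))"
  using assms
proof (induction es)
  case Nil show ?case by (rule ring_hom_memI) (auto simp: monoid.defs)
next
  case (Cons e es)
  have IH: "(\<lambda>x. map (\<lambda>e. e \<otimes> x) es) \<in> ring_hom R (RDirProd_list (map (idem_ring R) es))"
    using Cons by simp
  have h: "(\<lambda>x. e \<otimes> x) \<in> ring_hom R (idem_ring R e)"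
    using idem_ring_quotient[of e] Cons.prems[of e]
    by (simp add: idempotent_quotient_def ring_hom_cring_def ring_hom_cring_axioms_def)
  show ?case
  proof (rule ring_hom_memI)
    fix x assume "x \<in> carrier R"
    thus "map (\<lambda>e. e \<otimes> x) (e # es) \<in> carrier (RDirProd_list (map (idem_ring R) (e # es)))"
      using ring_hom_closed[OF IH] ring_hom_closed[OF h] by (simp add: RDirProd_list_Cons_mem)
  next
    fix x y assume xy: "x \<in> carrier R" "y \<in> carrier R"
    note c = ring_hom_closed[OF IH xy(1)] ring_hom_closed[OF IH xy(2)] ring_hom_closed[OF h xy(1)] ring_hom_closed[OF h xy(2)]
    show "map (\<lambda>e. e \<otimes> (x \<otimes> y)) (e # es) = map (\<lambda>e. e \<otimes> x) (e # es)
        \<otimes>\<^bsub>RDirProd_list (map (idem_ring R) (e # es))\<^esub> map (\<lambda>e. e \<otimes> y) (e # es)"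
      using ring_hom_mult[OF IH xy] ring_hom_mult[OF h xy] by (simp add: RDirProd_list_Cons_ops c)
    show "map (\<lambda>e. e \<otimes> (x \<oplus> y)) (e # es) = map (\<lambda>e. e \<otimes> x) (e # es)
        \<oplus>\<^bsub>RDirProd_list (map (idem_ring R) (e # es))\<^esub> map (\<lambda>e. e \<otimes> y) (e # es)"
      using ring_hom_add[OF IH xy] ring_hom_add[OF h xy] by (simp add: RDirProd_list_Cons_ops c)
  next
    show "map (\<lambda>e. e \<otimes> \<one>) (e # es) = \<one>\<^bsub>RDirProd_list (map (idem_ring R) (e # es))\<^esub>"
      using ring_hom_one[OF IH] ring_hom_one[OF h] by (simp add: RDirProd_list_Cons_one)
  qed
qed

text \<open>The last clause expresses that \<open>x\<close> has no component outside the given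
  idempotents. In the induction it makes the preimage for the tail vanish in the head component, so
  that the two parts can be added.\<close>

lemma idem_map_surj:
  assumes "\<And>e. e \<in> set es \<Longrightarrow> e \<in> carrier R \<and> e \<otimes> e = e" "distinct es"
    and "\<And>e f. \<lbrakk>e \<in> set es; f \<in> set es; e \<noteq> f\<rbrakk> \<Longrightarrow> e \<otimes> f = \<zero>"
    and "ys \<in> carrier (RDirProd_list (map (idem_ring R) es))"
  shows "\<exists>x\<in>carrier R. map (\<lambda>e. e \<otimes> x) es = ys
     \<and> (\<forall>f\<in>carrier R. (\<forall>e\<in>set es. f \<otimes> e = \<zero>) \<longrightarrow> f \<otimes> x = \<zero>)"
  using assms
proof (induction es arbitrary: ys)
  case Nil thus ?case by (intro bexI[of _ \<zero>]) auto
next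
  case (Cons e es)
  have e: "e \<in> carrier R" "e \<otimes> e = e" using Cons.prems(1) by auto
  obtain y zs where y: "ys = y # zs" "y \<in> carrier (idem_ring R e)" "zs \<in> carrier (RDirProd_list (map (idem_ring R) es))"
    using Cons.prems(4) by (auto elim: RDirProd_list_Cons_cases)
  have yc: "y \<in> carrier R" "e \<otimes> y = y" using y(2) by (auto simp: idem_ring_def)
  obtain x where x: "x \<in> carrier R" "map (\<lambda>e. e \<otimes> x) es = zs"
    "\<And>f. \<lbrakk>f \<in> carrier R; \<forall>e\<in>set es. f \<otimes> e = \<zero>\<rbrakk> \<Longrightarrow> f \<otimes> x = \<zero>"
    using Cons.IH[OF _ _ _ y(3)] Cons.prems(1-3) by auto
  have fy: "f \<otimes> y = \<zero>" if "f \<in> carrier R" "f \<otimes> e = \<zero>" for f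
  proof -
    have "f \<otimes> (e \<otimes> y) = (f \<otimes> e) \<otimes> y" using that(1) e(1) yc(1) by (simp only: m_assoc)
    thus ?thesis using that(2) yc by simp
  qed
  have "e \<otimes> x = \<zero>" by (rule x(3)[OF e(1)]) (use Cons.prems(2,3) in auto)
  hence 1: "e \<otimes> (y \<oplus> x) = y" using e(1) yc x(1) by (simp add: r_distr)
  have 2: "map (\<lambda>e. e \<otimes> (y \<oplus> x)) es = zs"
  proof -
    have "f \<otimes> (y \<oplus> x) = f \<otimes> x" if f: "f \<in> set es" for f
    proof -
      have "f \<in> carrier R" "f \<otimes> e = \<zero>" using f Cons.prems(1,2,3) by auto
      thus ?thesis using fy[of f] x(1) yc(1) by (simp add: r_distr)
    qed
    thus ?thesis using x(2) by (metis (no_types, lifting) map_eq_conv)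
  qed
  have 3: "f \<otimes> (y \<oplus> x) = \<zero>" if f: "f \<in> carrier R" "\<forall>e\<in>set (e # es). f \<otimes> e = \<zero>" for f
    using fy[of f] x(3)[of f] f x(1) yc(1) by (simp add: r_distr)
  have "map (\<lambda>e. e \<otimes> (y \<oplus> x)) (e # es) = ys" using 1 2 y(1) by simp
  thus ?case using 3 x(1) yc(1) by (intro bexI[of _ "y \<oplus> x"] conjI) auto
qed

lemma general_krull_ringI:
  assumes H: "nonprincipal_primes_contain_uinv R"
  shows "general_krull_ring R"
proof -
  let ?E = "{e \<in> carrier R. e \<otimes> e = e \<and> (krull_domain (idem_ring R e) \<or> special_primary_ring (idem_ring R e))
    \<and> (\<forall>f\<in>carrier R. f \<otimes> f = f \<longrightarrow> e \<otimes> f = \<zero> \<or> e \<otimes> f = e)}"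
  let ?I = "{x \<in> carrier R. \<exists>F. finite F \<and> F \<subseteq> ?E \<and> x \<in> Idl F}"
  have EF: "ideal (Idl F) R" "F \<subseteq> Idl F" "F \<subseteq> carrier R" if F: "F \<subseteq> ?E" for F
  proof -
    show c: "F \<subseteq> carrier R" using F by blast
    show "ideal (Idl F) R" by (rule genideal_ideal[OF c])
    show "F \<subseteq> Idl F" by (rule genideal_self[OF c])
  qed
  have I: "ideal ?I R"
  proof (rule idealI_cring)
    have "\<zero> \<in> Idl {}" using idealD(2)[OF EF(1)[of "{}"]] by blast
    thus "\<zero> \<in> ?I" by blast
  next
    fix a b assume "a \<in> ?I" "b \<in> ?I"
    then obtain F G where h: "a \<in> carrier R" "b \<in> carrier R" "finite F" "F \<subseteq> ?E" "a \<in> Idl F"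
      "finite G" "G \<subseteq> ?E" "b \<in> Idl G" by auto
    have U: "F \<union> G \<subseteq> ?E" using h(4,7) by blast
    have "a \<in> Idl (F \<union> G)" "b \<in> Idl (F \<union> G)"
      using subset_Idl_subset[OF EF(3)[OF U]] h(5,8) by blast+
    hence "a \<oplus> b \<in> Idl (F \<union> G)" by (rule idealD(3)[OF EF(1)[OF U]])
    moreover have "finite (F \<union> G)" using h by simp
    ultimately show "a \<oplus> b \<in> ?I" using U h(1,2) by blast
  next
    fix a x assume "a \<in> ?I" "x \<in> carrier R"
    then obtain F where h: "a \<in> carrier R" "x \<in> carrier R" "finite F" "F \<subseteq> ?E" "a \<in> Idl F" by auto
    have "x \<otimes> a \<in> Idl F" by (rule idealD(5)[OF EF(1)[OF h(4)] h(2,5)])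
    thus "x \<otimes> a \<in> ?I" using h by blast
  qed auto
  \<comment> \<open>If all of \<open>?E\<close> lay in a maximal ideal \<open>M\<close>, so would
    the idempotent \<open>e\<close> of a minimal prime inside \<open>M\<close>; but
    \<open>\<one> \<ominus> e\<close> is in that prime, hence in \<open>M\<close> as well.\<close>
  have "\<one> \<in> ?I"
  proof (rule ccontr)
    assume "\<one> \<notin> ?I"
    then obtain M where M: "maximalideal M R" "?I \<subseteq> M" by (rule exists_maximal[OF I])
    have Mp: "primeideal M R" by (rule maximalideal_prime[OF M(1)])
    obtain P where P: "primeideal P R" "P \<subseteq> M" and min: "\<And>Q. \<lbrakk>primeideal Q R; Q \<subseteq> P\<rbrakk> \<Longrightarrow> Q = P"
      using exists_minimal_prime[OF Mp] by blast
    obtain e where e: "e \<in> carrier R" "e \<otimes> e = e" "e \<notin> P"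
      "krull_domain (idem_ring R e) \<or> special_primary_ring (idem_ring R e)"
      "\<And>f. \<lbrakk>f \<in> carrier R; f \<otimes> f = f\<rbrakk> \<Longrightarrow> e \<otimes> f = \<zero> \<or> e \<otimes> f = e"
      using minimal_prime_factor[OF H P(1) min] by blast
    have eE: "{e} \<subseteq> ?E" using e by blast
    have "e \<in> ?I" using EF(2)[OF eE] e(1) eE by blast
    hence eM: "e \<in> M" using M(2) by blast
    have "\<one> \<ominus> e \<in> M"
      using idempotent_quotient.compl_mem_prime[OF idem_ring_quotient[OF e(1,2)] P(1) e(3)] P(2) by blast
    hence "(\<one> \<ominus> e) \<oplus> e \<in> M" using idealD(3)[OF primeidealD(1)[OF Mp]] eM by blast
    thus False using primeidealD(2)[OF Mp] e(1) by (simp add: minus_eq a_assoc l_neg)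
  qed
  then obtain F where F: "finite F" "F \<subseteq> ?E" "\<one> \<in> Idl F" by blast
  obtain es where es: "set es = F" "distinct es" using finite_distinct_list[OF F(1)] by blast
  have idem: "e \<in> carrier R \<and> e \<otimes> e = e" if "e \<in> set es" for e using that F(2) es(1) by blast
  \<comment> \<open>A nonzero product \<open>ef\<close> equals both \<open>e\<close> and
    \<open>f\<close>, each being indecomposable.\<close>
  have orth: "e \<otimes> f = \<zero>" if ef: "e \<in> set es" "f \<in> set es" "e \<noteq> f" for e f
  proof -
    have E: "e \<in> ?E" "f \<in> ?E" using ef(1,2) F(2) es(1) by blast+
    have "e \<otimes> f = \<zero> \<or> e \<otimes> f = e" "f \<otimes> e = \<zero> \<or> f \<otimes> e = f" using E by blast+
    moreover have "f \<otimes> e = e \<otimes> f" using E m_comm by blast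
    ultimately show ?thesis using ef(3) by metis
  qed
  let ?h = "\<lambda>x. map (\<lambda>e. e \<otimes> x) es" and ?L = "RDirProd_list (map (idem_ring R) es)"
  have hom: "?h \<in> ring_hom R ?L" by (rule idem_map_ring_hom[OF idem])
  \<comment> \<open>A difference of elements with equal images is killed by every member of
    \<open>F\<close>, hence by \<open>\<one>\<close>.\<close>
  have "inj_on ?h (carrier R)"
  proof (rule inj_onI)
    fix x y assume xy: "x \<in> carrier R" "y \<in> carrier R" "?h x = ?h y"
    have "ideal {z \<in> carrier R. z \<otimes> (x \<ominus> y) = \<zero>} R"
      by (rule idealI_cring) (use xy(1,2) in \<open>auto simp: l_distr m_assoc\<close>)
    moreover have "F \<subseteq> {z \<in> carrier R. z \<otimes> (x \<ominus> y) = \<zero>}"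
    proof
      fix e assume "e \<in> F"
      hence e: "e \<in> set es" "e \<in> carrier R" using es(1) idem by auto
      have "e \<otimes> x = e \<otimes> y" using xy(3) e(1) by simp
      hence "e \<otimes> (x \<ominus> y) = \<zero>" using e(2) xy(1,2) by (simp add: minus_eq r_distr r_minus r_neg)
      thus "e \<in> {z \<in> carrier R. z \<otimes> (x \<ominus> y) = \<zero>}" using e(2) by simp
    qed
    ultimately have "Idl F \<subseteq> {z \<in> carrier R. z \<otimes> (x \<ominus> y) = \<zero>}" by (rule genideal_minimal)
    hence "\<one> \<otimes> (x \<ominus> y) = \<zero>" using F(3) by blast
    thus "x = y" using xy(1,2) by (simp add: r_right_minus_eq)
  qed
  moreover have "?h ` carrier R = carrier ?L"
  proof
    show "?h ` carrier R \<subseteq> carrier ?L" using ring_hom_closed[OF hom] by blast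
    show "carrier ?L \<subseteq> ?h ` carrier R" using idem_map_surj[OF idem es(2) orth] by blast
  qed
  ultimately have "?h \<in> ring_iso R ?L" unfolding ring_iso_def bij_betw_def using hom by blast
  hence "R \<simeq> ?L" unfolding is_ring_iso_def by blast
  moreover have "\<forall>S\<in>set (map (idem_ring R) es). krull_domain S \<or> special_primary_ring S"
    using F(2) es(1) by auto
  ultimately show ?thesis unfolding general_krull_ring_def using is_cring by blast
qed

end

text \<open>The generator \<open>m\<close> of the maximal ideal is nilpotent, so it lies in
  \<open>P\<close>, and \<open>P\<close> is the maximal ideal.\<close>

lemma (in cring) special_primary_ring_prime:
  assumes spr: "special_primary_ring R" and P: "primeideal P R"
  obtains m where "m \<in> carrier R" "P = PIdl m"
proof -
  obtain M n where M: "maximalideal M R" "principalideal M R" "M [^]\<^bsub>ideals_set R\<^esub> (n::nat) = {\<zero>}"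
    using spr unfolding special_primary_ring_def by blast
  obtain m where m: "m \<in> carrier R" "M = PIdl m" using M(2) by (rule principalidealE)
  have mM: "m \<in> M" unfolding m(2) by (rule cgenideal_self[OF m(1)])
  have "m [^] k \<in> M [^]\<^bsub>ideals_set R\<^esub> k" for k :: nat
  proof (induction k)
    case 0 show ?case by (simp add: ideals_set_def)
  next
    case (Suc k)
    have "m [^] k \<otimes> m \<in> ideal_prod R (M [^]\<^bsub>ideals_set R\<^esub> k) M" by (rule ideal_prod.prod[OF Suc mM])
    thus ?case by (simp add: ideals_set_def)
  qed
  hence "m [^] n = \<zero>" using M(3) by blast
  hence "m [^] n \<in> P" using idealD(2)[OF primeidealD(1)[OF P]] by simp
  hence "m \<in> P" by (rule primeideal_pow[OF P m(1)])
  hence "M \<subseteq> P" unfolding m(2) by (rule cgenideal_minimal[OF primeidealD(1)[OF P]])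
  moreover have "P \<subseteq> carrier R" using idealD(1)[OF primeidealD(1)[OF P]] by blast
  ultimately have "P = M"
    using maximalideal.I_maximal[OF M(1) primeidealD(1)[OF P]] primeidealD(3)[OF P] by blast
  thus ?thesis using that m by blast
qed

text \<open>The prime \<open>P\<close> omits the idempotent of one of the factors \<open>S\<close>,
  so it is the preimage of its image there, and that image is not principal. This excludes an SPR,
  whose primes are all principal, and in a Krull domain it makes the image nonzero, hence
  \<open>u\<close>-invertible.\<close>

lemma (in cring) general_krull_ringD:
  assumes gk: "general_krull_ring R" and P: "primeideal P R" "\<not> principalideal P R"
  shows "uinv R P"
proof -
  obtain Ss :: "'a ring list" and \<phi> where Ss: "\<forall>S\<in>set Ss. krull_domain S \<or> special_primary_ring S"
    and \<phi>: "\<phi> \<in> ring_iso R (RDirProd_list Ss)"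
    using gk unfolding general_krull_ring_def is_ring_iso_def by blast
  let ?L = "RDirProd_list Ss"
  have crS: "cring S" if "S \<in> set Ss" for S
    using Ss that unfolding krull_domain_def special_primary_ring_def local_ring_def
    using domain.axioms(1) by blast
  have L: "cring ?L" by (rule RDirProd_list_cring[OF crS])
  note \<phi>r = ring_iso_memE(5)[OF \<phi>]
  have \<phi>h: "\<phi> \<in> ring_hom R ?L" using \<phi> unfolding ring_iso_def by blast
  have hc: "ring_hom_cring R ?L \<phi>"
    by (intro ring_hom_cring.intro ring_hom_cring_axioms.intro is_cring L \<phi>h)
  \<comment> \<open>The isomorphism is viewed as the quotient by the idempotent
    \<open>\<one>\<close>, so that it can be composed with a projection.\<close>
  have q1: "idempotent_quotient R ?L \<phi> \<one>"
  proof (intro idempotent_quotient.intro idempotent_quotient_axioms.intro hc)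
    show "\<phi> ` carrier R = carrier ?L" using \<phi>r unfolding bij_betw_def by blast
    show "\<phi> \<one> = \<one>\<^bsub>?L\<^esub>" by (rule ring_hom_one[OF \<phi>h])
    fix x assume x: "x \<in> carrier R" "\<phi> x = \<zero>\<^bsub>?L\<^esub>"
    have "\<phi> \<zero> = \<zero>\<^bsub>?L\<^esub>" by (rule ring_hom_cring.hom_zero[OF hc])
    hence "x = \<zero>" using \<phi>r x unfolding bij_betw_def by (metis inj_onD zero_closed)
    thus "\<one> \<otimes> x = \<zero>" by simp
  qed simp
  have oneP: "\<one> \<notin> P" by (rule primeidealD(2)[OF P(1)])
  have "primeideal (\<phi> ` P) ?L" by (rule idempotent_quotient.image_primeideal[OF q1 P(1) oneP])
  then obtain S g f where S: "S \<in> set Ss" "idempotent_quotient ?L S g f" "f \<notin> \<phi> ` P"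
    using RDirProd_list_prime_quotient[OF crS] by blast
  obtain h e where "idempotent_quotient R S h e" and eP: "e \<notin> P"
    using idempotent_quotient_comp[OF q1 S(2) P(1) oneP S(3)] by blast
  then interpret q: idempotent_quotient R S h e by simp
  have fP: "\<one> \<ominus> e \<in> P" by (rule q.compl_mem_prime[OF P(1) eP])
  note Pi = primeidealD(1)[OF P(1)]
  have hP: "primeideal (h ` P) S" by (rule q.image_primeideal[OF P(1) eP])
  have nonpr: "h ` P \<noteq> PIdl\<^bsub>S\<^esub> y" if "y \<in> carrier S" for y
    using q.principal_vimage[OF Pi fP that] P(2) by blast
  have "\<not> special_primary_ring S" using q.S.special_primary_ring_prime[OF _ hP] nonpr by metis
  hence K: "krull_domain S" using Ss S(1) by blast
  have "PIdl\<^bsub>S\<^esub> \<zero>\<^bsub>S\<^esub> = {\<zero>\<^bsub>S\<^esub>}" using q.S.cgenideal_eq_genideal[OF q.S.zero_closed] q.S.genideal_zero by simp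
  hence "h ` P \<noteq> {\<zero>\<^bsub>S\<^esub>}" using nonpr[OF q.S.zero_closed] by simp
  then obtain y where y: "y \<in> h ` P" "y \<noteq> \<zero>\<^bsub>S\<^esub>"
    using q.S.idealD(2)[OF q.S.primeidealD(1)[OF hP]] by blast
  have "domain S" using K unfolding krull_domain_def by blast
  hence "uinv S (h ` P)" by (rule domain.krull_domain_uinv[OF _ K q.S.primeidealD(1)[OF hP] y])
  hence "uinv R {x \<in> carrier R. h x \<in> h ` P}" by (rule q.uinv_vimage[OF q.S.primeidealD(1)[OF hP]])
  thus ?thesis unfolding q.vimage_image[OF Pi fP] .
qed

theorem theorem6p18:
  fixes R :: "('a, 'm) ring_scheme" (structure)
  assumes "cring R" and "\<one> \<noteq> \<zero>"
  shows "general_krull_ring R \<longleftrightarrow>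
    (\<forall>P. primeideal P R \<and> \<not> principalideal P R \<longrightarrow>
      (\<exists>Q. primeideal Q R \<and> Q \<subseteq> P \<and> u_invertible R (tq_embed R ` Q)))"
proof -
  interpret cring R by (rule assms(1))
  have u: "u_invertible R (tq_embed R ` Q) \<longleftrightarrow> uinv R Q" if "primeideal Q R" for Q
    by (rule u_invertible_iff[OF primeidealD(1)[OF that]])
  show ?thesis
  proof
    assume "general_krull_ring R"
    thus "\<forall>P. primeideal P R \<and> \<not> principalideal P R \<longrightarrow>
      (\<exists>Q. primeideal Q R \<and> Q \<subseteq> P \<and> u_invertible R (tq_embed R ` Q))"
      using general_krull_ringD u by blast
  next
    assume "\<forall>P. primeideal P R \<and> \<not> principalideal P R \<longrightarrow>
      (\<exists>Q. primeideal Q R \<and> Q \<subseteq> P \<and> u_invertible R (tq_embed R ` Q))"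
    hence "nonprincipal_primes_contain_uinv R"
      unfolding nonprincipal_primes_contain_uinv_def using u by blast
    thus "general_krull_ring R" by (rule general_krull_ringI)
  qed
qed

end
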